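(* Fix $\alpha\in(0,1)$ and let $a(\theta)$ satisfy $\lim_{\theta\to\infty}a(\theta)=\infty$ and $\lim_{\theta\to\infty}a(\theta)/\theta=0$. Let $$\beta(\alpha,\theta)=\log\theta-(\alpha+1)\log\log\theta-\log\Gamma(1-\alpha).$$ Then, as $\theta\to\infty$, the family of laws of $$a(\theta)\Big(P_1(\alpha,\theta)-\tfrac{\beta(\alpha,\theta)}{\theta},\ \ldots,\ P_n(\alpha,\theta)-\tfrac{\beta(\alpha,\theta)}{\theta},\ \ldots\Big)$$ satisfies a large deviation principle on $\mathbb R^{\infty}$ with speed $\frac{a(\theta)}{\theta}$ and rate function $$I(x_1,x_2,\ldots)=\begin{cases}\sum_{i=1}^{\infty}x_i, & x_1\ge x_2\ge\cdots\ge 0,\\ \infty,&\text{otherwise.}\end{cases}$$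
   Context: For $\alpha\in(0,1)$ and $\theta>0$, let $U_1,U_2,\ldots$ be independent with $U_k\sim \mathrm{Beta}(1-\alpha,\theta+k\alpha)$, and set $X_1^{\alpha,\theta}=U_1$, $X_n^{\alpha,\theta}=(1-U_1)\cdots(1-U_{n-1})U_n$ for $n\ge2$. Then $\sum_k X_k^{\alpha,\theta}=1$ almost surely. $\mathbf P(\alpha,\theta)=(P_1(\alpha,\theta),P_2(\alpha,\theta),\ldots)$ denotes the sequence $(X_k^{\alpha,\theta})_k$ rearranged in descending order; its law $\Pi_{\alpha,\theta}$ is the two-parameter Poisson-Dirichlet distribution. $\mathbb R^\infty$ (real sequences) carries the product topology. A family of laws $\mu_\theta$ on a topological space $E$ satisfies a large deviation principle as $\theta\to\infty$ with speed $\lambda(\theta)\to0$ and rate function $I:E\to[0,\infty]$ (lower semicontinuous) if $\limsup_{\theta\to\infty}\lambda(\theta)\log\mu_\theta(F)\le-\inf_F I$ for every closed $F$ and $\liminf_{\theta\to\infty}\lambda(\theta)\log\mu_\theta(G)\ge-\inf_G I$ for every open $G$. *)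

theory Defs
  imports "HOL-Probability.Probability"
begin

definition beta_density :: "real \<Rightarrow> real \<Rightarrow> real \<Rightarrow> real" where
  "beta_density p q u =
     (if 0 < u \<and> u < 1 then u powr (p - 1) * (1 - u) powr (q - 1) / Beta p q else 0)"

(* All sequences are indexed from 0, so index k here is index k + 1 in the usual
   one-based notation; in particular U k is distributed as Beta(1 - \<alpha>, \<theta> + (k + 1) \<alpha>). *)
definition PD_sticks ::
  "real \<Rightarrow> real \<Rightarrow> 'w measure \<Rightarrow> (nat \<Rightarrow> 'w \<Rightarrow> real) \<Rightarrow> bool" where
  "PD_sticks \<alpha> \<theta> M U \<longleftrightarrow>
     prob_space M \<and>
     prob_space.indep_vars M (\<lambda>_. borel) U UNIV \<and>
     (\<forall>k. distributed M lborel (U k)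
            (\<lambda>u. ennreal (beta_density (1 - \<alpha>) (\<theta> + real (Suc k) * \<alpha>) u)))"

definition stick_breaking :: "(nat \<Rightarrow> real) \<Rightarrow> nat \<Rightarrow> real" where
  "stick_breaking u n = (\<Prod>k<n. 1 - u k) * u n"

definition descending_rearrangement :: "(nat \<Rightarrow> real) \<Rightarrow> (nat \<Rightarrow> real) \<Rightarrow> bool" where
  "descending_rearrangement x y \<longleftrightarrow> decseq y \<and> (\<exists>\<sigma>. bij \<sigma> \<and> y = x \<circ> \<sigma>)"

lemma descending_rearrangement_unique:
  assumes "descending_rearrangement x y" "descending_rearrangement x z"
  shows "y = z"
proof -
  have le: "z n \<le> y n"
    if "decseq y" "decseq z" "bij \<tau>" "z = y \<circ> \<tau>" for y z :: "nat \<Rightarrow> real" and \<tau> n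
  proof -
    have "card (\<tau> ` {..n}) = Suc n"
      using that(3) by (simp add: card_image bij_is_inj inj_on_subset[OF bij_is_inj])
    then have "\<not> \<tau> ` {..n} \<subseteq> {..<n}"
      using card_mono[of "{..<n}" "\<tau> ` {..n}"] by auto
    then obtain i where "i \<le> n" "n \<le> \<tau> i" by force
    then have "z n \<le> z i" "y (\<tau> i) \<le> y n"
      using that(1,2) by (auto simp: decseq_def)
    then show ?thesis using that(4) by simp
  qed
  obtain \<sigma> \<rho> where *: "decseq y" "decseq z" "bij \<sigma>" "bij \<rho>" "y = x \<circ> \<sigma>" "z = x \<circ> \<rho>"
    using assms by (auto simp: descending_rearrangement_def)
  have "z = y \<circ> (inv \<sigma> \<circ> \<rho>)" "y = z \<circ> (inv \<rho> \<circ> \<sigma>)"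
    using * by (auto simp: fun_eq_iff bij_is_surj surj_f_inv_f)
  moreover have "bij (inv \<sigma> \<circ> \<rho>)" "bij (inv \<rho> \<circ> \<sigma>)"
    using * by (auto intro: bij_comp bij_imp_bij_inv)
  ultimately have "z n \<le> y n \<and> y n \<le> z n" for n
    using le *(1,2) by blast
  then show ?thesis by (intro ext antisym) auto
qed

(* A descending rearrangement exists for every sequence of positive reals tending to 0, hence
   almost surely for the stick-breaking sequence.  On the exceptional null set, where none
   exists, the value is an unspecified constant. *)
definition ranked :: "(nat \<Rightarrow> real) \<Rightarrow> nat \<Rightarrow> real" where
  "ranked x = (THE y. descending_rearrangement x y)"

definition PD_sequence :: "(nat \<Rightarrow> 'w \<Rightarrow> real) \<Rightarrow> 'w \<Rightarrow> nat \<Rightarrow> real" where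
  "PD_sequence U \<omega> = ranked (stick_breaking (\<lambda>k. U k \<omega>))"

definition beta_center :: "real \<Rightarrow> real \<Rightarrow> real" where
  "beta_center \<alpha> \<theta> = ln \<theta> - (\<alpha> + 1) * ln (ln \<theta>) - ln (Gamma (1 - \<alpha>))"

(* In HOL ln 0 = 0, so the convention log 0 = -\<infinity> is made explicit. *)
definition elog :: "real \<Rightarrow> ereal" where
  "elog p = (if p = 0 then - \<infinity> else ereal (ln p))"

definition rate_function :: "('a::topological_space \<Rightarrow> ereal) \<Rightarrow> bool" where
  "rate_function I \<longleftrightarrow> (\<forall>x. 0 \<le> I x) \<and> (\<forall>c. closed {x. I x \<le> c})"

(* The speed r is positive near the limit and tends to 0; the laws are required to be genuine
   Borel probability measures near the limit. *)
definition large_deviation_principle ::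
  "'i filter \<Rightarrow> ('i \<Rightarrow> 'a::topological_space measure) \<Rightarrow> ('i \<Rightarrow> real) \<Rightarrow> ('a \<Rightarrow> ereal) \<Rightarrow> bool" where
  "large_deviation_principle F \<mu> r I \<longleftrightarrow>
     (\<forall>\<^sub>F i in F. prob_space (\<mu> i) \<and> sets (\<mu> i) = sets borel) \<and>
     filterlim r (at_right 0) F \<and>
     rate_function I \<and>
     (\<forall>C. closed C \<longrightarrow>
        Limsup F (\<lambda>i. ereal (r i) * elog (measure (\<mu> i) C)) \<le> - (INF x\<in>C. I x)) \<and>
     (\<forall>G. open G \<longrightarrow>
        - (INF x\<in>G. I x) \<le> Liminf F (\<lambda>i. ereal (r i) * elog (measure (\<mu> i) G)))"

definition PD_rate :: "(nat \<Rightarrow> real) \<Rightarrow> ereal" where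
  "PD_rate x = (if decseq x \<and> (\<forall>i. 0 \<le> x i) then (\<Sum>i. ereal (x i)) else \<infinity>)"

end

theory Submission
  imports Defs "HOL-Real_Asymp.Real_Asymp"
begin

text \<open>
  On the scale \<open>y = \<beta>/\<theta> + x/a\<close> the expected number of stick fractions \<open>U\<^sub>k\<close> above \<open>y\<close> is
  \<open>exp (-(\<theta>/a) x)\<close> up to a subexponential factor, and only the first \<open>\<theta>/log \<theta>\<close> of them matter.
  Everything is reduced to the independent \<open>U\<^sub>k\<close>, so no correlation functions or size-biasing are
  needed.  From above, \<open>X\<^sub>k \<le> U\<^sub>k\<close>, and an exponential Chebyshev inequality for
  \<open>\<Sum>\<^sub>k max 0 (\<theta> U\<^sub>k - \<beta>)\<close>, whose moment generating function is bounded uniformly in \<open>\<theta>\<close> for every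
  parameter below 1, controls the sum of the positive parts of the ranked coordinates.  From
  below, the first \<open>\<theta>/log \<theta>\<close> sticks remove only a fraction of order \<open>1/log \<theta>\<close> of the unit length,
  so \<open>X\<^sub>k\<close> is close to \<open>U\<^sub>k\<close> and independence of disjoint blocks of sticks gives the joint
  probability of several large coordinates.  The same comparison shows that a coordinate lies below
  \<open>\<beta>/\<theta> - \<delta>/a\<close> with superexponentially small probability.  Compactness of the level sets lifts these
  finite-dimensional estimates to the product topology; for open sets, the event that the
  coordinates exceed the prescribed values is much more likely than the event that they exceed
  them and their sum is noticeably larger still.
\<close>

section \<open>Descending rearrangements and stick breaking\<close>

text \<open>The centering can be read off the summed beta densities. An early fraction has density
  of order \<open>\<theta> powr (1 - \<alpha>) * u powr (- \<alpha>) * exp (- \<theta> * u)\<close>;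
  the growing second parameter damps this by about \<open>exp (- \<alpha> * u)\<close> per index, so
  summing over all sticks contributes a further \<open>1 / (\<alpha> * u)\<close>. The expected
  number of fractions above \<open>b / \<theta>\<close> is thus of order
  \<open>\<theta> * b powr (- \<alpha> - 1) * exp (- b)\<close>, and
  \<open>b = beta_center \<alpha> \<theta>\<close> keeps it of order 1: in the coefficient
  \<open>\<alpha> + 1\<close> the \<alpha> stems from one density, the 1 from the number of sticks.
  The obstacle is that \<open>\<theta> / a \<theta>\<close>, against which errors in the exponent
  are measured, may grow much slower or much faster than \<open>ln \<theta>\<close>. Hence the
  bounds for fixed \<theta> keep every correction explicit, and the lower tail splits into two
  regimes. The bound on the moment generating function blows up as its parameter tends to 1, so
  upper bounds lose an arbitrarily small part of the rate, recovered at the end by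
  approximation.\<close>

lemma descending_rearrangement_exists_iff:
  "(\<exists>y. descending_rearrangement x y) \<longleftrightarrow> (\<forall>i. finite {j. x i < x j})"
proof
  assume "\<exists>y. descending_rearrangement x y"
  then obtain \<sigma> where \<sigma>: "decseq (x \<circ> \<sigma>)" "bij \<sigma>"
    by (auto simp: descending_rearrangement_def)
  show "\<forall>i. finite {j. x i < x j}"
  proof
    fix i
    obtain k where k: "i = \<sigma> k" using \<sigma>(2) by (metis bij_pointE)
    have "{j. x i < x j} \<subseteq> \<sigma> ` {..<k}"
    proof
      fix j assume j: "j \<in> {j. x i < x j}"
      obtain l where l: "j = \<sigma> l" using \<sigma>(2) by (metis bij_pointE)
      have "l < k"
      proof (rule ccontr)
        assume "\<not> l < k"
        then have "x (\<sigma> l) \<le> x (\<sigma> k)" using \<sigma>(1) by (auto simp: decseq_def)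
        then show False using j k l by simp
      qed
      then show "j \<in> \<sigma> ` {..<k}" using l by blast
    qed
    then show "finite {j. x i < x j}" by (rule finite_subset) simp
  qed
next
  assume fin: "\<forall>i. finite {j. x i < x j}"
  \<comment> \<open>\<open>B i\<close> collects the indices placed before \<open>i\<close>: larger
    values, then earlier indices among equal ones. The tie-break makes the order total and keeps
    \<open>B i\<close> finite even if a value recurs infinitely often; \<open>inv r\<close> will be
    the permutation.\<close>
  define B where "B i = {j. x i < x j \<or> x j = x i \<and> j < i}" for i
  define r where "r i = card (B i)" for i
  have finB: "finite (B i)" for i
    by (rule finite_subset[of _ "{j. x i < x j} \<union> {..<i}"]) (use fin in \<open>auto simp: B_def\<close>)
  have psub: "B j \<subset> B i" if "j \<in> B i" for i j
    using that by (auto simp: B_def)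
  have less: "r j < r i" if "j \<in> B i" for i j
    unfolding r_def by (rule psubset_card_mono[OF finB psub[OF that]])
  have total: "i = j \<or> i \<in> B j \<or> j \<in> B i" for i j
    by (auto simp: B_def)
  have inj: "inj r"
    by (rule injI) (metis less less_irrefl total)
  \<comment> \<open>The ranks leave no gap, because the last predecessor \<open>m\<close> of
    \<open>i\<close> satisfies \<open>B i = insert m (B m)\<close>. An infinite set of ranks closed
    downwards is all of the naturals.\<close>
  have step: "k \<in> range r" if "Suc k \<in> range r" for k
  proof -
    from that obtain i where i: "r i = Suc k" by (auto simp: eq_commute)
    then have "B i \<noteq> {}" by (auto simp: r_def)
    then have "Max (r ` B i) \<in> r ` B i" using finB[of i] by (intro Max_in) auto
    then obtain m where m: "m \<in> B i" "Max (r ` B i) = r m" by blast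
    have max: "r j \<le> r m" if "j \<in> B i" for j
      using that finB[of i] by (simp flip: m(2))
    have "B i = insert m (B m)"
    proof (intro equalityI subsetI)
      fix j assume j: "j \<in> B i"
      show "j \<in> insert m (B m)"
        using total[of j m] max[OF j] less[of m j] by auto
    qed (use m(1) psub[OF m(1)] in auto)
    moreover have "m \<notin> B m" by (auto simp: B_def)
    ultimately have "r i = Suc (r m)" using finB[of m] by (simp add: r_def)
    then show ?thesis using i by auto
  qed
  have down: "k \<in> range r" if "n \<in> range r" "k \<le> n" for k n
    using that(2,1) by (induction rule: inc_induct) (auto intro: step)
  have "surj r"
  proof (rule ccontr)
    assume "\<not> surj r"
    then obtain k where k: "k \<notin> range r" by blast
    have "range r \<subseteq> {..<k}" using down k by (metis lessThan_iff not_le subsetI)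
    then have "finite (range r)" by (rule finite_subset) simp
    then show False using inj by (simp add: finite_image_iff)
  qed
  then have bij: "bij r" using inj by (simp add: bij_def)
  have "decseq (x \<circ> inv r)"
    unfolding decseq_def
  proof (intro allI impI, rule ccontr)
    fix m n :: nat assume mn: "m \<le> n" "\<not> (x \<circ> inv r) n \<le> (x \<circ> inv r) m"
    then have "inv r n \<in> B (inv r m)" by (auto simp: B_def)
    from less[OF this] show False using mn(1) \<open>surj r\<close> by (simp add: surj_f_inv_f)
  qed
  then show "\<exists>y. descending_rearrangement x y"
    using bij_imp_bij_inv[OF bij] by (auto simp: descending_rearrangement_def)
qed

lemma descending_rearrangement_ranked:
  assumes "\<And>i. finite {j. x i < x j}"
  shows "descending_rearrangement x (ranked x)"
proof -
  have "\<exists>y. descending_rearrangement x y"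
    using assms descending_rearrangement_exists_iff by blast
  then show ?thesis
    unfolding ranked_def using descending_rearrangement_unique by (metis theI)
qed

text \<open>Without a rearrangement the definite description no longer depends on \<open>x\<close>.
  So \<open>ranked\<close> is constant on the exceptional set, which gives measurability everywhere
  and not only up to a null set.\<close>

lemma ranked_no_rearrangement:
  assumes "\<not> (\<forall>i. finite {j. x i < x j})"
  shows "ranked x = (THE y. False)"
proof -
  have "(\<lambda>y. descending_rearrangement x y) = (\<lambda>y. False)"
    using assms descending_rearrangement_exists_iff by blast
  then show ?thesis by (simp add: ranked_def)
qed

text \<open>The permutation, which varies with the outcome, is traded for countably many finite
  index sets. Conversely, \<open>Suc n\<close> indices cannot all occupy the first \<open>n\<close>
  positions, so one of them sits where the values are at most \<open>y n\<close>.\<close>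

lemma descending_rearrangement_less_iff:
  assumes "descending_rearrangement x y"
  shows "v < y n \<longleftrightarrow> (\<exists>J. finite J \<and> card J = Suc n \<and> (\<forall>j\<in>J. v < x j))"
proof
  obtain \<sigma> where \<sigma>: "decseq (x \<circ> \<sigma>)" "bij \<sigma>" "y = x \<circ> \<sigma>"
    using assms by (auto simp: descending_rearrangement_def)
  show "\<exists>J. finite J \<and> card J = Suc n \<and> (\<forall>j\<in>J. v < x j)" if "v < y n"
  proof (intro exI conjI)
    show "card (\<sigma> ` {..n}) = Suc n"
      using \<sigma>(2) by (simp add: card_image inj_on_subset[OF bij_is_inj])
    have "x (\<sigma> n) \<le> x (\<sigma> i)" if "i \<le> n" for i
      using \<sigma>(1) that by (auto simp: decseq_def)
    with that \<sigma>(3) show "\<forall>j\<in>\<sigma> ` {..n}. v < x j" by fastforce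
  qed simp
  show "v < y n" if ex: "\<exists>J. finite J \<and> card J = Suc n \<and> (\<forall>j\<in>J. v < x j)"
  proof -
    obtain J where J: "finite J" "card J = Suc n" "\<And>j. j \<in> J \<Longrightarrow> v < x j"
      using ex by auto
    have "\<not> J \<subseteq> \<sigma> ` {..<n}"
      using card_mono[of "\<sigma> ` {..<n}" J] card_image_le[of "{..<n}" \<sigma>] J(2) by auto
    then obtain j where j: "j \<in> J" "j \<notin> \<sigma> ` {..<n}" by blast
    obtain k where k: "j = \<sigma> k" using \<sigma>(2) by (metis bij_pointE)
    have "n \<le> k" using j(2) k by (meson image_eqI lessThan_iff not_le)
    then have "x (\<sigma> k) \<le> x (\<sigma> n)" using \<sigma>(1) by (auto simp: decseq_def)
    then show ?thesis using J(3)[OF j(1)] k \<sigma>(3) by simp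
  qed
qed

lemma descending_rearrangement_geI:
  assumes "descending_rearrangement x y" "finite J" "n < card J" "\<And>j. j \<in> J \<Longrightarrow> v \<le> x j"
  shows "v \<le> y n"
proof (rule dense_le)
  fix w assume w: "w < v"
  obtain J' where J': "J' \<subseteq> J" "card J' = Suc n" "finite J'"
    using assms(2,3) by (meson Suc_leI obtain_subset_with_card_n)
  have "w < x j" if "j \<in> J'" for j
    using assms(4)[of j] that J'(1) w by auto
  with J' have "\<exists>J. finite J \<and> card J = Suc n \<and> (\<forall>j\<in>J. w < x j)"
    by blast
  then show "w \<le> y n"
    using descending_rearrangement_less_iff[OF assms(1), of w n] by simp
qed

text \<open>The first \<open>n\<close> ranked values come from finitely many indices. The bound
  \<open>N\<close> depends on the permutation, hence on the outcome; later an increasing union of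
  events absorbs it.\<close>

lemma descending_rearrangement_sum_le:
  fixes \<phi> :: "real \<Rightarrow> real"
  assumes "descending_rearrangement x y" "\<And>u. 0 \<le> \<phi> u"
  shows "\<exists>N. (\<Sum>i<n. \<phi> (y i)) \<le> (\<Sum>j<N. \<phi> (x j))"
proof -
  obtain \<sigma> where \<sigma>: "bij \<sigma>" "y = x \<circ> \<sigma>"
    using assms by (auto simp: descending_rearrangement_def)
  obtain N where N: "\<sigma> ` {..<n} \<subseteq> {..<N}"
    using finite_nat_iff_bounded[of "\<sigma> ` {..<n}"] by auto
  have "(\<Sum>i<n. \<phi> (y i)) = (\<Sum>j\<in>\<sigma> ` {..<n}. \<phi> (x j))"
    using \<sigma> by (simp add: sum.reindex inj_on_subset[OF bij_is_inj])
  also have "\<dots> \<le> (\<Sum>j<N. \<phi> (x j))"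
    using N assms(2) by (intro sum_mono2) auto
  finally show ?thesis by blast
qed

lemma measurable_ranked:
  fixes X :: "nat \<Rightarrow> 'w \<Rightarrow> real"
  assumes [measurable]: "\<And>n. X n \<in> borel_measurable M"
  shows "(\<lambda>\<omega>. ranked (\<lambda>n. X n \<omega>)) \<in> borel_measurable M"
proof (rule measurable_coordinatewise_then_product)
  fix n
  \<comment> \<open>Finiteness of \<open>{j. X i \<omega> < X j \<omega>}\<close> is spelled out
    with countable quantifiers, so that the set where the ranking is genuine is an event.\<close>
  define D where "D = {\<omega>\<in>space M. \<forall>i. \<exists>N. \<forall>j\<ge>N. X j \<omega> \<le> X i \<omega>}"
  have [measurable]: "D \<in> sets M" unfolding D_def by measurable
  have D_iff: "\<omega> \<in> D \<longleftrightarrow> (\<forall>i. finite {j. X i \<omega> < X j \<omega>})" if "\<omega> \<in> space M" for \<omega>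
  proof -
    have "finite {j. X i \<omega> < X j \<omega>} \<longleftrightarrow> (\<exists>N. \<forall>j\<ge>N. X j \<omega> \<le> X i \<omega>)" for i
      unfolding finite_nat_iff_bounded by (auto simp: subset_eq not_less) (meson not_le)+
    then show ?thesis using that by (simp add: D_def)
  qed
  show "(\<lambda>\<omega>. ranked (\<lambda>n. X n \<omega>) n) \<in> borel_measurable M"
    unfolding borel_measurable_iff_greater
  proof
    fix c
    \<comment> \<open>Off \<open>D\<close> the coordinate is one fixed constant, so that part counts
      entirely or not at all.\<close>
    have "{\<omega> \<in> space M. c < ranked (\<lambda>n. X n \<omega>) n} =
      (D \<inter> (\<Union>J\<in>{J. finite J \<and> card J = Suc n}. {\<omega>\<in>space M. \<forall>j\<in>J. c < X j \<omega>})) \<union>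
      (if c < (THE y. False) n then space M - D else {})" (is "?L = ?R")
    proof (rule set_eqI)
      fix \<omega>
      show "\<omega> \<in> ?L \<longleftrightarrow> \<omega> \<in> ?R"
      proof (cases "\<omega> \<in> space M")
        case True
        show ?thesis
        proof (cases "\<omega> \<in> D")
          case d: True
          then have "descending_rearrangement (\<lambda>n. X n \<omega>) (ranked (\<lambda>n. X n \<omega>))"
            using D_iff[OF True] by (intro descending_rearrangement_ranked) auto
          from descending_rearrangement_less_iff[OF this, of c n]
          show ?thesis using True d by auto
        next
          case False
          then have "ranked (\<lambda>n. X n \<omega>) = (THE y. False)"
            using D_iff[OF True] by (intro ranked_no_rearrangement) auto
          then show ?thesis using True False by auto
        qed
      qed (auto simp: D_def)
    qed
    moreover have "{\<omega>\<in>space M. \<forall>j\<in>J. c < X j \<omega>} \<in> sets M" if "finite J" for J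
      using that by measurable
    moreover have "countable {J :: nat set. finite J \<and> card J = Suc n}"
      by (rule countable_subset[OF _ countable_Collect_finite]) auto
    ultimately show "{\<omega> \<in> space M. c < ranked (\<lambda>n. X n \<omega>) n} \<in> sets M"
      by (auto intro!: sets.Un sets.Int sets.countable_UN'')
  qed
qed

section \<open>Stick lengths compared with stick fractions\<close>

lemma stick_breaking_eq_diff:
  "stick_breaking u n = (\<Prod>k<n. 1 - u k) - (\<Prod>k<Suc n. 1 - u k)"
  by (simp add: stick_breaking_def algebra_simps)

lemma stick_breaking_pos:
  assumes "\<And>k. 0 < u k \<and> u k < 1"
  shows "0 < stick_breaking u n"
  unfolding stick_breaking_def using assms by (intro mult_pos_pos prod_pos) auto

lemma stick_breaking_le:
  assumes "\<And>k. 0 < u k \<and> u k < 1"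
  shows "stick_breaking u n \<le> u n"
proof -
  have "(\<Prod>k<n. 1 - u k) \<le> 1"
    by (intro prod_le_1) (use assms in \<open>auto simp: less_imp_le\<close>)
  then show ?thesis
    unfolding stick_breaking_def using assms[of n] by (simp add: mult_left_le_one_le mult_le_cancel_right1)
qed

text \<open>Extending the product to a common \<open>N\<close> gives one factor that serves the
  first \<open>N\<close> sticks simultaneously: a single bound on the remaining length turns every
  large fraction among them into a large stick.\<close>

lemma stick_breaking_ge:
  assumes u: "\<And>k. 0 < u k \<and> u k < 1" and "n < N"
  shows "(\<Prod>k<N. 1 - u k) * u n \<le> stick_breaking u n"
proof -
  have "(\<Prod>k<N. 1 - u k) \<le> (\<Prod>k<n. 1 - u k)"
  proof -
    have "(\<Prod>k<N. 1 - u k) = (\<Prod>k<n. 1 - u k) * (\<Prod>k\<in>{n..<N}. 1 - u k)"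
      using assms(2) prod.union_disjoint[of "{..<n}" "{n..<N}" "\<lambda>k. 1 - u k"]
      by (simp add: ivl_disj_un_one(2) ivl_disj_int_one(2) less_imp_le)
    also have "\<dots> \<le> (\<Prod>k<n. 1 - u k) * 1"
      by (intro mult_left_mono prod_le_1 prod_nonneg) (use u in \<open>auto simp: less_imp_le\<close>)
    finally show ?thesis by simp
  qed
  then show ?thesis
    unfolding stick_breaking_def using u[of n] by (intro mult_right_mono) auto
qed

text \<open>The remaining lengths decrease and are nonnegative, so their decrements, the sticks,
  tend to 0; each stick is positive and is therefore exceeded by only finitely many others.\<close>

lemma descending_rearrangement_stick_breaking:
  assumes u: "\<And>k. 0 < u k \<and> u k < 1"
  shows "descending_rearrangement (stick_breaking u) (ranked (stick_breaking u))"
proof (rule descending_rearrangement_ranked)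
  fix i
  define T where "T n = (\<Prod>k<n. 1 - u k)" for n
  have "decseq T"
    unfolding decseq_Suc_iff T_def using u
    by (auto intro!: mult_right_le_one_le prod_nonneg simp: less_imp_le)
  moreover have "0 \<le> T n" for n
    unfolding T_def using u by (auto intro!: prod_nonneg simp: less_imp_le)
  ultimately obtain L where "T \<longlonglongrightarrow> L"
    using decseq_convergent[of T 0] by blast
  then have "(\<lambda>n. T n - T (Suc n)) \<longlonglongrightarrow> L - L"
    by (intro tendsto_diff LIMSEQ_Suc)
  then have "stick_breaking u \<longlonglongrightarrow> 0"
    by (simp add: stick_breaking_eq_diff[abs_def] T_def del: prod.lessThan_Suc)
  then have "\<forall>\<^sub>F j in sequentially. stick_breaking u j < stick_breaking u i"
    using stick_breaking_pos[OF u] by (rule order_tendstoD)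
  then obtain N where "\<And>j. j \<ge> N \<Longrightarrow> stick_breaking u j < stick_breaking u i"
    by (force simp: eventually_sequentially)
  then have "{j. stick_breaking u i < stick_breaking u j} \<subseteq> {..<N}"
    by (force simp: not_le[symmetric])
  then show "finite {j. stick_breaking u i < stick_breaking u j}"
    by (rule finite_subset) simp
qed

section \<open>Estimates for beta densities\<close>

text \<open>Log-convexity of Gamma, interpolated between \<open>q\<close> and
  \<open>q + 1\<close>.\<close>

lemma Gamma_add_le:
  fixes q s :: real
  assumes "0 < q" "0 \<le> s" "s \<le> 1"
  shows "Gamma (q + s) \<le> q powr s * Gamma q"
proof -
  have "ln (Gamma ((1 - s) *\<^sub>R q + s *\<^sub>R (q + 1))) \<le> (1 - s) * ln (Gamma q) + s * ln (Gamma (q + 1))"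
    using convex_onD[OF log_convex_Gamma_real, of s q "q + 1"] assms by simp
  moreover have "(1 - s) *\<^sub>R q + s *\<^sub>R (q + 1) = q + s" by (simp add: algebra_simps)
  moreover have "Gamma (q + 1) = q * Gamma q"
    by (intro Gamma_plus1) (use assms in \<open>auto elim!: nonpos_Ints_cases\<close>)
  ultimately have "ln (Gamma (q + s)) \<le> s * ln q + ln (Gamma q)"
    using assms Gamma_real_pos[of q] by (simp add: ln_mult_pos algebra_simps)
  also have "\<dots> = ln (q powr s * Gamma q)"
    using assms Gamma_real_pos[of q] by (simp add: ln_mult_pos ln_powr)
  finally show ?thesis
    using assms Gamma_real_pos[of q] Gamma_real_pos[of "q + s"] by simp
qed

text \<open>The upper bound applied at \<open>q + s\<close> with step \<open>1 - s\<close> leads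
  back to \<open>Gamma (q + 1)\<close>; the 2 pays for replacing \<open>q + s\<close> by
  \<open>2 * q\<close>.\<close>

lemma Gamma_add_ge:
  fixes q s :: real
  assumes "1 \<le> q" "0 \<le> s" "s \<le> 1"
  shows "q powr s * Gamma q / 2 \<le> Gamma (q + s)"
proof -
  have pos: "0 < Gamma (q + s)" using assms by (intro Gamma_real_pos) simp
  have "q * Gamma q = Gamma (q + 1)"
    by (intro Gamma_plus1[symmetric]) (use assms in \<open>auto elim!: nonpos_Ints_cases\<close>)
  also have "\<dots> \<le> (q + s) powr (1 - s) * Gamma (q + s)"
    using Gamma_add_le[of "q + s" "1 - s"] assms by simp
  also have "\<dots> \<le> (2 * q) powr (1 - s) * Gamma (q + s)"
    using assms pos by (intro mult_right_mono powr_mono2) auto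
  also have "\<dots> = 2 powr (1 - s) * (q powr (1 - s) * Gamma (q + s))"
    using assms by (simp add: powr_mult)
  also have "\<dots> \<le> 2 powr 1 * (q powr (1 - s) * Gamma (q + s))"
    using assms pos by (intro mult_right_mono powr_mono) auto
  also have "q powr (1 - s) = q / q powr s" using assms by (simp add: powr_diff)
  finally show ?thesis using assms by (simp add: field_simps)
qed

lemma inverse_Beta_le:
  fixes \<alpha> q :: real
  assumes "0 < \<alpha>" "\<alpha> < 1" "0 < q"
  shows "1 / Beta (1 - \<alpha>) q \<le> q powr (1 - \<alpha>) / Gamma (1 - \<alpha>)"
  using Gamma_add_le[of q "1 - \<alpha>"] Gamma_real_pos[of q] Gamma_real_pos[of "1 - \<alpha>"] assms
  by (simp add: Beta_def field_simps)

lemma inverse_Beta_ge: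
  fixes \<alpha> q :: real
  assumes "0 < \<alpha>" "\<alpha> < 1" "1 \<le> q"
  shows "q powr (1 - \<alpha>) / (2 * Gamma (1 - \<alpha>)) \<le> 1 / Beta (1 - \<alpha>) q"
  using Gamma_add_ge[of q "1 - \<alpha>"] Gamma_real_pos[of q] Gamma_real_pos[of "1 - \<alpha>"] assms
  by (simp add: Beta_def field_simps)

text \<open>The ratio is the mean of \<open>(1 - u) powr (- r)\<close> under the beta law with
  parameters \<open>1 - \<alpha>\<close> and \<open>q\<close>. One factor 2 comes from the lower
  Gamma bound, the other from \<open>q \<le> 2 * (q - r)\<close>. Uniformity in \<open>q\<close>
  permits exponents \<open>r\<close> of order \<theta> in Markov's inequality.\<close>

lemma Beta_ratio_le:
  fixes \<alpha> q r :: real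
  assumes "0 < \<alpha>" "\<alpha> < 1" "2 \<le> q" "0 \<le> r" "r \<le> q / 2"
  shows "Beta (1 - \<alpha>) (q - r) / Beta (1 - \<alpha>) q \<le> 4"
proof -
  have G: "0 < Gamma (1 - \<alpha>)" using assms by (intro Gamma_real_pos) simp
  have B: "0 < Beta (1 - \<alpha>) (q - r)"
    using assms by (auto simp: Beta_def intro!: divide_pos_pos mult_pos_pos Gamma_real_pos)
  have "(q - r) powr (1 - \<alpha>) * Beta (1 - \<alpha>) (q - r) \<le> 2 * Gamma (1 - \<alpha>)"
    using inverse_Beta_ge[of \<alpha> "q - r"] assms G B by (simp add: field_simps)
  moreover have "q powr (1 - \<alpha>) \<le> (2 * (q - r)) powr (1 - \<alpha>)"
    using assms by (intro powr_mono2) auto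
  moreover have "(2 * (q - r)) powr (1 - \<alpha>) \<le> 2 * (q - r) powr (1 - \<alpha>)"
    using assms powr_mono[of "1 - \<alpha>" 1 2] by (subst powr_mult) (auto intro: mult_right_mono)
  ultimately have "q powr (1 - \<alpha>) * Beta (1 - \<alpha>) (q - r) \<le> 4 * Gamma (1 - \<alpha>)"
    using B mult_right_mono[of "q powr (1 - \<alpha>)" "2 * (q - r) powr (1 - \<alpha>)" "Beta (1 - \<alpha>) (q - r)"]
    by linarith
  then have "Beta (1 - \<alpha>) (q - r) * (q powr (1 - \<alpha>) / Gamma (1 - \<alpha>)) \<le> 4"
    using G by (simp add: field_simps)
  moreover have "Beta (1 - \<alpha>) (q - r) * (1 / Beta (1 - \<alpha>) q) \<le>
      Beta (1 - \<alpha>) (q - r) * (q powr (1 - \<alpha>) / Gamma (1 - \<alpha>))"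
    using inverse_Beta_le[of \<alpha> q] assms B by (intro mult_left_mono) auto
  ultimately show ?thesis by simp
qed

lemma Beta_real_pos: "0 < Beta p q" if "0 < p" "0 < q" for p q :: real
  using that by (auto simp: Beta_def intro!: divide_pos_pos mult_pos_pos Gamma_real_pos)

lemma beta_density_nonneg: "0 < p \<Longrightarrow> 0 < q \<Longrightarrow> 0 \<le> beta_density p q u"
  using Beta_real_pos[of p q] by (auto simp: beta_density_def intro!: divide_nonneg_nonneg)

lemma measurable_beta_density [measurable]: "beta_density p q \<in> borel_measurable borel"
  unfolding beta_density_def[abs_def] by measurable

lemma nn_integral_beta_density_powr:
  assumes "0 < p" "0 < q" "r < q"
  shows "(\<integral>\<^sup>+u. ennreal (beta_density p q u) * ennreal ((1 - u) powr (- r)) \<partial>lborel)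
    = ennreal (Beta p (q - r) / Beta p q)"
proof -
  have e: "q - 1 - r = q - r - 1" by simp
  have "(\<integral>\<^sup>+u. ennreal (beta_density p q u) * ennreal ((1 - u) powr (- r)) \<partial>lborel)
    = (\<integral>\<^sup>+u. ennreal (u powr (p - 1) * (1 - u) powr (q - r - 1) / Beta p q) * indicator {0<..<1} u \<partial>lborel)"
    using assms beta_density_nonneg[of p q]
    by (intro nn_integral_cong)
       (auto simp: beta_density_def indicator_def mult.assoc e simp flip: ennreal_mult' powr_add)
  also have "\<dots> = ennreal (Beta p (q - r) / Beta p q)"
  proof (rule nn_integral_has_integral_lebesgue')
    have "((\<lambda>u. u powr (p - 1) * (1 - u) powr (q - r - 1)) has_integral Beta p (q - r)) {0<..<1}"
      using has_integral_Beta_real[of p "q - r"] assms by (simp add: has_integral_Icc_iff_Ioo)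
    from has_integral_divide[OF this, of "Beta p q"]
    show "((\<lambda>u. u powr (p - 1) * (1 - u) powr (q - r - 1) / Beta p q) has_integral
        Beta p (q - r) / Beta p q) {0<..<1}" by simp
  qed (use Beta_real_pos[of p q] assms in \<open>auto intro!: divide_nonneg_nonneg\<close>)
  finally show ?thesis .
qed

text \<open>Along \<open>k\<close> the power of \<open>1 - u\<close> decays like
  \<open>exp (- k * \<alpha> * u)\<close>, while the normalising constant grows by at most about
  \<open>exp (k * \<alpha> / \<theta>)\<close>; \<open>2 / \<theta> \<le> u\<close> limits this
  growth to half of the decay. The geometric sum, at most \<open>4 / (\<alpha> * u)\<close>, changes
  the exponent \<open>- \<alpha>\<close> of one density into \<open>- \<alpha> - 1\<close>.\<close>

lemma sum_beta_density_le:
  fixes \<alpha> \<theta> u :: real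
  assumes \<alpha>: "0 < \<alpha>" "\<alpha> < 1" and \<theta>: "1 \<le> \<theta>" and u: "2 / \<theta> \<le> u" "u < 1"
  shows "(\<Sum>k<N. beta_density (1 - \<alpha>) (\<theta> + real (Suc k) * \<alpha>) u) \<le>
    4 * exp 2 / (\<alpha> * Gamma (1 - \<alpha>)) * (\<theta> powr (1 - \<alpha>) * u powr (- \<alpha> - 1) * exp (- \<theta> * u))"
proof -
  have u0: "0 < u" using u(1) \<theta> by (smt (verit) divide_pos_pos)
  have G: "0 < Gamma (1 - \<alpha>)" using \<alpha> by (intro Gamma_real_pos) simp
  define A where "A = \<theta> powr (1 - \<alpha>) / Gamma (1 - \<alpha>) * u powr (- \<alpha>) * exp (1 - \<theta> * u)"
  have A: "0 \<le> A" unfolding A_def using G by simp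
  define x where "x = exp (- \<alpha> * u / 2)"
  have x: "0 < x" "x < 1" unfolding x_def using u0 \<alpha> by auto
  have summand: "beta_density (1 - \<alpha>) (\<theta> + real (Suc k) * \<alpha>) u \<le> A * exp 1 * x ^ k" for k
  proof -
    define q where "q = \<theta> + real (Suc k) * \<alpha>"
    have q: "0 < q" "1 \<le> q" "\<theta> \<le> q" using \<theta> \<alpha> by (auto simp: q_def add_pos_pos add_increasing2)
    have "q powr (1 - \<alpha>) = \<theta> powr (1 - \<alpha>) * (q / \<theta>) powr (1 - \<alpha>)"
      using \<theta> q by (simp add: powr_divide)
    also have "(q / \<theta>) powr (1 - \<alpha>) \<le> (q / \<theta>) powr 1"
      using q \<theta> \<alpha> by (intro powr_mono) auto
    also have "(q / \<theta>) powr 1 = 1 + real (Suc k) * \<alpha> / \<theta>"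
      using \<theta> q by (simp add: q_def field_simps)
    also have "\<dots> \<le> exp (real (Suc k) * \<alpha> / \<theta>)" by (rule exp_ge_add_one_self)
    finally have 1: "q powr (1 - \<alpha>) \<le> \<theta> powr (1 - \<alpha>) * exp (real (Suc k) * \<alpha> / \<theta>)"
      using \<theta> by (simp add: mult_left_mono)
    have "1 - u \<le> exp (- u)" using exp_ge_add_one_self[of "- u"] by simp
    then have "(1 - u) powr (q - 1) \<le> exp (- u) powr (q - 1)"
      using u q by (intro powr_mono2) auto
    also have "\<dots> = exp (- u * (q - 1))" by (simp add: powr_def)
    finally have 2: "(1 - u) powr (q - 1) \<le> exp (- u * (q - 1))" .
    have "beta_density (1 - \<alpha>) q u = u powr (- \<alpha>) * ((1 - u) powr (q - 1) * (1 / Beta (1 - \<alpha>) q))"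
      using u u0 by (simp add: beta_density_def)
    also have "\<dots> \<le> u powr (- \<alpha>) * (exp (- u * (q - 1)) *
        (\<theta> powr (1 - \<alpha>) * exp (real (Suc k) * \<alpha> / \<theta>) / Gamma (1 - \<alpha>)))"
    proof (intro mult_left_mono mult_mono)
      show "1 / Beta (1 - \<alpha>) q \<le> \<theta> powr (1 - \<alpha>) * exp (real (Suc k) * \<alpha> / \<theta>) / Gamma (1 - \<alpha>)"
        using inverse_Beta_le[OF \<alpha> q(1)] 1 G by (meson divide_right_mono less_imp_le order.trans)
      show "0 \<le> 1 / Beta (1 - \<alpha>) q" using Beta_real_pos[of "1 - \<alpha>" q] \<alpha> q by simp
    qed (use 2 in auto)
    also have "\<dots> = \<theta> powr (1 - \<alpha>) / Gamma (1 - \<alpha>) * u powr (- \<alpha>) *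
        exp (- u * (q - 1) + real (Suc k) * \<alpha> / \<theta>)"
      by (simp only: exp_add) simp
    also have "\<dots> \<le> \<theta> powr (1 - \<alpha>) / Gamma (1 - \<alpha>) * u powr (- \<alpha>) *
        exp ((1 - \<theta> * u) + 1 + real k * (- \<alpha> * u / 2))"
    proof (intro mult_left_mono)
      have "real (Suc k) * \<alpha> / \<theta> \<le> real (Suc k) * \<alpha> * (u / 2)"
        using u(1) \<theta> \<alpha> mult_left_mono[of "1 / \<theta>" "u / 2" "real (Suc k) * \<alpha>"] by simp
      moreover have "0 \<le> \<alpha> * u" "0 \<le> real k * (\<alpha> * u)" using \<alpha> u0 by auto
      ultimately show "exp (- u * (q - 1) + real (Suc k) * \<alpha> / \<theta>) \<le>
          exp ((1 - \<theta> * u) + 1 + real k * (- \<alpha> * u / 2))"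
        using u u0 by (simp add: q_def algebra_simps)
    qed (use G in auto)
    also have "exp ((1 - \<theta> * u) + 1 + real k * (- \<alpha> * u / 2)) = exp (1 - \<theta> * u) * (exp 1 * x ^ k)"
      unfolding x_def by (simp only: exp_add exp_of_nat_mult mult.assoc)
    finally show ?thesis by (simp add: A_def q_def mult.assoc)
  qed
  have "(\<Sum>k<N. x ^ k) \<le> 1 / (1 - x)"
    using x by (simp add: sum_gp_strict divide_right_mono)
  also have "\<dots> \<le> 4 / (\<alpha> * u)"
  proof -
    have au: "0 < \<alpha> * u" "\<alpha> * u < 1" using \<alpha> u u0 mult_strict_mono[of \<alpha> 1 u 1] by auto
    have "x = inverse (exp (\<alpha> * u / 2))" by (simp add: x_def exp_minus)
    also have "\<dots> \<le> inverse (1 + \<alpha> * u / 2)"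
      using au by (intro le_imp_inverse_le) (auto simp: exp_ge_add_one_self)
    also have "\<dots> \<le> 1 - \<alpha> * u / 4"
    proof -
      have "(\<alpha> * u) * (\<alpha> * u) \<le> (\<alpha> * u) * 1" using au by (intro mult_left_mono) auto
      then have "1 \<le> (1 - \<alpha> * u / 4) * (1 + \<alpha> * u / 2)" using au by (simp add: algebra_simps)
      then show ?thesis using au by (simp add: inverse_eq_divide pos_divide_le_eq)
    qed
    finally have "\<alpha> * u / 4 \<le> 1 - x" by simp
    then have "1 / (1 - x) \<le> 1 / (\<alpha> * u / 4)" using au x by (intro divide_left_mono) auto
    then show ?thesis by simp
  qed
  finally have geo: "(\<Sum>k<N. x ^ k) \<le> 4 / (\<alpha> * u)" .
  have "(\<Sum>k<N. beta_density (1 - \<alpha>) (\<theta> + real (Suc k) * \<alpha>) u) \<le> (\<Sum>k<N. A * exp 1 * x ^ k)"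
    by (intro sum_mono summand)
  also have "\<dots> = A * exp 1 * (\<Sum>k<N. x ^ k)" by (simp add: sum_distrib_left)
  also have "\<dots> \<le> A * exp 1 * (4 / (\<alpha> * u))" using A geo by (intro mult_left_mono) auto
  also have "\<dots> = 4 * exp 2 / (\<alpha> * Gamma (1 - \<alpha>)) * (\<theta> powr (1 - \<alpha>) * u powr (- \<alpha> - 1) * exp (- \<theta> * u))"
  proof -
    have "exp (1 - \<theta> * u) * exp 1 = exp 2 * exp (- \<theta> * u)" by (simp flip: exp_add)
    moreover have "u powr (- \<alpha> - 1) = u powr (- \<alpha>) / u" using u0 by (simp add: powr_diff)
    moreover have "A * exp 1 * (4 / (\<alpha> * u)) = 4 * (exp (1 - \<theta> * u) * exp 1) / (\<alpha> * Gamma (1 - \<alpha>)) *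
        (\<theta> powr (1 - \<alpha>) * (u powr (- \<alpha>) / u))"
      by (simp add: A_def mult_ac)
    ultimately show ?thesis by simp
  qed
  finally show ?thesis .
qed

text \<open>Beyond \<open>\<beta> / \<theta>\<close> the power of \<open>u\<close> is at most its
  value at that point, which leaves \<open>exp (- (1 - \<kappa>) * (\<theta> * u - \<beta>))\<close>
  to integrate and produces the factor \<open>1 / (1 - \<kappa>)\<close>. The condition
  \<open>2 \<le> \<beta>\<close> puts all relevant \<open>u\<close> in the range of the summed
  density bound.\<close>

lemma sum_tilted_beta_le:
  fixes \<alpha> \<theta> \<beta> \<kappa> :: real
  assumes \<alpha>: "0 < \<alpha>" "\<alpha> < 1" and \<theta>: "1 \<le> \<theta>" and \<beta>: "2 \<le> \<beta>" and \<kappa>: "\<kappa> < 1"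
  shows "(\<Sum>k<N. \<integral>\<^sup>+u. ennreal (beta_density (1 - \<alpha>) (\<theta> + real (Suc k) * \<alpha>) u) *
           ennreal (if \<beta> < \<theta> * u then exp (\<kappa> * (\<theta> * u - \<beta>)) else 0) \<partial>lborel)
    \<le> ennreal (4 * exp 2 / (\<alpha> * Gamma (1 - \<alpha>) * (1 - \<kappa>)) * (\<theta> * \<beta> powr (- \<alpha> - 1) * exp (- \<beta>)))"
proof -
  define c where "c = 1 - \<kappa>"
  have c: "0 < c" using \<kappa> by (simp add: c_def)
  define D where "D = 4 * exp 2 / (\<alpha> * Gamma (1 - \<alpha>))"
  have G: "0 < Gamma (1 - \<alpha>)" using \<alpha> by (intro Gamma_real_pos) simp
  have D: "0 < D" unfolding D_def using G \<alpha> by simp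
  define d where "d k = beta_density (1 - \<alpha>) (\<theta> + real (Suc k) * \<alpha>)" for k
  define g where "g u = (if \<beta> < \<theta> * u then exp (\<kappa> * (\<theta> * u - \<beta>)) else 0)" for u
  have [measurable]: "g \<in> borel_measurable borel" unfolding g_def[abs_def] by measurable
  have d0: "0 \<le> d k u" for k u
    unfolding d_def using \<alpha> \<theta> by (intro beta_density_nonneg add_pos_nonneg) auto
  have g0: "0 \<le> g u" for u by (simp add: g_def)
  define E where "E = D * \<theta> powr (1 - \<alpha>) * (\<beta> / \<theta>) powr (- \<alpha> - 1) * exp (- \<beta>)"
  define F where "F u = - exp (- c * (\<theta> * u - \<beta>)) / (c * \<theta>)" for u
  have E: "0 \<le> E" unfolding E_def using D by simp
  have "(\<Sum>k<N. \<integral>\<^sup>+u. ennreal (d k u) * ennreal (g u) \<partial>lborel) =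
      (\<integral>\<^sup>+u. (\<Sum>k<N. ennreal (d k u) * ennreal (g u)) \<partial>lborel)"
    by (subst nn_integral_sum) (auto simp: d_def)
  also have "\<dots> \<le> (\<integral>\<^sup>+u. ennreal E * (ennreal (exp (- c * (\<theta> * u - \<beta>))) * indicator {\<beta> / \<theta>..} u) \<partial>lborel)"
  proof (rule nn_integral_mono)
    fix u :: real
    show "(\<Sum>k<N. ennreal (d k u) * ennreal (g u)) \<le>
        ennreal E * (ennreal (exp (- c * (\<theta> * u - \<beta>))) * indicator {\<beta> / \<theta>..} u)"
    proof (cases "\<beta> < \<theta> * u \<and> u < 1")
      case True
      then have u: "\<beta> / \<theta> < u" "u < 1" "0 < u"
        using \<theta> \<beta> by (auto simp: field_simps) (smt (verit) mult_nonneg_nonpos)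
      have "2 / \<theta> \<le> \<beta> / \<theta>" using \<beta> \<theta> by (intro divide_right_mono) auto
      then have "2 / \<theta> \<le> u" using u by simp
      then have "(\<Sum>k<N. d k u) \<le> D * (\<theta> powr (1 - \<alpha>) * u powr (- \<alpha> - 1) * exp (- \<theta> * u))"
        unfolding d_def D_def using u \<alpha> \<theta> by (intro sum_beta_density_le) auto
      also have "\<dots> \<le> D * (\<theta> powr (1 - \<alpha>) * (\<beta> / \<theta>) powr (- \<alpha> - 1) * exp (- \<theta> * u))"
        using D u \<alpha> \<beta> \<theta> by (intro mult_left_mono mult_right_mono powr_mono2') auto
      also have "\<dots> = E * exp (\<beta> - \<theta> * u)"
        by (simp add: E_def exp_diff exp_minus field_simps)
      finally have "(\<Sum>k<N. d k u) * g u \<le> E * exp (\<beta> - \<theta> * u) * g u"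
        using g0 by (rule mult_right_mono)
      also have "\<dots> = E * exp (- c * (\<theta> * u - \<beta>))"
        using True by (simp add: g_def c_def algebra_simps flip: exp_add)
      finally have "ennreal (\<Sum>k<N. d k u * g u) \<le> ennreal (E * exp (- c * (\<theta> * u - \<beta>)))"
        by (intro ennreal_leI) (simp add: sum_distrib_right)
      then show ?thesis
        using u d0 g0 E by (simp add: ennreal_mult[symmetric] sum_ennreal)
    next
      case False
      then have "d k u * g u = 0" for k
        by (auto simp: g_def d_def beta_density_def)
      then have "ennreal (d k u) * ennreal (g u) = 0" for k
        using d0 g0 by (simp flip: ennreal_mult)
      then have "(\<Sum>k<N. ennreal (d k u) * ennreal (g u)) = 0" by (intro sum.neutral ballI)
      then show ?thesis by (simp only: zero_le)
    qed
  qed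
  also have "\<dots> = ennreal E * (\<integral>\<^sup>+u. ennreal (exp (- c * (\<theta> * u - \<beta>))) * indicator {\<beta> / \<theta>..} u \<partial>lborel)"
    by (rule nn_integral_cmult) measurable
  also have "(\<integral>\<^sup>+u. ennreal (exp (- c * (\<theta> * u - \<beta>))) * indicator {\<beta> / \<theta>..} u \<partial>lborel) = ennreal (0 - F (\<beta> / \<theta>))"
  proof (rule nn_integral_FTC_atLeast)
    show "DERIV F u :> exp (- c * (\<theta> * u - \<beta>))" for u
      unfolding F_def using \<theta> c by (auto intro!: derivative_eq_intros simp: field_simps)
    have "filterlim (\<lambda>u. - c * (\<theta> * u - \<beta>)) at_bot at_top"
      using \<theta> c by real_asymp
    then have "((\<lambda>u. exp (- c * (\<theta> * u - \<beta>))) \<longlongrightarrow> 0) at_top"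
      by (rule filterlim_compose[OF exp_at_bot])
    then have "((\<lambda>u. - exp (- c * (\<theta> * u - \<beta>)) / (c * \<theta>)) \<longlongrightarrow> - 0 / (c * \<theta>)) at_top"
      using \<theta> c by (intro tendsto_intros) auto
    then show "(F \<longlongrightarrow> 0) at_top" by (simp add: F_def[abs_def])
  qed auto
  also have "ennreal E * ennreal (0 - F (\<beta> / \<theta>)) = ennreal (E / (c * \<theta>))"
    using \<theta> c E by (simp add: F_def ennreal_mult'[symmetric])
  also have "E / (c * \<theta>) = 4 * exp 2 / (\<alpha> * Gamma (1 - \<alpha>) * c) * (\<theta> * \<beta> powr (- \<alpha> - 1) * exp (- \<beta>))"
  proof -
    have "\<theta> powr (1 - \<alpha>) * (\<beta> / \<theta>) powr (- \<alpha> - 1) = \<beta> powr (- \<alpha> - 1) * (\<theta> powr (1 - \<alpha>) / \<theta> powr (- \<alpha> - 1))"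
      using \<beta> \<theta> by (simp add: powr_divide)
    also have "\<theta> powr (1 - \<alpha>) / \<theta> powr (- \<alpha> - 1) = \<theta> powr 2"
      using \<theta> by (simp flip: powr_diff)
    finally have "E = D * (\<beta> powr (- \<alpha> - 1) * \<theta>\<^sup>2) * exp (- \<beta>)"
      using \<theta> by (simp add: E_def)
    then show ?thesis using \<theta> c by (simp add: D_def power2_eq_square field_simps)
  qed
  finally show ?thesis unfolding d_def g_def c_def .
qed

section \<open>Probability bounds for the sticks\<close>

text \<open>A single \<theta> is frozen and all bounds are nonasymptotic, since different \<theta>
  may live on unrelated probability spaces.\<close>

locale stick_model =
  fixes \<alpha> \<theta> :: real and M :: "'w measure" and U :: "nat \<Rightarrow> 'w \<Rightarrow> real"
  assumes alpha_pos: "0 < \<alpha>" and alpha_less: "\<alpha> < 1" and theta_ge: "2 \<le> \<theta>"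
    and sticks: "PD_sticks \<alpha> \<theta> M U"
begin

sublocale prob_space M
  using sticks by (simp add: PD_sticks_def)

abbreviation dens :: "nat \<Rightarrow> real \<Rightarrow> real" where
  "dens k \<equiv> beta_density (1 - \<alpha>) (\<theta> + real (Suc k) * \<alpha>)"

lemma indep: "indep_vars (\<lambda>_. borel) U UNIV"
  using sticks by (simp add: PD_sticks_def)

lemma distributed_U: "distributed M lborel (U k) (\<lambda>u. ennreal (dens k u))"
  using sticks by (simp add: PD_sticks_def)

lemma measurable_U [measurable]: "U k \<in> borel_measurable M"
  using distributed_measurable[OF distributed_U[of k]] by simp

lemma shape_ge: "\<theta> \<le> \<theta> + real (Suc k) * \<alpha>"
  using alpha_pos by simp

lemma Gamma_pos: "0 < Gamma (1 - \<alpha>)"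
  using alpha_less by (intro Gamma_real_pos) simp

lemma AE_U: "AE \<omega> in M. \<forall>k. 0 < U k \<omega> \<and> U k \<omega> < 1"
proof -
  have "AE \<omega> in M. 0 < U k \<omega> \<and> U k \<omega> < 1" for k
    by (subst distributed_AE2[OF distributed_U]) (auto simp: beta_density_def)
  then show ?thesis by (simp add: AE_all_countable)
qed

lemma nn_integral_U:
  "g \<in> borel_measurable borel \<Longrightarrow>
    (\<integral>\<^sup>+\<omega>. g (U k \<omega>) \<partial>M) = (\<integral>\<^sup>+u. ennreal (dens k u) * g u \<partial>lborel)"
  by (rule distributed_nn_integral[OF distributed_U, symmetric]) simp

lemma nn_integral_prod_U:
  fixes g :: "nat \<Rightarrow> real \<Rightarrow> ennreal"
  assumes "finite J" "\<And>j. g j \<in> borel_measurable borel"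
  shows "(\<integral>\<^sup>+\<omega>. (\<Prod>j\<in>J. g j (U j \<omega>)) \<partial>M) = (\<Prod>j\<in>J. \<integral>\<^sup>+\<omega>. g j (U j \<omega>) \<partial>M)"
proof (rule indep_vars_nn_integral[OF assms(1)])
  have "indep_vars (\<lambda>_. borel) U J"
    using indep_vars_subset[OF indep] by blast
  then show "indep_vars (\<lambda>_. borel) (\<lambda>j \<omega>. g j (U j \<omega>)) J"
    by (rule indep_vars_compose2) (use assms(2) in auto)
qed simp

section \<open>Upper tails of the fractions\<close>

text \<open>At \<open>\<kappa> = 0\<close> this bounds the expected number of fractions above
  \<open>\<beta> / \<theta>\<close>, otherwise its exponentially tilted version. At the centering it
  stays bounded in \<theta>.\<close>

definition excess_const :: "real \<Rightarrow> real \<Rightarrow> real" where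
  "excess_const \<kappa> \<beta> = 4 * exp 2 / (\<alpha> * Gamma (1 - \<alpha>) * (1 - \<kappa>)) * (\<theta> * \<beta> powr (- \<alpha> - 1) * exp (- \<beta>))"

lemma excess_const_nonneg: "\<kappa> < 1 \<Longrightarrow> 0 \<le> excess_const \<kappa> \<beta>"
  using Gamma_pos alpha_pos theta_ge by (simp add: excess_const_def)

lemma sum_nn_integral_tilted_le:
  assumes "2 \<le> \<beta>" "\<kappa> < 1"
  shows "(\<Sum>k<N. \<integral>\<^sup>+\<omega>. ennreal (if \<beta> < \<theta> * U k \<omega> then exp (\<kappa> * (\<theta> * U k \<omega> - \<beta>)) else 0) \<partial>M)
    \<le> ennreal (excess_const \<kappa> \<beta>)"
proof -
  have "(\<integral>\<^sup>+\<omega>. ennreal (if \<beta> < \<theta> * U k \<omega> then exp (\<kappa> * (\<theta> * U k \<omega> - \<beta>)) else 0) \<partial>M) =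
      (\<integral>\<^sup>+u. ennreal (dens k u) * ennreal (if \<beta> < \<theta> * u then exp (\<kappa> * (\<theta> * u - \<beta>)) else 0) \<partial>lborel)" for k
    by (rule nn_integral_U[where g="\<lambda>u. ennreal (if \<beta> < \<theta> * u then exp (\<kappa> * (\<theta> * u - \<beta>)) else 0)"]) measurable
  then show ?thesis
    unfolding excess_const_def
    using sum_tilted_beta_le[of \<alpha> \<theta> \<beta> \<kappa> N] assms alpha_pos alpha_less theta_ge by simp
qed

text \<open>Since \<open>exp (\<kappa> * max 0 v)\<close> is at most 1 plus the tilted indicator
  \<open>g\<close>, independence turns the exponential moment into a product of factors
  \<open>1 + E g \<le> exp (E g)\<close>, whose exponents add up to at most
  \<open>excess_const\<close>. Small fractions contribute only the 1, so the bound is uniform in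
  \<open>N\<close>.\<close>

lemma prob_sum_excess_le:
  assumes "2 \<le> \<beta>" "0 \<le> \<kappa>" "\<kappa> < 1"
  shows "prob {\<omega>\<in>space M. t \<le> (\<Sum>j<N. max 0 (\<theta> * U j \<omega> - \<beta>))} \<le> exp (excess_const \<kappa> \<beta> - \<kappa> * t)"
proof -
  define g where "g u = (if \<beta> < \<theta> * u then exp (\<kappa> * (\<theta> * u - \<beta>)) else 0)" for u
  have [measurable]: "g \<in> borel_measurable borel" unfolding g_def[abs_def] by measurable
  have g0: "0 \<le> g u" for u by (simp add: g_def)
  have pos: "ennreal (1 + g u) = 1 + ennreal (g u)" for u
    using g0[of u] by simp
  have e: "(\<integral>\<^sup>+\<omega>. ennreal (1 + g (U j \<omega>)) \<partial>M) \<le> ennreal (exp (enn2real (\<integral>\<^sup>+\<omega>. ennreal (g (U j \<omega>)) \<partial>M)))"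
    (is "?A j \<le> ennreal (exp (enn2real (?I j)))") if "j < N" for j
  proof -
    have "?I j \<le> (\<Sum>k<N. ?I k)"
      using that by (intro member_le_sum) auto
    also have "\<dots> \<le> ennreal (excess_const \<kappa> \<beta>)"
      using sum_nn_integral_tilted_le[OF assms(1,3), of N] by (simp add: g_def)
    finally have fin: "?I j < \<infinity>" by (simp add: order.strict_trans1)
    have "?A j = 1 + ?I j"
      unfolding pos by (subst nn_integral_add) (auto simp: emeasure_space_1)
    also have "\<dots> = ennreal (1 + enn2real (?I j))"
      using fin by (simp add: ennreal_plus)
    also have "\<dots> \<le> ennreal (exp (enn2real (?I j)))"
      by (intro ennreal_leI exp_ge_add_one_self)
    finally show ?thesis .
  qed
  have sum_le: "(\<Sum>j<N. enn2real (\<integral>\<^sup>+\<omega>. ennreal (g (U j \<omega>)) \<partial>M)) \<le> excess_const \<kappa> \<beta>"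
  proof -
    have s: "(\<Sum>j<N. \<integral>\<^sup>+\<omega>. ennreal (g (U j \<omega>)) \<partial>M) \<le> ennreal (excess_const \<kappa> \<beta>)"
      using sum_nn_integral_tilted_le[OF assms(1,3), of N] by (simp add: g_def)
    have "enn2real (\<Sum>j<N. \<integral>\<^sup>+\<omega>. ennreal (g (U j \<omega>)) \<partial>M) \<le> excess_const \<kappa> \<beta>"
      by (intro enn2real_leI s excess_const_nonneg assms)
    moreover have "(\<integral>\<^sup>+\<omega>. ennreal (g (U j \<omega>)) \<partial>M) < \<infinity>" if "j \<in> {..<N}" for j
    proof -
      have "(\<integral>\<^sup>+\<omega>. ennreal (g (U j \<omega>)) \<partial>M) \<le> (\<Sum>j<N. \<integral>\<^sup>+\<omega>. ennreal (g (U j \<omega>)) \<partial>M)"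
        using that by (intro member_le_sum) auto
      also note s
      finally show ?thesis by (simp add: order.strict_trans1)
    qed
    ultimately show ?thesis by (subst (asm) enn2real_sum) auto
  qed
  have "emeasure M {\<omega>\<in>space M. t \<le> (\<Sum>j<N. max 0 (\<theta> * U j \<omega> - \<beta>))} =
      (\<integral>\<^sup>+\<omega>. indicator {\<omega>\<in>space M. t \<le> (\<Sum>j<N. max 0 (\<theta> * U j \<omega> - \<beta>))} \<omega> \<partial>M)"
    by (rule nn_integral_indicator[symmetric]) measurable
  also have "\<dots> \<le> (\<integral>\<^sup>+\<omega>. ennreal (exp (- \<kappa> * t)) * (\<Prod>j<N. ennreal (1 + g (U j \<omega>))) \<partial>M)"
  proof (rule nn_integral_mono)
    fix \<omega>
    show "indicator {\<omega>\<in>space M. t \<le> (\<Sum>j<N. max 0 (\<theta> * U j \<omega> - \<beta>))} \<omega> \<le>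
      ennreal (exp (- \<kappa> * t)) * (\<Prod>j<N. ennreal (1 + g (U j \<omega>)))"
    proof (cases "t \<le> (\<Sum>j<N. max 0 (\<theta> * U j \<omega> - \<beta>))")
      case True
      have "exp (\<kappa> * t) \<le> exp (\<Sum>j<N. \<kappa> * max 0 (\<theta> * U j \<omega> - \<beta>))"
        using mult_left_mono[OF True assms(2)] by (simp add: sum_distrib_left)
      also have "\<dots> = (\<Prod>j<N. exp (\<kappa> * max 0 (\<theta> * U j \<omega> - \<beta>)))"
        by (simp add: exp_sum)
      also have "\<dots> \<le> (\<Prod>j<N. 1 + g (U j \<omega>))"
        by (intro prod_mono) (auto simp: g_def max_def)
      finally have "1 \<le> exp (- \<kappa> * t) * (\<Prod>j<N. 1 + g (U j \<omega>))"
        by (simp add: exp_minus field_simps)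
      then have "1 \<le> ennreal (exp (- \<kappa> * t) * (\<Prod>j<N. 1 + g (U j \<omega>)))" by simp
      also have "\<dots> = ennreal (exp (- \<kappa> * t)) * (\<Prod>j<N. ennreal (1 + g (U j \<omega>)))"
        using g0 by (subst prod_ennreal) (auto simp: ennreal_mult' intro: add_nonneg_nonneg)
      finally show ?thesis by (auto simp: indicator_def)
    qed simp
  qed
  also have "\<dots> = ennreal (exp (- \<kappa> * t)) * (\<Prod>j<N. \<integral>\<^sup>+\<omega>. ennreal (1 + g (U j \<omega>)) \<partial>M)"
    by (subst nn_integral_cmult) (auto simp: nn_integral_prod_U[where g="\<lambda>_ u. ennreal (1 + g u)"])
  also have "\<dots> \<le> ennreal (exp (- \<kappa> * t)) * (\<Prod>j<N. ennreal (exp (enn2real (\<integral>\<^sup>+\<omega>. ennreal (g (U j \<omega>)) \<partial>M))))"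
    using e by (intro mult_left_mono prod_mono_ennreal) auto
  also have "\<dots> = ennreal (exp (- \<kappa> * t) * exp (\<Sum>j<N. enn2real (\<integral>\<^sup>+\<omega>. ennreal (g (U j \<omega>)) \<partial>M)))"
    by (simp add: prod_ennreal exp_sum ennreal_mult'[symmetric])
  also have "\<dots> \<le> ennreal (exp (- \<kappa> * t) * exp (excess_const \<kappa> \<beta>))"
    using sum_le by (intro ennreal_leI mult_left_mono) auto
  also have "exp (- \<kappa> * t) * exp (excess_const \<kappa> \<beta>) = exp (excess_const \<kappa> \<beta> - \<kappa> * t)"
    by (simp flip: exp_add)
  finally show ?thesis by (simp add: emeasure_eq_measure)
qed

text \<open>Markov's inequality with the same tilt. It certifies that a high window receives at most
  one fraction on average, the regime in which the union bound is sharp up to a constant.\<close>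

lemma sum_prob_tail_le:
  assumes "2 \<le> \<beta>" "0 \<le> \<kappa>" "\<kappa> < 1" "0 < t" "finite J"
  shows "(\<Sum>j\<in>J. prob {\<omega>\<in>space M. \<beta> + t \<le> \<theta> * U j \<omega>}) \<le> excess_const \<kappa> \<beta> * exp (- \<kappa> * t)"
proof -
  define g where "g u = (if \<beta> < \<theta> * u then exp (\<kappa> * (\<theta> * u - \<beta>)) else 0)" for u
  have [measurable]: "g \<in> borel_measurable borel" unfolding g_def[abs_def] by measurable
  obtain N where N: "J \<subseteq> {..<N}" using assms(5) finite_nat_iff_bounded by blast
  have "emeasure M {\<omega>\<in>space M. \<beta> + t \<le> \<theta> * U j \<omega>} \<le>
      ennreal (exp (- \<kappa> * t)) * (\<integral>\<^sup>+\<omega>. ennreal (g (U j \<omega>)) \<partial>M)" for j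
  proof -
    have "emeasure M {\<omega>\<in>space M. \<beta> + t \<le> \<theta> * U j \<omega>} =
        (\<integral>\<^sup>+\<omega>. indicator {\<omega>\<in>space M. \<beta> + t \<le> \<theta> * U j \<omega>} \<omega> \<partial>M)"
      by (rule nn_integral_indicator[symmetric]) measurable
    also have "\<dots> \<le> (\<integral>\<^sup>+\<omega>. ennreal (exp (- \<kappa> * t)) * ennreal (g (U j \<omega>)) \<partial>M)"
    proof (rule nn_integral_mono)
      fix \<omega>
      show "indicator {\<omega>\<in>space M. \<beta> + t \<le> \<theta> * U j \<omega>} \<omega> \<le> ennreal (exp (- \<kappa> * t)) * ennreal (g (U j \<omega>))"
      proof (cases "\<beta> + t \<le> \<theta> * U j \<omega>")
        case True
        then have "\<kappa> * t \<le> \<kappa> * (\<theta> * U j \<omega> - \<beta>)" using assms(2) by (intro mult_left_mono) auto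
        then have "1 \<le> exp (- \<kappa> * t) * g (U j \<omega>)"
          using True assms(4) by (simp add: g_def flip: exp_add)
        then have "1 \<le> ennreal (exp (- \<kappa> * t) * g (U j \<omega>))" by simp
        also have "\<dots> = ennreal (exp (- \<kappa> * t)) * ennreal (g (U j \<omega>))"
          by (rule ennreal_mult') simp
        finally show ?thesis by (auto simp: indicator_def)
      qed simp
    qed
    finally show ?thesis by (simp add: nn_integral_cmult)
  qed
  then have "(\<Sum>j<N. emeasure M {\<omega>\<in>space M. \<beta> + t \<le> \<theta> * U j \<omega>}) \<le>
      ennreal (exp (- \<kappa> * t)) * (\<Sum>j<N. \<integral>\<^sup>+\<omega>. ennreal (g (U j \<omega>)) \<partial>M)"
    by (simp add: sum_distrib_left sum_mono)
  also have "\<dots> \<le> ennreal (exp (- \<kappa> * t)) * ennreal (excess_const \<kappa> \<beta>)"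
    using sum_nn_integral_tilted_le[OF assms(1,3), of N] by (intro mult_left_mono) (simp_all add: g_def)
  also have "\<dots> = ennreal (excess_const \<kappa> \<beta> * exp (- \<kappa> * t))"
    using excess_const_nonneg[OF assms(3)] by (simp add: mult.commute flip: ennreal_mult')
  finally have "(\<Sum>j<N. prob {\<omega>\<in>space M. \<beta> + t \<le> \<theta> * U j \<omega>}) \<le> excess_const \<kappa> \<beta> * exp (- \<kappa> * t)"
    using excess_const_nonneg[OF assms(3)] by (simp add: emeasure_eq_measure sum_ennreal sum_nonneg)
  moreover have "(\<Sum>j\<in>J. prob {\<omega>\<in>space M. \<beta> + t \<le> \<theta> * U j \<omega>}) \<le> (\<Sum>j<N. prob {\<omega>\<in>space M. \<beta> + t \<le> \<theta> * U j \<omega>})"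
    using N by (intro sum_mono2) auto
  ultimately show ?thesis by linarith
qed

section \<open>Removed length, counts of large fractions, and independent blocks\<close>

text \<open>Markov's inequality for the power \<open>- (\<theta> / 2)\<close> of the product, each
  factor having moment at most 4. As \<open>j\<close> lies outside \<open>J\<close>, the event for
  \<open>U j\<close> factors out. A bound relative to its probability is essential, because that
  probability will itself be exponentially small.\<close>

lemma prob_remaining_stick_less:
  assumes J: "finite J" "j \<notin> J" and W [measurable]: "W \<in> sets borel" and s: "0 \<le> s" "s < 1"
  shows "prob {\<omega>\<in>space M. U j \<omega> \<in> W \<and> (\<Prod>i\<in>J. 1 - U i \<omega>) < 1 - s}
    \<le> prob {\<omega>\<in>space M. U j \<omega> \<in> W} * (exp (- s * \<theta> / 2) * 4 ^ card J)"
proof -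
  let ?E = "{\<omega>\<in>space M. U j \<omega> \<in> W \<and> (\<Prod>i\<in>J. 1 - U i \<omega>) < 1 - s}"
  define g :: "nat \<Rightarrow> real \<Rightarrow> ennreal" where
    "g i u = (if i = j then indicator W u else ennreal ((1 - u) powr (- (\<theta> / 2))))" for i u
  have [measurable]: "g i \<in> borel_measurable borel" for i
    unfolding g_def[abs_def] by measurable
  have "emeasure M ?E = (\<integral>\<^sup>+\<omega>. indicator ?E \<omega> \<partial>M)"
    using J by (intro nn_integral_indicator[symmetric]) measurable
  also have "\<dots> \<le> (\<integral>\<^sup>+\<omega>. ennreal (exp (- s * \<theta> / 2)) * (\<Prod>i\<in>insert j J. g i (U i \<omega>)) \<partial>M)"
  proof (rule nn_integral_mono_AE)
    show "AE \<omega> in M. indicator ?E \<omega> \<le> ennreal (exp (- s * \<theta> / 2)) * (\<Prod>i\<in>insert j J. g i (U i \<omega>))"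
      using AE_U
    proof eventually_elim
      case (elim \<omega>)
      show ?case
      proof (cases "\<omega> \<in> ?E")
        case True
        have T: "0 < (\<Prod>i\<in>J. 1 - U i \<omega>)" using elim by (intro prod_pos) auto
        have "1 - s \<le> exp (- s)" using exp_ge_add_one_self[of "- s"] by simp
        then have "(\<Prod>i\<in>J. 1 - U i \<omega>) powr (\<theta> / 2) \<le> exp (- s) powr (\<theta> / 2)"
          using True T theta_ge by (intro powr_mono2) auto
        also have "\<dots> = exp (- s * \<theta> / 2)" by (simp add: powr_def)
        finally have "1 \<le> exp (- s * \<theta> / 2) * (\<Prod>i\<in>J. 1 - U i \<omega>) powr (- (\<theta> / 2))"
          using T by (simp add: powr_minus field_simps)
        also have "(\<Prod>i\<in>J. 1 - U i \<omega>) powr (- (\<theta> / 2)) = (\<Prod>i\<in>J. (1 - U i \<omega>) powr (- (\<theta> / 2)))"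
          by (rule prod_powr_distrib)
        finally have "1 \<le> ennreal (exp (- s * \<theta> / 2) * (\<Prod>i\<in>J. (1 - U i \<omega>) powr (- (\<theta> / 2))))" by simp
        also have "\<dots> = ennreal (exp (- s * \<theta> / 2)) * (\<Prod>i\<in>J. ennreal ((1 - U i \<omega>) powr (- (\<theta> / 2))))"
          by (subst prod_ennreal) (auto simp: ennreal_mult')
        also have "(\<Prod>i\<in>J. ennreal ((1 - U i \<omega>) powr (- (\<theta> / 2)))) = (\<Prod>i\<in>insert j J. g i (U i \<omega>))"
          using J True by (auto simp: g_def intro!: prod.cong)
        finally show ?thesis by (auto simp: indicator_def)
      qed simp
    qed
  qed
  also have "\<dots> = ennreal (exp (- s * \<theta> / 2)) * (\<Prod>i\<in>insert j J. \<integral>\<^sup>+\<omega>. g i (U i \<omega>) \<partial>M)"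
    using J by (subst nn_integral_cmult) (auto simp: nn_integral_prod_U simp del: prod.insert)
  also have "(\<Prod>i\<in>insert j J. \<integral>\<^sup>+\<omega>. g i (U i \<omega>) \<partial>M) =
      (\<integral>\<^sup>+\<omega>. g j (U j \<omega>) \<partial>M) * (\<Prod>i\<in>J. \<integral>\<^sup>+\<omega>. g i (U i \<omega>) \<partial>M)"
    using J by simp
  also have "\<dots> \<le> ennreal (prob {\<omega>\<in>space M. U j \<omega> \<in> W}) * (\<Prod>i\<in>J. ennreal 4)"
  proof (intro mult_mono prod_mono_ennreal)
    have "(\<integral>\<^sup>+\<omega>. g j (U j \<omega>) \<partial>M) = (\<integral>\<^sup>+\<omega>. indicator {\<omega>\<in>space M. U j \<omega> \<in> W} \<omega> \<partial>M)"
      by (intro nn_integral_cong) (auto simp: g_def indicator_def)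
    also have "\<dots> = emeasure M {\<omega>\<in>space M. U j \<omega> \<in> W}" by (rule nn_integral_indicator) measurable
    finally show "(\<integral>\<^sup>+\<omega>. g j (U j \<omega>) \<partial>M) \<le> ennreal (prob {\<omega>\<in>space M. U j \<omega> \<in> W})"
      by (simp add: emeasure_eq_measure)
    fix i assume "i \<in> J"
    then have "i \<noteq> j" using J by auto
    then have "(\<integral>\<^sup>+\<omega>. g i (U i \<omega>) \<partial>M) = (\<integral>\<^sup>+u. ennreal (dens i u) * ennreal ((1 - u) powr (- (\<theta> / 2))) \<partial>lborel)"
      by (subst nn_integral_U) (auto simp: g_def)
    also have "\<dots> = ennreal (Beta (1 - \<alpha>) (\<theta> + real (Suc i) * \<alpha> - \<theta> / 2) / Beta (1 - \<alpha>) (\<theta> + real (Suc i) * \<alpha>))"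
      using alpha_less theta_ge shape_ge[of i] by (intro nn_integral_beta_density_powr) auto
    also have "\<dots> \<le> ennreal 4"
      using order.trans[OF theta_ge shape_ge[of i]] alpha_pos alpha_less theta_ge
      by (intro ennreal_leI Beta_ratio_le) auto
    finally show "(\<integral>\<^sup>+\<omega>. g i (U i \<omega>) \<partial>M) \<le> ennreal 4" .
  qed auto
  also have "ennreal (exp (- s * \<theta> / 2)) * (ennreal (prob {\<omega>\<in>space M. U j \<omega> \<in> W}) * (\<Prod>i\<in>J. ennreal 4)) =
      ennreal (prob {\<omega>\<in>space M. U j \<omega> \<in> W} * (exp (- s * \<theta> / 2) * 4 ^ card J))"
    by (simp add: ennreal_mult' ennreal_power mult_ac del: ennreal_numeral)
  finally show ?thesis by (simp add: emeasure_eq_measure mult_left_mono)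
qed

text \<open>Markov's inequality for \<open>exp (- count)\<close>: each fraction contributes
  \<open>1 - (1 - exp (- 1)) * p \<le> exp (- p / 2)\<close>. Where the expected count is
  exponentially large, the bound becomes doubly exponential.\<close>

lemma prob_few_large_le:
  assumes J: "finite J"
  shows "prob {\<omega>\<in>space M. card {j\<in>J. w \<le> U j \<omega>} \<le> n}
    \<le> exp (real n - (\<Sum>j\<in>J. prob {\<omega>\<in>space M. w \<le> U j \<omega>}) / 2)"
proof -
  let ?E = "{\<omega>\<in>space M. card {j\<in>J. w \<le> U j \<omega>} \<le> n}"
  define g where "g u = exp (- (if w \<le> u then 1 else 0) :: real)" for u :: real
  have [measurable]: "g \<in> borel_measurable borel" unfolding g_def[abs_def] by measurable
  have count: "real (card {j\<in>J. w \<le> U j \<omega>}) = (\<Sum>j\<in>J. if w \<le> U j \<omega> then 1 else 0)" for \<omega>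
    using J by (simp add: sum.If_cases Int_def)
  have "?E = {\<omega>\<in>space M. (\<Sum>j\<in>J. if w \<le> U j \<omega> then 1 else 0) \<le> real n}"
    by (simp flip: count)
  also have "\<dots> \<in> sets M" by measurable
  finally have [measurable]: "?E \<in> sets M" .
  have "emeasure M ?E = (\<integral>\<^sup>+\<omega>. indicator ?E \<omega> \<partial>M)"
    by (intro nn_integral_indicator[symmetric]) measurable
  also have "\<dots> \<le> (\<integral>\<^sup>+\<omega>. ennreal (exp (real n)) * (\<Prod>j\<in>J. ennreal (g (U j \<omega>))) \<partial>M)"
  proof (rule nn_integral_mono)
    fix \<omega>
    show "indicator ?E \<omega> \<le> ennreal (exp (real n)) * (\<Prod>j\<in>J. ennreal (g (U j \<omega>)))"
    proof (cases "\<omega> \<in> ?E")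
      case True
      have "1 \<le> exp (real n - real (card {j\<in>J. w \<le> U j \<omega>}))" using True by simp
      also have "\<dots> = exp (real n) * exp (\<Sum>j\<in>J. - (if w \<le> U j \<omega> then 1 else 0))"
        unfolding count sum_negf by (simp flip: exp_add)
      also have "\<dots> = exp (real n) * (\<Prod>j\<in>J. g (U j \<omega>))"
        using J by (simp add: exp_sum g_def)
      finally have "1 \<le> ennreal (exp (real n) * (\<Prod>j\<in>J. g (U j \<omega>)))" by simp
      also have "\<dots> = ennreal (exp (real n)) * (\<Prod>j\<in>J. ennreal (g (U j \<omega>)))"
        by (subst prod_ennreal) (auto simp: ennreal_mult' g_def)
      finally show ?thesis using True by simp
    qed simp
  qed
  also have "\<dots> = ennreal (exp (real n)) * (\<Prod>j\<in>J. \<integral>\<^sup>+\<omega>. ennreal (g (U j \<omega>)) \<partial>M)"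
    using J by (subst nn_integral_cmult) (auto simp: nn_integral_prod_U[where g="\<lambda>_ u. ennreal (g u)"])
  also have "\<dots> \<le> ennreal (exp (real n)) * (\<Prod>j\<in>J. ennreal (exp (- prob {\<omega>\<in>space M. w \<le> U j \<omega>} / 2)))"
  proof (intro mult_left_mono prod_mono_ennreal)
    fix j
    let ?A = "{\<omega>\<in>space M. w \<le> U j \<omega>}"
    have "(\<integral>\<^sup>+\<omega>. ennreal (g (U j \<omega>)) \<partial>M) =
        (\<integral>\<^sup>+\<omega>. ennreal (exp (- 1)) * indicator ?A \<omega> + indicator (space M - ?A) \<omega> \<partial>M)"
      by (intro nn_integral_cong) (auto simp: g_def indicator_def)
    also have "\<dots> = ennreal (exp (- 1)) * emeasure M ?A + emeasure M (space M - ?A)"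
      by (subst nn_integral_add) (auto simp: nn_integral_cmult)
    also have "\<dots> = ennreal (exp (- 1) * prob ?A + (1 - prob ?A))"
      by (subst ennreal_plus) (auto simp: emeasure_eq_measure prob_compl ennreal_mult')
    also have "\<dots> \<le> ennreal (exp (- prob ?A / 2))"
    proof (rule ennreal_leI)
      have "exp (- 1) \<le> (1 / 2 :: real)"
        using exp_ge_add_one_self[of "1::real"] by (simp add: exp_minus field_simps)
      then have "exp (- 1) * prob ?A \<le> 1 / 2 * prob ?A" by (intro mult_right_mono) auto
      then have "exp (- 1) * prob ?A + (1 - prob ?A) \<le> 1 + (- prob ?A / 2)" by simp
      also have "\<dots> \<le> exp (- prob ?A / 2)" by (rule exp_ge_add_one_self)
      finally show "exp (- 1) * prob ?A + (1 - prob ?A) \<le> exp (- prob ?A / 2)" .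
    qed
    finally show "(\<integral>\<^sup>+\<omega>. ennreal (g (U j \<omega>)) \<partial>M) \<le> ennreal (exp (- prob ?A / 2))" .
  qed auto
  also have "\<dots> = ennreal (exp (real n) * exp (\<Sum>j\<in>J. - prob {\<omega>\<in>space M. w \<le> U j \<omega>} / 2))"
    using J by (simp add: prod_ennreal exp_sum ennreal_mult')
  also have "exp (real n) * exp (\<Sum>j\<in>J. - prob {\<omega>\<in>space M. w \<le> U j \<omega>} / 2) =
      exp (real n - (\<Sum>j\<in>J. prob {\<omega>\<in>space M. w \<le> U j \<omega>}) / 2)"
  proof -
    have "(\<Sum>j\<in>J. - prob {\<omega>\<in>space M. w \<le> U j \<omega>} / 2) = - ((\<Sum>j\<in>J. prob {\<omega>\<in>space M. w \<le> U j \<omega>}) / 2)"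
      unfolding sum_divide_distrib sum_negf[symmetric] by (intro sum.cong) auto
    then show ?thesis by (simp only: exp_add[symmetric] diff_conv_add_uminus)
  qed
  finally show ?thesis by (simp add: emeasure_eq_measure)
qed

text \<open>Over a length \<open>1 / \<theta>\<close> the factor \<open>exp (- \<theta> * u)\<close>
  changes only by a constant, so evaluating at the right end \<open>h\<close> loses little. A
  bounded window, unlike a half-line, also caps the selected fraction and hence the length that it
  removes.\<close>

lemma prob_window_ge:
  assumes w: "0 \<le> w" and h: "h = w + 1 / \<theta>" "h \<le> 1 / 2"
  shows "(\<theta> * h) powr (- \<alpha>) * exp (- (\<theta> + real (Suc k) * \<alpha>) * (h + 2 * h\<^sup>2)) / (2 * Gamma (1 - \<alpha>))
    \<le> prob {\<omega>\<in>space M. U k \<omega> \<in> {w..w + 1 / \<theta>}}"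
proof -
  define q where "q = \<theta> + real (Suc k) * \<alpha>"
  have q: "\<theta> \<le> q" unfolding q_def by (rule shape_ge)
  have h0: "0 < h" using w h theta_ge by (simp add: add_nonneg_pos)
  define c where "c = h powr (- \<alpha>) * exp (- q * (h + 2 * h\<^sup>2)) * (\<theta> powr (1 - \<alpha>) / (2 * Gamma (1 - \<alpha>)))"
  have c0: "0 \<le> c" unfolding c_def using Gamma_pos by simp
  have low: "c \<le> dens k u" if u: "u \<in> {w<..<w + 1 / \<theta>}" for u
  proof -
    have u': "0 < u" "u \<le> h" "u < 1" using u w h by auto
    have "exp (- q * (h + 2 * h\<^sup>2)) \<le> (1 - u) powr (q - 1)"
    proof -
      have "exp (- q * (h + 2 * h\<^sup>2)) = exp (- h - 2 * h\<^sup>2) powr q"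
        by (simp add: powr_def algebra_simps)
      also have "\<dots> \<le> (1 - h) powr q"
      proof (rule powr_mono2)
        have "- h - 2 * h\<^sup>2 \<le> ln (1 - h)"
          using h h0 by (intro ln_one_minus_pos_lower_bound) auto
        then have "exp (- h - 2 * h\<^sup>2) \<le> exp (ln (1 - h))" by (simp only: exp_le_cancel_iff)
        then show "exp (- h - 2 * h\<^sup>2) \<le> 1 - h" using h by simp
      qed (use q theta_ge in auto)
      also have "\<dots> \<le> (1 - u) powr q"
        using u' h q theta_ge by (intro powr_mono2) auto
      also have "\<dots> \<le> (1 - u) powr (q - 1)"
        using u' by (intro powr_mono') auto
      finally show ?thesis .
    qed
    moreover have "\<theta> powr (1 - \<alpha>) / (2 * Gamma (1 - \<alpha>)) \<le> 1 / Beta (1 - \<alpha>) q"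
    proof -
      have "\<theta> powr (1 - \<alpha>) / (2 * Gamma (1 - \<alpha>)) \<le> q powr (1 - \<alpha>) / (2 * Gamma (1 - \<alpha>))"
        using q theta_ge alpha_less Gamma_pos by (intro divide_right_mono powr_mono2) auto
      also have "\<dots> \<le> 1 / Beta (1 - \<alpha>) q"
        using q theta_ge alpha_less alpha_pos by (intro inverse_Beta_ge) auto
      finally show ?thesis .
    qed
    moreover have "h powr (- \<alpha>) \<le> u powr (- \<alpha>)"
      using u' alpha_pos by (intro powr_mono2') auto
    ultimately have "c \<le> u powr (- \<alpha>) * (1 - u) powr (q - 1) * (1 / Beta (1 - \<alpha>) q)"
      unfolding c_def using Gamma_pos by (intro mult_mono) auto
    then show ?thesis using u' by (simp add: beta_density_def q_def)
  qed
  have "ennreal (c * (1 / \<theta>)) = (\<integral>\<^sup>+u. ennreal c * indicator {w<..<w + 1 / \<theta>} u \<partial>lborel)"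
    using theta_ge c0 by (simp add: nn_integral_cmult ennreal_mult'[OF c0, of "1 / \<theta>"] del: times_divide_eq_right)
  also have "\<dots> \<le> (\<integral>\<^sup>+u. ennreal (dens k u) * indicator {w..w + 1 / \<theta>} u \<partial>lborel)"
    using low by (intro nn_integral_mono) (auto simp: indicator_def intro!: ennreal_leI)
  also have "\<dots> = emeasure M (U k -` {w..w + 1 / \<theta>} \<inter> space M)"
    by (rule distributed_emeasure[OF distributed_U, symmetric]) simp
  also have "U k -` {w..w + 1 / \<theta>} \<inter> space M = {\<omega>\<in>space M. U k \<omega> \<in> {w..w + 1 / \<theta>}}" by auto
  finally have "c * (1 / \<theta>) \<le> prob {\<omega>\<in>space M. U k \<omega> \<in> {w..w + 1 / \<theta>}}"
    by (simp add: emeasure_eq_measure)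
  moreover have "c * (1 / \<theta>) = (\<theta> * h) powr (- \<alpha>) * exp (- q * (h + 2 * h\<^sup>2)) / (2 * Gamma (1 - \<alpha>))"
    using theta_ge h0 by (simp add: c_def powr_mult powr_diff powr_minus field_simps)
  ultimately show ?thesis by (simp add: q_def)
qed

text \<open>With \<open>q \<le> 1\<close> the expected number of hits, independence gives some hit
  with probability at least \<open>1 - exp (- q) \<ge> q / 2\<close>. Hits accompanied by too much
  removed length have total probability at most \<open>q / 4\<close>, because the previous bound is
  relative to each hit.\<close>

lemma prob_block_ge:
  assumes J: "finite J" and W [measurable]: "W \<in> sets borel" and s: "0 \<le> s" "s < 1"
    and small: "exp (- s * \<theta> / 2) * 4 ^ card J \<le> 1 / 4"
    and q: "(\<Sum>j\<in>J. prob {\<omega>\<in>space M. U j \<omega> \<in> W}) \<le> 1"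
  shows "(\<Sum>j\<in>J. prob {\<omega>\<in>space M. U j \<omega> \<in> W}) / 4 \<le>
    prob {\<omega>\<in>space M. \<exists>j\<in>J. U j \<omega> \<in> W \<and> 1 - s \<le> (\<Prod>i\<in>J - {j}. 1 - U i \<omega>)}"
proof (cases "J = {}")
  case False
  define p where "p j = prob {\<omega>\<in>space M. U j \<omega> \<in> W}" for j
  define bad where "bad j = {\<omega>\<in>space M. U j \<omega> \<in> W \<and> (\<Prod>i\<in>J - {j}. 1 - U i \<omega>) < 1 - s}" for j
  let ?E = "{\<omega>\<in>space M. \<exists>j\<in>J. U j \<omega> \<in> W \<and> 1 - s \<le> (\<Prod>i\<in>J - {j}. 1 - U i \<omega>)}"
  let ?V = "{\<omega>\<in>space M. \<exists>j\<in>J. U j \<omega> \<in> W}"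
  have [measurable]: "?E \<in> sets M" "?V \<in> sets M" "bad j \<in> sets M" for j
    using J unfolding bad_def by measurable
  have q': "0 \<le> sum p J" "sum p J \<le> 1" using q by (auto simp: p_def sum_nonneg)
  have "prob (\<Inter>j\<in>J. U j -` (- W) \<inter> space M) = (\<Prod>j\<in>J. prob (U j -` (- W) \<inter> space M))"
    using J False by (intro indep_varsD[OF indep]) auto
  also have "\<dots> = (\<Prod>j\<in>J. 1 - p j)"
  proof (intro prod.cong refl)
    fix j
    have "U j -` (- W) \<inter> space M = space M - {\<omega>\<in>space M. U j \<omega> \<in> W}" by auto
    then show "prob (U j -` (- W) \<inter> space M) = 1 - p j" by (simp add: prob_compl p_def)
  qed
  also have "\<dots> \<le> (\<Prod>j\<in>J. exp (- p j))"
  proof (intro prod_mono conjI)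
    show "1 - p j \<le> exp (- p j)" for j using exp_ge_add_one_self[of "- p j"] by simp
  qed (auto simp: p_def)
  also have "\<dots> = exp (- sum p J)" using J by (simp add: exp_sum sum_negf[symmetric])
  also have "\<dots> \<le> 1 - sum p J / 2"
  proof -
    have "exp (- sum p J) \<le> inverse (1 + sum p J)"
      unfolding exp_minus using q' by (intro le_imp_inverse_le exp_ge_add_one_self) auto
    also have "\<dots> \<le> 1 - sum p J / 2"
    proof -
      have "sum p J * sum p J \<le> sum p J * 1" using q' by (intro mult_left_mono) auto
      then have "1 \<le> (1 - sum p J / 2) * (1 + sum p J)" by (simp add: algebra_simps)
      then show ?thesis using q' by (simp add: inverse_eq_divide pos_divide_le_eq)
    qed
    finally show ?thesis .
  qed
  also have "(\<Inter>j\<in>J. U j -` (- W) \<inter> space M) = space M - ?V" using False by auto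
  also have "prob (space M - ?V) = 1 - prob ?V" by (rule prob_compl) measurable
  finally have V: "sum p J / 2 \<le> prob ?V" by simp
  have bad_le: "prob (bad j) \<le> p j / 4" if "j \<in> J" for j
  proof -
    have "prob (bad j) \<le> p j * (exp (- s * \<theta> / 2) * 4 ^ card (J - {j}))"
      unfolding bad_def p_def using J s by (intro prob_remaining_stick_less) auto
    also have "\<dots> \<le> p j * (exp (- s * \<theta> / 2) * 4 ^ card J)"
      using J by (intro mult_left_mono power_increasing card_mono) (auto simp: p_def)
    also have "\<dots> \<le> p j * (1 / 4)" using small by (intro mult_left_mono) (auto simp: p_def)
    finally show ?thesis by simp
  qed
  have "prob ?V \<le> prob (?E \<union> (\<Union>j\<in>J. bad j))"
    using J by (intro finite_measure_mono sets.Un sets.finite_UN) (auto simp: bad_def not_less)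
  also have "\<dots> \<le> prob ?E + prob (\<Union>j\<in>J. bad j)"
    using J by (intro measure_Un_le sets.finite_UN) auto
  also have "prob (\<Union>j\<in>J. bad j) \<le> (\<Sum>j\<in>J. prob (bad j))"
    using J by (intro measure_UNION_le) auto
  also have "\<dots> \<le> (\<Sum>j\<in>J. p j / 4)" by (intro sum_mono bad_le)
  also have "\<dots> = sum p J / 4" by (simp add: sum_divide_distrib)
  finally have "sum p J / 4 \<le> prob ?E" using V by simp
  then show ?thesis by (simp add: p_def)
qed simp

text \<open>Disjoint blocks involve disjoint sets of independent fractions, so the bounds for single
  blocks multiply.\<close>

lemma prob_blocks_ge:
  fixes n :: nat and J :: "nat \<Rightarrow> nat set"
  assumes J: "\<And>k. k < n \<Longrightarrow> finite (J k)" "disjoint_family_on J {..<n}"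
    and W: "\<And>k. W k \<in> sets borel" and s: "0 \<le> s" "s < 1"
    and small: "\<And>k. k < n \<Longrightarrow> exp (- s * \<theta> / 2) * 4 ^ card (J k) \<le> 1 / 4"
    and q: "\<And>k. k < n \<Longrightarrow> (\<Sum>j\<in>J k. prob {\<omega>\<in>space M. U j \<omega> \<in> W k}) \<le> 1"
  shows "(\<Prod>k<n. (\<Sum>j\<in>J k. prob {\<omega>\<in>space M. U j \<omega> \<in> W k}) / 4) \<le>
    prob {\<omega>\<in>space M. \<forall>k<n. \<exists>j\<in>J k. U j \<omega> \<in> W k \<and> 1 - s \<le> (\<Prod>i\<in>J k - {j}. 1 - U i \<omega>)}"
proof (cases "n = 0")
  case False
  \<comment> \<open>The block event is recast as a measurable set of functions on
    \<open>J k\<close>, to which independence of the restrictions applies. \<open>n = 0\<close> is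
    separate because the product rule asks for a nonempty index set.\<close>
  define B where "B k = {f \<in> space (\<Pi>\<^sub>M i\<in>J k. borel). \<exists>j\<in>J k. f j \<in> W k \<and> 1 - s \<le> (\<Prod>i\<in>J k - {j}. 1 - f i :: real)}" for k
  have B: "B k \<in> sets (\<Pi>\<^sub>M i\<in>J k. borel)" if "k < n" for k
  proof -
    have [measurable]: "finite (J k)" "W k \<in> sets borel" using J(1)[OF that] W by auto
    have [measurable]: "(\<lambda>f. f i) \<in> borel_measurable (\<Pi>\<^sub>M i\<in>J k. borel)" if "i \<in> J k" for i
      using that by (rule measurable_component_singleton)
    show ?thesis unfolding B_def
    proof (rule sets.sets_Collect_finite_Ex)
      fix j assume "j \<in> J k"
      then have [measurable]: "(\<lambda>f. f j) \<in> borel_measurable (\<Pi>\<^sub>M i\<in>J k. borel)" by (rule measurable_component_singleton)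
      have [measurable]: "(\<lambda>f. \<Prod>i\<in>J k - {j}. 1 - f i :: real) \<in> borel_measurable (\<Pi>\<^sub>M i\<in>J k. borel)"
        by (intro borel_measurable_prod borel_measurable_diff borel_measurable_const measurable_component_singleton) auto
      show "{f \<in> space (\<Pi>\<^sub>M i\<in>J k. borel). f j \<in> W k \<and> 1 - s \<le> (\<Prod>i\<in>J k - {j}. 1 - f i)} \<in> sets (\<Pi>\<^sub>M i\<in>J k. borel)"
        by measurable
    qed (use J(1)[OF that] in simp)
  qed
  have ind: "indep_vars (\<lambda>k. \<Pi>\<^sub>M i\<in>J k. borel) (\<lambda>k \<omega>. restrict (\<lambda>i. U i \<omega>) (J k)) {..<n}"
    by (rule indep_vars_restrict[OF indep _ J(2)]) simp
  have pre: "(\<lambda>\<omega>. restrict (\<lambda>i. U i \<omega>) (J k)) -` B k \<inter> space M =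
      {\<omega>\<in>space M. \<exists>j\<in>J k. U j \<omega> \<in> W k \<and> 1 - s \<le> (\<Prod>i\<in>J k - {j}. 1 - U i \<omega>)}" for k
  proof -
    have "(\<Prod>i\<in>J k - {j}. 1 - restrict (\<lambda>i. U i \<omega>) (J k) i) = (\<Prod>i\<in>J k - {j}. 1 - U i \<omega>)" for j \<omega>
      by (intro prod.cong) auto
    then show ?thesis by (auto simp: B_def space_PiM simp del: restrict_apply) (auto simp: restrict_def)
  qed
  have "(\<Prod>k<n. (\<Sum>j\<in>J k. prob {\<omega>\<in>space M. U j \<omega> \<in> W k}) / 4) \<le>
      (\<Prod>k<n. prob ((\<lambda>\<omega>. restrict (\<lambda>i. U i \<omega>) (J k)) -` B k \<inter> space M))"
    unfolding pre using J W s small q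
    by (intro prod_mono conjI prob_block_ge divide_nonneg_nonneg sum_nonneg) auto
  also have "\<dots> = prob (\<Inter>k<n. (\<lambda>\<omega>. restrict (\<lambda>i. U i \<omega>) (J k)) -` B k \<inter> space M)"
    using False B by (intro indep_varsD[OF ind, symmetric]) auto
  also have "(\<Inter>k<n. (\<lambda>\<omega>. restrict (\<lambda>i. U i \<omega>) (J k)) -` B k \<inter> space M) =
      {\<omega>\<in>space M. \<forall>k<n. \<exists>j\<in>J k. U j \<omega> \<in> W k \<and> 1 - s \<le> (\<Prod>i\<in>J k - {j}. 1 - U i \<omega>)}"
    unfolding pre using False by auto
  finally show ?thesis .
qed (simp add: prob_space)

section \<open>Measurability and upper tail of the ranked sequence\<close>

lemma measurable_stick_breaking [measurable]:
  "(\<lambda>\<omega>. stick_breaking (\<lambda>k. U k \<omega>) n) \<in> borel_measurable M"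
  unfolding stick_breaking_def by measurable

lemma measurable_PD_sequence: "PD_sequence U \<in> borel_measurable M"
  unfolding PD_sequence_def[abs_def] by (rule measurable_ranked) measurable

lemma measurable_PD_coordinate [measurable]: "(\<lambda>\<omega>. PD_sequence U \<omega> n) \<in> borel_measurable M"
  using measurable_PD_sequence by (rule measurable_product_then_coordinatewise)

lemma AE_PD_sequence:
  "AE \<omega> in M. (\<forall>k. 0 < U k \<omega> \<and> U k \<omega> < 1) \<and>
     descending_rearrangement (stick_breaking (\<lambda>k. U k \<omega>)) (PD_sequence U \<omega>)"
  using AE_U
  by eventually_elim (auto simp: PD_sequence_def intro!: descending_rearrangement_stick_breaking)

text \<open>Each stick is at most the fraction \<open>U\<^sub>j\<close> that produced it, so \<open>prob_sum_excess_le\<close> applies.\<close>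

lemma prob_PD_excess_le:
  assumes "2 \<le> \<beta>" "0 \<le> \<kappa>" "\<kappa> < 1"
  shows "prob {\<omega>\<in>space M. t \<le> (\<Sum>i<n. max 0 (\<theta> * PD_sequence U \<omega> i - \<beta>))} \<le>
    exp (excess_const \<kappa> \<beta> - \<kappa> * t)"
proof -
  define A where "A N = {\<omega>\<in>space M. t \<le> (\<Sum>j<N. max 0 (\<theta> * U j \<omega> - \<beta>))}" for N
  have [measurable]: "A N \<in> sets M" for N unfolding A_def by measurable
  have "AE \<omega> in M. \<omega> \<in> {\<omega>\<in>space M. t \<le> (\<Sum>i<n. max 0 (\<theta> * PD_sequence U \<omega> i - \<beta>))} \<longrightarrow> \<omega> \<in> (\<Union>N. A N)"
    using AE_PD_sequence
  proof eventually_elim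
    case (elim \<omega>)
    show ?case
    proof
      assume \<omega>: "\<omega> \<in> {\<omega>\<in>space M. t \<le> (\<Sum>i<n. max 0 (\<theta> * PD_sequence U \<omega> i - \<beta>))}"
      obtain N where "(\<Sum>i<n. max 0 (\<theta> * PD_sequence U \<omega> i - \<beta>)) \<le>
          (\<Sum>j<N. max 0 (\<theta> * stick_breaking (\<lambda>k. U k \<omega>) j - \<beta>))"
        using descending_rearrangement_sum_le[of "stick_breaking (\<lambda>k. U k \<omega>)" "PD_sequence U \<omega>"
            "\<lambda>x. max 0 (\<theta> * x - \<beta>)" n] elim by auto
      also have "\<dots> \<le> (\<Sum>j<N. max 0 (\<theta> * U j \<omega> - \<beta>))"
      proof (intro sum_mono max.mono)
        fix j
        have "stick_breaking (\<lambda>k. U k \<omega>) j \<le> U j \<omega>" using elim by (intro stick_breaking_le) auto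
        then show "\<theta> * stick_breaking (\<lambda>k. U k \<omega>) j - \<beta> \<le> \<theta> * U j \<omega> - \<beta>"
          using theta_ge by simp
      qed simp
      finally show "\<omega> \<in> (\<Union>N. A N)" using \<omega> by (auto simp: A_def intro: order.trans)
    qed
  qed
  then have "prob {\<omega>\<in>space M. t \<le> (\<Sum>i<n. max 0 (\<theta> * PD_sequence U \<omega> i - \<beta>))} \<le> prob (\<Union>N. A N)"
    by (intro finite_measure_mono_AE) auto
  also have "\<dots> \<le> exp (excess_const \<kappa> \<beta> - \<kappa> * t)"
  proof (rule LIMSEQ_le_const2)
    have "incseq A"
      unfolding incseq_Suc_iff A_def by (auto intro: order.trans)
    then show "(\<lambda>N. prob (A N)) \<longlonglongrightarrow> prob (\<Union>N. A N)"
      by (intro finite_Lim_measure_incseq) auto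
    show "\<exists>N. \<forall>n\<ge>N. prob (A n) \<le> exp (excess_const \<kappa> \<beta> - \<kappa> * t)"
      unfolding A_def using prob_sum_excess_le[OF assms] by blast
  qed
  finally show ?thesis .
qed

end

section \<open>Lower tails and joint lower bounds for the ranked coordinates\<close>

lemma four_le_exp_2: "(4::real) \<le> exp 2"
proof -
  have "(1 + 1) * (1 + 1) \<le> exp 1 * exp (1::real)" by (intro mult_mono exp_ge_add_one_self) auto
  then show ?thesis by (simp flip: exp_add)
qed

lemma exp_beta_center:
  assumes "0 < \<alpha>" "\<alpha> < 1" "1 < \<theta>"
  shows "exp (beta_center \<alpha> \<theta>) = \<theta> * ln \<theta> powr (- \<alpha> - 1) / Gamma (1 - \<alpha>)"
proof -
  have "0 < ln \<theta>" "0 < Gamma (1 - \<alpha>)" using assms by (auto intro: Gamma_real_pos)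
  moreover have "beta_center \<alpha> \<theta> = ln \<theta> + (- \<alpha> - 1) * ln (ln \<theta>) + - ln (Gamma (1 - \<alpha>))"
    by (simp add: beta_center_def algebra_simps)
  ultimately show ?thesis
    using assms by (simp only: exp_add) (simp add: powr_def exp_minus field_simps)
qed

context stick_model begin

text \<open>The number of sticks that contribute at level \<open>log \<theta> / \<theta>\<close>, up to a constant factor.\<close>

definition "block = nat \<lfloor>\<theta> / ln \<theta>\<rfloor>"

text \<open>The 6 balances \<open>4 \<le> exp 2\<close>: the moments of a block cost
  \<open>exp (2 * \<theta> / ln \<theta>)\<close>, while losing the share
  \<open>6 / ln \<theta>\<close> gains \<open>exp (- 3 * \<theta> / ln \<theta>)\<close>.\<close>

lemma block_bounds:
  assumes "1 \<le> ln \<theta>" "2 * ln \<theta> \<le> \<theta>"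
  shows "real block \<le> \<theta> / ln \<theta>" "\<theta> / (2 * ln \<theta>) \<le> real block"
    "exp (- (6 / ln \<theta>) * \<theta> / 2) * 4 ^ block \<le> exp (- (\<theta> / ln \<theta>))"
proof -
  have r: "2 \<le> \<theta> / ln \<theta>" using assms by (simp add: field_simps)
  show le: "real block \<le> \<theta> / ln \<theta>" unfolding block_def using r by simp
  have "\<theta> / ln \<theta> - 1 \<le> real block" unfolding block_def using r by linarith
  then show "\<theta> / (2 * ln \<theta>) \<le> real block" using r by simp
  have "(4::real) ^ block \<le> exp 2 ^ block" by (intro power_mono four_le_exp_2) auto
  also have "\<dots> = exp (real block * 2)" by (simp flip: exp_of_nat_mult)
  also have "\<dots> \<le> exp (\<theta> / ln \<theta> * 2)"
    unfolding exp_le_cancel_iff using le by (intro mult_right_mono) auto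
  finally have "exp (- (6 / ln \<theta>) * \<theta> / 2) * 4 ^ block \<le>
      exp (- (6 / ln \<theta>) * \<theta> / 2) * exp (\<theta> / ln \<theta> * 2)" by simp
  also have "\<dots> = exp (- (\<theta> / ln \<theta>))"
    by (simp flip: exp_add)
  finally show "exp (- (6 / ln \<theta>) * \<theta> / 2) * 4 ^ block \<le> exp (- (\<theta> / ln \<theta>))" .
qed

text \<open>\<open>\<nu>\<close> measures how far out the indices reach: the second beta parameter
  is at most \<open>\<theta> * (1 + \<nu> / ln \<theta>)\<close> there. It is 1 for the initial
  block and \<open>n\<close> for \<open>n\<close> consecutive blocks. The 4 combines a 2 from the
  window bound and a 2 from rounding the block length.\<close>

lemma sum_prob_window_ge:
  assumes L: "1 \<le> ln \<theta>" "2 * ln \<theta> \<le> \<theta>" and x: "0 \<le> x" "2 * (x + 1) \<le> \<theta>"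
    and J: "finite J" "card J = block" "\<And>j. j \<in> J \<Longrightarrow> real (Suc j) \<le> \<nu> * (\<theta> / ln \<theta>)"
    and \<nu>: "0 \<le> \<nu>"
  shows "exp (beta_center \<alpha> \<theta> - (x + 1) / ln \<theta> - (1 + \<nu> / ln \<theta>) * (x + 1) * (1 + 2 * (x + 1) / \<theta>)) / 4
    \<le> (\<Sum>j\<in>J. prob {\<omega>\<in>space M. U j \<omega> \<in> {x / \<theta>..x / \<theta> + 1 / \<theta>}})"
proof -
  define h where "h = x / \<theta> + 1 / \<theta>"
  have h: "h = (x + 1) / \<theta>" by (simp add: h_def add_divide_distrib)
  have \<theta>h: "\<theta> * h = x + 1" using theta_ge by (simp add: h)
  have h0: "0 \<le> h" using x theta_ge by (simp add: h)
  define b where "b = (x + 1) powr (- \<alpha>) * exp (- (1 + \<nu> / ln \<theta>) * (x + 1) * (1 + 2 * (x + 1) / \<theta>)) / (2 * Gamma (1 - \<alpha>))"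
  have b0: "0 \<le> b" unfolding b_def using Gamma_pos by simp
  have "b \<le> prob {\<omega>\<in>space M. U j \<omega> \<in> {x / \<theta>..x / \<theta> + 1 / \<theta>}}" if "j \<in> J" for j
  proof -
    define q where "q = \<theta> + real (Suc j) * \<alpha>"
    have "q \<le> \<theta> + real (Suc j) * 1"
      unfolding q_def using alpha_less by (intro add_left_mono mult_left_mono) auto
    also have "\<dots> \<le> \<theta> * (1 + \<nu> / ln \<theta>)"
      using J(3)[OF that] by (simp add: algebra_simps)
    finally have "q * (h + 2 * h\<^sup>2) \<le> \<theta> * (1 + \<nu> / ln \<theta>) * (h + 2 * h\<^sup>2)"
      using h0 by (intro mult_right_mono) auto
    also have "\<dots> = (1 + \<nu> / ln \<theta>) * (\<theta> * h) * (1 + 2 * h)"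
      by (simp add: algebra_simps power2_eq_square add_divide_distrib)
    also have "\<dots> = (1 + \<nu> / ln \<theta>) * (x + 1) * (1 + 2 * (x + 1) / \<theta>)"
      unfolding \<theta>h by (simp add: h)
    finally have "exp (- (1 + \<nu> / ln \<theta>) * (x + 1) * (1 + 2 * (x + 1) / \<theta>)) \<le> exp (- q * (h + 2 * h\<^sup>2))"
      by (simp only: exp_le_cancel_iff mult_minus_left neg_le_iff_le)
    then have "b \<le> (x + 1) powr (- \<alpha>) * exp (- q * (h + 2 * h\<^sup>2)) / (2 * Gamma (1 - \<alpha>))"
      unfolding b_def using Gamma_pos by (intro divide_right_mono mult_left_mono) auto
    also have "\<dots> = (\<theta> * h) powr (- \<alpha>) * exp (- q * (h + 2 * h\<^sup>2)) / (2 * Gamma (1 - \<alpha>))"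
      by (simp only: \<theta>h)
    also have "\<dots> \<le> prob {\<omega>\<in>space M. U j \<omega> \<in> {x / \<theta>..x / \<theta> + 1 / \<theta>}}"
      unfolding q_def using x theta_ge
      by (intro prob_window_ge h_def) (simp_all add: h)
    finally show ?thesis .
  qed
  then have "(\<Sum>j\<in>J. b) \<le> (\<Sum>j\<in>J. prob {\<omega>\<in>space M. U j \<omega> \<in> {x / \<theta>..x / \<theta> + 1 / \<theta>}})"
    by (intro sum_mono)
  moreover have "\<theta> / (2 * ln \<theta>) * b \<le> (\<Sum>j\<in>J. b)"
    using mult_right_mono[OF block_bounds(2)[OF L] b0] J(2) by simp
  moreover have "exp (beta_center \<alpha> \<theta> - (x + 1) / ln \<theta> - (1 + \<nu> / ln \<theta>) * (x + 1) * (1 + 2 * (x + 1) / \<theta>)) / 4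
      \<le> \<theta> / (2 * ln \<theta>) * b"
  proof -
    \<comment> \<open>The density carries \<open>(x + 1) powr (- \<alpha>)\<close> but the centering
      has \<open>ln \<theta> powr (- \<alpha>)\<close>. Exchanging them through
      \<open>ln t \<le> t\<close> costs \<open>(x + 1) / ln \<theta>\<close> in the exponent,
      whatever the size of \<open>x\<close> relative to \<open>ln \<theta>\<close>.\<close>
    have "\<alpha> * ln ((x + 1) / ln \<theta>) \<le> (x + 1) / ln \<theta>"
    proof (cases "0 \<le> ln ((x + 1) / ln \<theta>)")
      case True
      then have "\<alpha> * ln ((x + 1) / ln \<theta>) \<le> 1 * ln ((x + 1) / ln \<theta>)"
        using alpha_less by (intro mult_right_mono) auto
      also have "\<dots> \<le> (x + 1) / ln \<theta>"
        using ln_le_minus_one[of "(x + 1) / ln \<theta>"] x L by simp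
      finally show ?thesis .
    next
      case False
      then have "\<alpha> * ln ((x + 1) / ln \<theta>) \<le> 0" using alpha_pos by (intro mult_nonneg_nonpos) auto
      also have "0 \<le> (x + 1) / ln \<theta>" using x L by simp
      finally show ?thesis .
    qed
    then have "exp (- ((x + 1) / ln \<theta>)) \<le> exp (- \<alpha> * ln ((x + 1) / ln \<theta>))" by simp
    also have "\<dots> = ((x + 1) / ln \<theta>) powr (- \<alpha>)" using x L by (simp add: powr_def)
    also have "\<dots> = (x + 1) powr (- \<alpha>) * ln \<theta> powr \<alpha>"
      using x L by (simp add: powr_divide powr_minus field_simps)
    finally have 1: "exp (- ((x + 1) / ln \<theta>)) \<le> (x + 1) powr (- \<alpha>) * ln \<theta> powr \<alpha>" .
    have "exp (beta_center \<alpha> \<theta> - (x + 1) / ln \<theta> - (1 + \<nu> / ln \<theta>) * (x + 1) * (1 + 2 * (x + 1) / \<theta>)) / 4 =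
        exp (beta_center \<alpha> \<theta>) * exp (- (1 + \<nu> / ln \<theta>) * (x + 1) * (1 + 2 * (x + 1) / \<theta>)) / 4 *
        exp (- ((x + 1) / ln \<theta>))"
      unfolding mult_minus_left diff_conv_add_uminus exp_add by simp
    also have "\<dots> \<le> exp (beta_center \<alpha> \<theta>) * exp (- (1 + \<nu> / ln \<theta>) * (x + 1) * (1 + 2 * (x + 1) / \<theta>)) / 4 *
        ((x + 1) powr (- \<alpha>) * ln \<theta> powr \<alpha>)"
      using 1 by (intro mult_left_mono) auto
    also have "exp (beta_center \<alpha> \<theta>) = \<theta> * ln \<theta> powr (- \<alpha> - 1) / Gamma (1 - \<alpha>)"
      using alpha_pos alpha_less theta_ge by (intro exp_beta_center) auto
    also have "\<theta> * ln \<theta> powr (- \<alpha> - 1) / Gamma (1 - \<alpha>) *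
        exp (- (1 + \<nu> / ln \<theta>) * (x + 1) * (1 + 2 * (x + 1) / \<theta>)) / 4 * ((x + 1) powr (- \<alpha>) * ln \<theta> powr \<alpha>) =
        \<theta> / (2 * ln \<theta>) * b"
    proof -
      have "ln \<theta> powr (- \<alpha> - 1) * ln \<theta> powr \<alpha> = ln \<theta> powr (- 1)" by (simp flip: powr_add)
      also have "\<dots> = 1 / ln \<theta>" using L by (simp add: powr_minus field_simps)
      finally have inv: "ln \<theta> powr (- \<alpha> - 1) * ln \<theta> powr \<alpha> = 1 / ln \<theta>" .
      have regroup: "\<theta> * ln \<theta> powr (- \<alpha> - 1) / Gamma (1 - \<alpha>) * e / 4 * (B * ln \<theta> powr \<alpha>) =
          \<theta> * B * e / (4 * Gamma (1 - \<alpha>)) * (ln \<theta> powr (- \<alpha> - 1) * ln \<theta> powr \<alpha>)" for e B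
        by (simp add: mult_ac)
      show ?thesis unfolding regroup inv b_def by (simp add: mult_ac)
    qed
    finally show ?thesis .
  qed
  ultimately show ?thesis by linarith
qed

text \<open>Either the initial block removes more than the share \<open>6 / ln \<theta>\<close> of
  the length, or at most \<open>n\<close> of its fractions reach a slightly raised threshold;
  otherwise \<open>n + 1\<close> sticks are large enough. The two summands are the probabilities of
  these failures.\<close>

lemma prob_coordinate_small_le:
  defines "\<beta> \<equiv> beta_center \<alpha> \<theta>"
  assumes z: "0 < z" "z \<le> \<beta>" and L: "13 \<le> ln \<theta>" "16 * (ln \<theta>)\<^sup>2 \<le> \<theta>" "\<beta> \<le> ln \<theta>"
  shows "prob {\<omega>\<in>space M. PD_sequence U \<omega> n < (\<beta> - z) / \<theta>} \<le>
    exp (- (\<theta> / ln \<theta>)) + exp (real n - exp (z - 18) / 8)"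
proof -
  \<comment> \<open>The shift 12 compensates the removed length, since
    \<open>s * x \<le> (6 / ln \<theta>) * (2 * ln \<theta>) = 12\<close>.\<close>
  define x where "x = \<beta> - z + 12"
  define s where "s = 6 / ln \<theta>"
  have "2 * ln \<theta> \<le> 16 * (ln \<theta>)\<^sup>2"
    using L(1) by (simp add: power2_eq_square)
  then have L': "1 \<le> ln \<theta>" "2 * ln \<theta> \<le> \<theta>" using L by auto
  have x: "0 \<le> x" "x + 1 \<le> 2 * ln \<theta>" using z L by (auto simp: x_def)
  have "4 * ln \<theta> \<le> 16 * (ln \<theta>)\<^sup>2" using L(1) by (simp add: power2_eq_square)
  moreover have "2 * (x + 1) \<le> 4 * ln \<theta>" using x by simp
  ultimately have x2: "2 * (x + 1) \<le> \<theta>" using L(2) by (meson order.trans)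
  have s: "0 \<le> s" "s \<le> 1 / 2" using L by (auto simp: s_def field_simps)
  \<comment> \<open>\<open>18 = 12 + 1 + 3 + 2\<close>: the shift in \<open>x\<close>, the width of
    the window, the multiplicative corrections, and
    \<open>(x + 1) / ln \<theta> \<le> 2\<close>.\<close>
  have sum_ge: "exp (z - 18) / 4 \<le> (\<Sum>j<block. prob {\<omega>\<in>space M. x / \<theta> \<le> U j \<omega>})"
  proof -
    have "(1 + 1 / ln \<theta>) * (x + 1) * (1 + 2 * (x + 1) / \<theta>) \<le> (x + 1) + 3"
    proof -
      have "(1 + 1 / ln \<theta>) * (x + 1) \<le> (x + 1) + 2"
        using x L' by (simp add: field_simps)
      moreover have "(1 + 1 / ln \<theta>) * (x + 1) * (2 * (x + 1) / \<theta>) \<le> 1"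
      proof -
        have "(1 + 1 / ln \<theta>) * (x + 1) * (2 * (x + 1) / \<theta>) \<le> 2 * (2 * ln \<theta>) * (2 * (2 * ln \<theta>) / \<theta>)"
          using x L' theta_ge by (intro mult_mono divide_right_mono) (auto simp: field_simps)
        also have "\<dots> = 16 * (ln \<theta>)\<^sup>2 / \<theta>" by (simp add: power2_eq_square)
        also have "\<dots> \<le> 1" using L(2) theta_ge by simp
        finally show ?thesis .
      qed
      moreover have "(1 + 1 / ln \<theta>) * (x + 1) * (1 + 2 * (x + 1) / \<theta>) =
          (1 + 1 / ln \<theta>) * (x + 1) + (1 + 1 / ln \<theta>) * (x + 1) * (2 * (x + 1) / \<theta>)"
        by (simp add: distrib_left)
      ultimately show ?thesis by linarith
    qed
    moreover have "(x + 1) / ln \<theta> \<le> 2" using x L' by (simp add: field_simps)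
    ultimately have "z - 18 \<le> \<beta> - (x + 1) / ln \<theta> - (1 + 1 / ln \<theta>) * (x + 1) * (1 + 2 * (x + 1) / \<theta>)"
      by (simp add: x_def)
    then have "exp (z - 18) / 4 \<le>
        exp (\<beta> - (x + 1) / ln \<theta> - (1 + 1 / ln \<theta>) * (x + 1) * (1 + 2 * (x + 1) / \<theta>)) / 4" by simp
    also have "\<dots> \<le> (\<Sum>j<block. prob {\<omega>\<in>space M. U j \<omega> \<in> {x / \<theta>..x / \<theta> + 1 / \<theta>}})"
      unfolding \<beta>_def using block_bounds(1)[OF L']
      by (intro sum_prob_window_ge L' x x2) auto
    also have "\<dots> \<le> (\<Sum>j<block. prob {\<omega>\<in>space M. x / \<theta> \<le> U j \<omega>})"
      by (intro sum_mono finite_measure_mono) auto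
    finally show ?thesis .
  qed
  have thr: "(\<beta> - z) / \<theta> \<le> (1 - s) * (x / \<theta>)"
  proof -
    have "s * x \<le> s * (2 * ln \<theta>)" using x s by (intro mult_left_mono) auto
    also have "\<dots> = 12" using L by (simp add: s_def)
    finally have "\<beta> - z \<le> (1 - s) * x" by (simp add: x_def algebra_simps)
    then show ?thesis using theta_ge by (simp add: divide_right_mono)
  qed
  \<comment> \<open>The vacuous condition on \<open>U block\<close> brings the event into the form
    of \<open>prob_remaining_stick_less\<close>, with an index outside the block.\<close>
  let ?A = "{\<omega>\<in>space M. U block \<omega> \<in> UNIV \<and> (\<Prod>i<block. 1 - U i \<omega>) < 1 - s}"
  let ?B = "{\<omega>\<in>space M. card {j\<in>{..<block}. x / \<theta> \<le> U j \<omega>} \<le> n}"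
  have "AE \<omega> in M. \<omega> \<in> {\<omega>\<in>space M. PD_sequence U \<omega> n < (\<beta> - z) / \<theta>} \<longrightarrow> \<omega> \<in> ?A \<union> ?B"
    using AE_PD_sequence
  proof eventually_elim
    case (elim \<omega>)
    show ?case
    proof (intro impI, rule ccontr)
      assume *: "\<omega> \<in> {\<omega>\<in>space M. PD_sequence U \<omega> n < (\<beta> - z) / \<theta>}" "\<omega> \<notin> ?A \<union> ?B"
      have "(\<beta> - z) / \<theta> \<le> PD_sequence U \<omega> n"
      proof (rule descending_rearrangement_geI)
        show "descending_rearrangement (stick_breaking (\<lambda>k. U k \<omega>)) (PD_sequence U \<omega>)" using elim by simp
        show "n < card {j\<in>{..<block}. x / \<theta> \<le> U j \<omega>}" using * by auto
        fix j assume j: "j \<in> {j\<in>{..<block}. x / \<theta> \<le> U j \<omega>}"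
        have "(1 - s) * (x / \<theta>) \<le> (\<Prod>i<block. 1 - U i \<omega>) * U j \<omega>"
          using * j s x theta_ge elim by (intro mult_mono prod_nonneg) (auto simp: not_less less_imp_le)
        also have "\<dots> \<le> stick_breaking (\<lambda>k. U k \<omega>) j"
          using elim j by (intro stick_breaking_ge) auto
        finally show "(\<beta> - z) / \<theta> \<le> stick_breaking (\<lambda>k. U k \<omega>) j" using thr by simp
      qed simp
      then show False using * by simp
    qed
  qed
  moreover have [measurable]: "?A \<in> sets M" by measurable
  moreover have [measurable]: "?B \<in> sets M"
  proof -
    have "?B = {\<omega>\<in>space M. (\<Sum>j<block. if x / \<theta> \<le> U j \<omega> then 1 else 0) \<le> real n}"
      by (simp add: sum.If_cases Int_def)
    also have "\<dots> \<in> sets M" by measurable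
    finally show ?thesis .
  qed
  ultimately have "prob {\<omega>\<in>space M. PD_sequence U \<omega> n < (\<beta> - z) / \<theta>} \<le> prob (?A \<union> ?B)"
    by (intro finite_measure_mono_AE) auto
  also have "\<dots> \<le> prob ?A + prob ?B" by (intro measure_Un_le) measurable
  also have "prob ?A \<le> prob {\<omega>\<in>space M. U block \<omega> \<in> UNIV} * (exp (- s * \<theta> / 2) * 4 ^ card {..<block})"
    using s by (intro prob_remaining_stick_less) auto
  also have "\<dots> \<le> 1 * (exp (- s * \<theta> / 2) * 4 ^ card {..<block})"
    by (intro mult_right_mono) auto
  also have "\<dots> \<le> exp (- (\<theta> / ln \<theta>))"
    using block_bounds(3)[OF L'] by (simp add: s_def)
  also have "prob ?B \<le> exp (real n - (\<Sum>j<block. prob {\<omega>\<in>space M. x / \<theta> \<le> U j \<omega>}) / 2)"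
    by (intro prob_few_large_le) auto
  also have "\<dots> \<le> exp (real n - exp (z - 18) / 8)" using sum_ge by simp
  finally show ?thesis by simp
qed

text \<open>Each of \<open>n\<close> consecutive blocks places one fraction in its own window;
  \<open>y\<close> is the window position reduced by the removed length. As \<open>y\<close>
  decreases, the sticks selected in the first \<open>k + 1\<close> blocks all reach
  \<open>y k / \<theta>\<close>, which bounds the ranked coordinate \<open>k\<close> without
  identifying the largest sticks.\<close>

lemma prob_coordinates_large_ge:
  fixes n :: nat and x y :: "nat \<Rightarrow> real"
  defines "\<beta> \<equiv> beta_center \<alpha> \<theta>"
  assumes n: "0 < n" and L: "6 \<le> ln \<theta>" "2 * ln \<theta> \<le> \<theta>" and \<beta>: "2 \<le> \<beta>"
    and x: "\<And>k. k < n \<Longrightarrow> \<beta> + t \<le> x k" "\<And>k. k < n \<Longrightarrow> x k \<le> X"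
    and t: "0 < t" "excess_const (1 / 2) \<beta> * exp (- (1 / 2) * t) \<le> 1"
    and X: "2 * (X + 1) \<le> \<theta>" "6 / ln \<theta> + (X + 1) / \<theta> \<le> 1"
    and y: "\<And>k. k < n \<Longrightarrow> y k \<le> (1 - real n * (6 / ln \<theta> + (X + 1) / \<theta>)) * x k"
      "\<And>k l. k \<le> l \<Longrightarrow> l < n \<Longrightarrow> y l \<le> y k"
  shows "(\<Prod>k<n. exp (\<beta> - (x k + 1) / ln \<theta> - (1 + real n / ln \<theta>) * (x k + 1) * (1 + 2 * (x k + 1) / \<theta>)) / 16)
    \<le> prob {\<omega>\<in>space M. \<forall>k<n. y k / \<theta> \<le> PD_sequence U \<omega> k}"
proof -
  define s where "s = 6 / ln \<theta>"
  define h where "h = (X + 1) / \<theta>"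
  define J where "J k = {k * block..<Suc k * block}" for k
  define W where "W k = {x k / \<theta>..x k / \<theta> + 1 / \<theta>}" for k
  have L': "1 \<le> ln \<theta>" using L by simp
  have x0: "0 \<le> x k" if "k < n" for k using x(1)[OF that] t \<beta> by simp
  have X0: "0 \<le> X" using x0[OF n] x(2)[OF n] by simp
  have "0 < (X + 1) / \<theta>" using X0 theta_ge by (intro divide_pos_pos) auto
  with X(2) have s: "0 \<le> s" "s < 1" using L by (simp add: s_def, unfold s_def, linarith)
  have h: "0 \<le> h" "h \<le> 1 / 2" "s + h \<le> 1" using X X0 theta_ge by (auto simp: h_def s_def field_simps)
  have J: "finite (J k)" "card (J k) = block" for k by (auto simp: J_def)
  have disj: "J k \<inter> J l = {}" if "k < l" for k l
  proof -
    have "Suc k * block \<le> l * block" using that by (intro mult_le_mono1) simp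
    then show ?thesis by (auto simp: J_def)
  qed
  have disjoint: "disjoint_family_on J {..<n}"
    unfolding disjoint_family_on_def using disj by (metis inf_commute linorder_neqE_nat)
  have Jn: "J k \<subseteq> {..<n * block}" if "k < n" for k
  proof -
    have "Suc k * block \<le> n * block" using that by (intro mult_le_mono1) simp
    then show ?thesis by (auto simp: J_def)
  qed
  \<comment> \<open>The blocks tile an initial segment, so the product over all of them is the
    remaining length in \<open>stick_breaking_ge\<close>.\<close>
  have JU: "(\<Union>k<n. J k) = {..<n * block}"
  proof (intro equalityI subsetI)
    fix j assume j: "j \<in> {..<n * block}"
    then have "0 < block" by (cases "block = 0") auto
    then have "j div block < n" "j \<in> J (j div block)"
      using j by (auto simp: J_def less_mult_imp_div_less dividend_less_times_div
          intro: dividend_less_div_times less_imp_le)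
    then show "j \<in> (\<Union>k<n. J k)" by blast
  qed (use Jn in blast)
  have "(\<Prod>k<n. exp (\<beta> - (x k + 1) / ln \<theta> - (1 + real n / ln \<theta>) * (x k + 1) * (1 + 2 * (x k + 1) / \<theta>)) / 16)
     \<le> (\<Prod>k<n. (\<Sum>j\<in>J k. prob {\<omega>\<in>space M. U j \<omega> \<in> W k}) / 4)"
  proof (intro prod_mono conjI)
    fix k assume "k \<in> {..<n}"
    then have k: "k < n" by simp
    have "exp (\<beta> - (x k + 1) / ln \<theta> - (1 + real n / ln \<theta>) * (x k + 1) * (1 + 2 * (x k + 1) / \<theta>)) / 4
      \<le> (\<Sum>j\<in>J k. prob {\<omega>\<in>space M. U j \<omega> \<in> W k})"
      unfolding \<beta>_def W_def
    proof (rule sum_prob_window_ge[OF L' L(2) x0[OF k] _ J])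
      show "2 * (x k + 1) \<le> \<theta>" using X(1) x(2)[OF k] by (simp add: distrib_left)
      fix j assume "j \<in> J k"
      then have "j < n * block" using Jn[OF k] by blast
      then have "Suc j \<le> n * block" by simp
      then have "real (Suc j) \<le> real n * real block" by (simp flip: of_nat_mult del: of_nat_Suc)
      also have "\<dots> \<le> real n * (\<theta> / ln \<theta>)"
        using block_bounds(1)[OF L' L(2)] by (intro mult_left_mono) auto
      finally show "real (Suc j) \<le> real n * (\<theta> / ln \<theta>)" .
    qed simp
    then show "exp (\<beta> - (x k + 1) / ln \<theta> - (1 + real n / ln \<theta>) * (x k + 1) * (1 + 2 * (x k + 1) / \<theta>)) / 16
      \<le> (\<Sum>j\<in>J k. prob {\<omega>\<in>space M. U j \<omega> \<in> W k}) / 4" by simp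
  qed simp
  also have "\<dots> \<le> prob {\<omega>\<in>space M. \<forall>k<n. \<exists>j\<in>J k. U j \<omega> \<in> W k \<and> 1 - s \<le> (\<Prod>i\<in>J k - {j}. 1 - U i \<omega>)}"
  proof (rule prob_blocks_ge[OF J(1) disjoint _ s])
    show "W k \<in> sets borel" for k by (simp add: W_def)
    fix k assume k: "k < n"
    have "exp (- (\<theta> / ln \<theta>)) \<le> exp (- 2)" using L L' by (simp add: field_simps)
    also have "\<dots> \<le> 1 / 4" using four_le_exp_2 by (simp add: exp_minus field_simps)
    finally show "exp (- s * \<theta> / 2) * 4 ^ card (J k) \<le> 1 / 4"
      using block_bounds(3)[OF L' L(2)] by (simp add: s_def J)
    \<comment> \<open>All windows lie at least \<open>t\<close> above the centering, where the
      expected number of fractions is at most 1.\<close>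
    have "(\<Sum>j\<in>J k. prob {\<omega>\<in>space M. U j \<omega> \<in> W k}) \<le> (\<Sum>j\<in>J k. prob {\<omega>\<in>space M. \<beta> + t \<le> \<theta> * U j \<omega>})"
    proof (intro sum_mono finite_measure_mono subsetI)
      fix j \<omega> assume "\<omega> \<in> {\<omega>\<in>space M. U j \<omega> \<in> W k}"
      then have "\<omega> \<in> space M" "x k / \<theta> \<le> U j \<omega>" by (auto simp: W_def)
      then have "x k \<le> \<theta> * U j \<omega>" using theta_ge by (simp add: field_simps)
      then show "\<omega> \<in> {\<omega>\<in>space M. \<beta> + t \<le> \<theta> * U j \<omega>}"
        using \<open>\<omega> \<in> space M\<close> x(1)[OF k] by simp
    qed simp
    also have "\<dots> \<le> excess_const (1 / 2) \<beta> * exp (- (1 / 2) * t)"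
      using \<beta> t J by (intro sum_prob_tail_le) auto
    finally show "(\<Sum>j\<in>J k. prob {\<omega>\<in>space M. U j \<omega> \<in> W k}) \<le> 1" using t(2) by simp
  qed
  also have "\<dots> \<le> prob {\<omega>\<in>space M. \<forall>k<n. y k / \<theta> \<le> PD_sequence U \<omega> k}"
  proof (rule finite_measure_mono_AE)
    show "AE \<omega> in M. \<omega> \<in> {\<omega>\<in>space M. \<forall>k<n. \<exists>j\<in>J k. U j \<omega> \<in> W k \<and> 1 - s \<le> (\<Prod>i\<in>J k - {j}. 1 - U i \<omega>)} \<longrightarrow>
        \<omega> \<in> {\<omega>\<in>space M. \<forall>k<n. y k / \<theta> \<le> PD_sequence U \<omega> k}"
      using AE_PD_sequence
    proof eventually_elim
      case (elim \<omega>)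
      show ?case
      proof
        assume \<omega>: "\<omega> \<in> {\<omega>\<in>space M. \<forall>k<n. \<exists>j\<in>J k. U j \<omega> \<in> W k \<and> 1 - s \<le> (\<Prod>i\<in>J k - {j}. 1 - U i \<omega>)}"
        then obtain j where j: "\<And>k. k < n \<Longrightarrow> j k \<in> J k" "\<And>k. k < n \<Longrightarrow> U (j k) \<omega> \<in> W k"
          "\<And>k. k < n \<Longrightarrow> 1 - s \<le> (\<Prod>i\<in>J k - {j k}. 1 - U i \<omega>)"
          by simp metis
        \<comment> \<open>The block event controls only the product without the selected fraction;
          the right end of its window bounds that fraction by \<open>h\<close> and restores the
          missing factor.\<close>
        have block_prod: "1 - (s + h) \<le> (\<Prod>i\<in>J k. 1 - U i \<omega>)" if k: "k < n" for k
        proof -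
          have "U (j k) \<omega> \<le> (x k + 1) / \<theta>" using j(2)[OF k] by (simp add: W_def add_divide_distrib)
          also have "\<dots> \<le> h" unfolding h_def using x(2)[OF k] theta_ge by (intro divide_right_mono) auto
          finally have "(1 - h) * (1 - s) \<le> (1 - U (j k) \<omega>) * (\<Prod>i\<in>J k - {j k}. 1 - U i \<omega>)"
            using h s j(3)[OF k] by (intro mult_mono) auto
          also have "\<dots> = (\<Prod>i\<in>J k. 1 - U i \<omega>)"
            using j(1)[OF k] J by (simp add: prod.remove)
          finally have "1 - (s + h) + h * s \<le> (\<Prod>i\<in>J k. 1 - U i \<omega>)"
            by (simp add: algebra_simps)
          then show ?thesis using mult_nonneg_nonneg[OF h(1) s(1)] by linarith
        qed
        have "1 - real n * (s + h) \<le> (1 - (s + h)) ^ n"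
          using Bernoulli_inequality[of "- (s + h)" n] h by (simp add: algebra_simps)
        also have "\<dots> = (\<Prod>k<n. 1 - (s + h))" by simp
        also have "\<dots> \<le> (\<Prod>k<n. \<Prod>i\<in>J k. 1 - U i \<omega>)"
          using block_prod h by (intro prod_mono) auto
        also have "\<dots> = (\<Prod>i<n * block. 1 - U i \<omega>)"
          unfolding JU[symmetric] using J disjoint
          by (intro prod.UNION_disjoint[symmetric]) (auto simp: disjoint_family_on_def)
        finally have T: "1 - real n * (s + h) \<le> (\<Prod>i<n * block. 1 - U i \<omega>)" .
        have stick: "y k / \<theta> \<le> stick_breaking (\<lambda>k. U k \<omega>) (j k)" if k: "k < n" for k
        proof -
          have "y k / \<theta> \<le> (1 - real n * (s + h)) * (x k / \<theta>)"
            using divide_right_mono[OF y(1)[OF k], of \<theta>] theta_ge by (simp add: s_def h_def)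
          also have "\<dots> \<le> (\<Prod>i<n * block. 1 - U i \<omega>) * (x k / \<theta>)"
            using T x0[OF k] theta_ge by (intro mult_right_mono) auto
          also have "\<dots> \<le> (\<Prod>i<n * block. 1 - U i \<omega>) * U (j k) \<omega>"
            using j(2)[OF k] elim by (intro mult_left_mono prod_nonneg) (auto simp: W_def less_imp_le)
          also have "\<dots> \<le> stick_breaking (\<lambda>k. U k \<omega>) (j k)"
            using elim j(1)[OF k] Jn[OF k] by (intro stick_breaking_ge) auto
          finally show ?thesis .
        qed
        have "y k / \<theta> \<le> PD_sequence U \<omega> k" if k: "k < n" for k
        proof (rule descending_rearrangement_geI)
          show "descending_rearrangement (stick_breaking (\<lambda>k. U k \<omega>)) (PD_sequence U \<omega>)" using elim by simp
          have "inj_on j {..k}"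
          proof (rule inj_onI)
            fix l m assume lm: "l \<in> {..k}" "m \<in> {..k}" "j l = j m"
            then have "j l \<in> J l \<inter> J m" using j(1)[of l] j(1)[of m] k by auto
            then show "l = m" using disj[of l m] disj[of m l] by (cases l m rule: linorder_cases) auto
          qed
          then show "k < card (j ` {..k})" by (simp add: card_image)
          fix i assume "i \<in> j ` {..k}"
          then obtain l where l: "l \<le> k" "i = j l" by auto
          have "y k / \<theta> \<le> y l / \<theta>" using y(2)[OF l(1) k] theta_ge by (intro divide_right_mono) auto
          then show "y k / \<theta> \<le> stick_breaking (\<lambda>k. U k \<omega>) i"
            using stick[of l] l k by simp
        qed simp
        then show "\<omega> \<in> {\<omega>\<in>space M. \<forall>k<n. y k / \<theta> \<le> PD_sequence U \<omega> k}" using \<omega> by simp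
      qed
    qed
  qed measurable
  finally show ?thesis .
qed

end

section \<open>Asymptotics\<close>

locale PD_family =
  fixes \<alpha> :: real and a :: "real \<Rightarrow> real"
    and M :: "real \<Rightarrow> 'w measure" and U :: "real \<Rightarrow> nat \<Rightarrow> 'w \<Rightarrow> real"
  assumes \<alpha>_pos: "0 < \<alpha>" and \<alpha>_less: "\<alpha> < 1"
    and a_at_top: "filterlim a at_top at_top"
    and speed_0: "((\<lambda>\<theta>. a \<theta> / \<theta>) \<longlongrightarrow> 0) at_top"
    and sticks: "\<And>\<theta>. \<theta> > 0 \<Longrightarrow> PD_sticks \<alpha> \<theta> (M \<theta>) (U \<theta>)"
begin

abbreviation R :: "real \<Rightarrow> real" where "R \<theta> \<equiv> \<theta> / a \<theta>"

abbreviation \<beta> :: "real \<Rightarrow> real" where "\<beta> \<theta> \<equiv> beta_center \<alpha> \<theta>"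

definition Y :: "real \<Rightarrow> 'w \<Rightarrow> nat \<Rightarrow> real" where
  "Y \<theta> \<omega> n = a \<theta> * (PD_sequence (U \<theta>) \<omega> n - \<beta> \<theta> / \<theta>)"

lemma stick_model: "2 \<le> \<theta> \<Longrightarrow> stick_model \<alpha> \<theta> (M \<theta>) (U \<theta>)"
  using \<alpha>_pos \<alpha>_less sticks[of \<theta>] by unfold_locales auto

lemma eventually_a_pos: "\<forall>\<^sub>F \<theta> in at_top. 0 < a \<theta>"
  using a_at_top by (simp add: filterlim_at_top_dense)

lemma R_at_top: "filterlim R at_top at_top"
proof -
  have "\<forall>\<^sub>F \<theta> in at_top. 0 < a \<theta> / \<theta>"
    using eventually_a_pos eventually_gt_at_top[of 0] by eventually_elim simp
  from filterlim_inverse_at_top[OF speed_0 this] show ?thesis by simp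
qed

lemma inverse_a_tendsto: "((\<lambda>\<theta>. 1 / a \<theta>) \<longlongrightarrow> 0) at_top"
  using tendsto_inverse_0_at_top[OF a_at_top] by (simp add: inverse_eq_divide)

lemma eventually_center_bounds:
  "\<forall>\<^sub>F \<theta> in at_top. 2 \<le> \<beta> \<theta> \<and> \<beta> \<theta> \<le> ln \<theta> \<and> ln \<theta> / 2 \<le> \<beta> \<theta>"
proof -
  have "\<forall>\<^sub>F \<theta> in at_top. 2 \<le> ln \<theta> - (\<alpha> + 1) * ln (ln \<theta>) - c" for c :: real
    using \<alpha>_pos by real_asymp
  moreover have "\<forall>\<^sub>F \<theta> in at_top. ln \<theta> - (\<alpha> + 1) * ln (ln \<theta>) - c \<le> ln \<theta>" for c :: real
    using \<alpha>_pos by real_asymp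
  moreover have "\<forall>\<^sub>F \<theta> in at_top. ln \<theta> / 2 \<le> ln \<theta> - (\<alpha> + 1) * ln (ln \<theta>) - c" for c :: real
    using \<alpha>_pos by real_asymp
  ultimately show ?thesis unfolding beta_center_def by (intro eventually_conj)
qed

text \<open>\<open>exp (- \<beta> \<theta>)\<close> cancels \<theta> and the Gamma factor and leaves
  a multiple of \<open>(ln \<theta> / \<beta> \<theta>) powr (\<alpha> + 1)\<close>, where
  eventually \<open>ln \<theta> \<le> 2 * \<beta> \<theta>\<close>.\<close>

lemma excess_const_bounded:
  assumes "\<kappa> < 1"
  shows "\<exists>C. \<forall>\<^sub>F \<theta> in at_top. stick_model.excess_const \<alpha> \<theta> \<kappa> (\<beta> \<theta>) \<le> C"
proof (intro exI)
  show "\<forall>\<^sub>F \<theta> in at_top. stick_model.excess_const \<alpha> \<theta> \<kappa> (\<beta> \<theta>) \<le> 4 * exp 2 / (\<alpha> * (1 - \<kappa>)) * 2 powr (\<alpha> + 1)"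
    using eventually_center_bounds eventually_ge_at_top[of 3]
  proof eventually_elim
    case (elim \<theta>)
    interpret stick_model \<alpha> \<theta> "M \<theta>" "U \<theta>" using elim by (intro stick_model) simp
    define L where "L = ln \<theta>"
    have L: "0 < L" "L \<le> 2 * \<beta> \<theta>" "0 < \<beta> \<theta>" using elim by (auto simp: L_def)
    have "exp (- \<beta> \<theta>) = Gamma (1 - \<alpha>) / (\<theta> * L powr (- \<alpha> - 1))"
      using exp_beta_center[of \<alpha> \<theta>] elim \<alpha>_pos \<alpha>_less by (simp add: exp_minus L_def)
    then have "excess_const \<kappa> (\<beta> \<theta>) =
        4 * exp 2 / (\<alpha> * (1 - \<kappa>)) * (\<beta> \<theta> powr (- \<alpha> - 1) / L powr (- \<alpha> - 1))"
      using theta_ge Gamma_pos by (simp add: excess_const_def)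
    also have "\<beta> \<theta> powr (- \<alpha> - 1) / L powr (- \<alpha> - 1) = (L / \<beta> \<theta>) powr (\<alpha> + 1)"
      using L by (simp add: powr_divide powr_diff powr_minus powr_add field_simps)
    also have "4 * exp 2 / (\<alpha> * (1 - \<kappa>)) * (L / \<beta> \<theta>) powr (\<alpha> + 1) \<le> 4 * exp 2 / (\<alpha> * (1 - \<kappa>)) * 2 powr (\<alpha> + 1)"
      using L \<alpha>_pos assms by (intro mult_left_mono powr_mono2) (auto simp: field_simps)
    finally show ?case .
  qed
qed

lemma measurable_Y:
  "2 \<le> \<theta> \<Longrightarrow> (\<lambda>\<omega>. Y \<theta> \<omega> n) \<in> borel_measurable (M \<theta>)"
  unfolding Y_def using stick_model.measurable_PD_coordinate[OF stick_model] by measurable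

lemma Y_eq: "0 < a \<theta> \<Longrightarrow> 0 < \<theta> \<Longrightarrow> Y \<theta> \<omega> n = (\<theta> * PD_sequence (U \<theta>) \<omega> n - \<beta> \<theta>) / R \<theta>"
  by (simp add: Y_def field_simps)

lemma eventually_prob_sum_pos_le:
  assumes "0 \<le> \<gamma>'" "\<gamma>' < \<gamma>"
  shows "\<forall>\<^sub>F \<theta> in at_top. measure (M \<theta>) {\<omega>\<in>space (M \<theta>). \<gamma> \<le> (\<Sum>i<n. max 0 (Y \<theta> \<omega> i))} \<le> exp (- \<gamma>' * R \<theta>)"
proof -
  \<comment> \<open>This makes \<open>\<kappa> * \<gamma>\<close> the midpoint of
    \<open>\<gamma>'\<close> and \<open>\<gamma>\<close>: \<kappa> stays below 1, and the surplus
    \<open>(\<gamma> - \<gamma>') / 2 * R \<theta>\<close> absorbs the constant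
    \<open>C\<close>.\<close>
  define \<kappa> where "\<kappa> = (\<gamma> + \<gamma>') / (2 * \<gamma>)"
  have \<kappa>: "0 \<le> \<kappa>" "\<kappa> < 1" using assms by (auto simp: \<kappa>_def field_simps)
  obtain C where C: "\<forall>\<^sub>F \<theta> in at_top. stick_model.excess_const \<alpha> \<theta> \<kappa> (\<beta> \<theta>) \<le> C"
    using excess_const_bounded[OF \<kappa>(2)] by blast
  have "\<forall>\<^sub>F \<theta> in at_top. C / ((\<gamma> - \<gamma>') / 2) \<le> R \<theta>"
    using R_at_top by (simp add: filterlim_at_top)
  then show ?thesis
    using C eventually_center_bounds eventually_ge_at_top[of 3] eventually_a_pos
  proof eventually_elim
    case (elim \<theta>)
    interpret stick_model \<alpha> \<theta> "M \<theta>" "U \<theta>" using elim by (intro stick_model) simp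
    have R: "0 < R \<theta>" using elim by simp
    have "R \<theta> * max 0 (Y \<theta> \<omega> i) = max 0 (\<theta> * PD_sequence (U \<theta>) \<omega> i - \<beta> \<theta>)" for \<omega> i
    proof -
      have "R \<theta> * Y \<theta> \<omega> i = \<theta> * PD_sequence (U \<theta>) \<omega> i - \<beta> \<theta>"
        using Y_eq[of \<theta> \<omega> i] R elim by simp
      then show ?thesis using max_mult_distrib_left[of "R \<theta>" 0 "Y \<theta> \<omega> i"] R by simp
    qed
    then have scale: "R \<theta> * (\<Sum>i<n. max 0 (Y \<theta> \<omega> i)) = (\<Sum>i<n. max 0 (\<theta> * PD_sequence (U \<theta>) \<omega> i - \<beta> \<theta>))" for \<omega>
      by (simp add: sum_distrib_left)
    have "\<gamma> \<le> (\<Sum>i<n. max 0 (Y \<theta> \<omega> i)) \<longleftrightarrow> R \<theta> * \<gamma> \<le> (\<Sum>i<n. max 0 (\<theta> * PD_sequence (U \<theta>) \<omega> i - \<beta> \<theta>))" for \<omega>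
      unfolding scale[symmetric] using R by (rule mult_le_cancel_left_pos[symmetric])
    then have "prob {\<omega>\<in>space (M \<theta>). \<gamma> \<le> (\<Sum>i<n. max 0 (Y \<theta> \<omega> i))} =
        prob {\<omega>\<in>space (M \<theta>). R \<theta> * \<gamma> \<le> (\<Sum>i<n. max 0 (\<theta> * PD_sequence (U \<theta>) \<omega> i - \<beta> \<theta>))}" by presburger
    also have "\<dots> \<le> exp (excess_const \<kappa> (\<beta> \<theta>) - \<kappa> * (R \<theta> * \<gamma>))"
      using elim \<kappa> by (intro prob_PD_excess_le) auto
    also have "\<dots> \<le> exp (- \<gamma>' * R \<theta>)"
    proof -
      have "C \<le> (\<gamma> - \<gamma>') / 2 * R \<theta>" using elim(1) assms by (simp add: field_simps)
      also have "\<dots> = \<kappa> * (R \<theta> * \<gamma>) - \<gamma>' * R \<theta>"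
      proof -
        have "\<kappa> * \<gamma> = (\<gamma> + \<gamma>') / 2" using assms by (simp add: \<kappa>_def)
        then have "\<kappa> * (R \<theta> * \<gamma>) = (\<gamma> + \<gamma>') / 2 * R \<theta>" by (metis mult.assoc mult.commute)
        moreover have "(\<gamma> - \<gamma>') / 2 * \<rho> = (\<gamma> + \<gamma>') / 2 * \<rho> - \<gamma>' * \<rho>" for \<rho>
          by (simp add: field_simps)
        ultimately show ?thesis by (simp only:)
      qed
      finally show ?thesis using elim(2) by simp
    qed
    finally show ?case .
  qed
qed

text \<open>The doubly exponential term beats every \<open>K\<close> by itself. The term
  \<open>exp (- (\<theta> / ln \<theta>))\<close> does so only while \<open>R \<theta>\<close> is at
  most of order \<open>ln \<theta>\<close>; for larger \<open>R \<theta>\<close> the threshold is no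
  longer positive and the event is null.\<close>

lemma eventually_prob_below_le:
  assumes \<delta>: "0 < \<delta>"
  shows "\<forall>\<^sub>F \<theta> in at_top. measure (M \<theta>) {\<omega>\<in>space (M \<theta>). Y \<theta> \<omega> n < - \<delta>} \<le> exp (- K * R \<theta>)"
proof -
  have "\<forall>\<^sub>F r in at_top. exp (real n - exp (\<delta> * r / 2 - 18) / 8) \<le> exp (- K * r) / 2"
  proof -
    have "\<forall>\<^sub>F r in at_top. real n + K * r + ln 2 \<le> exp (\<delta> * r / 2 - 18) / 8"
      using \<delta> by real_asymp
    then show ?thesis
    proof eventually_elim
      case (elim r)
      then have "exp (real n - exp (\<delta> * r / 2 - 18) / 8) \<le> exp (- K * r - ln 2)" by simp
      then show ?case by (simp add: exp_diff)
    qed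
  qed
  from eventually_compose_filterlim[OF this R_at_top]
  have 1: "\<forall>\<^sub>F \<theta> in at_top. exp (real n - exp (\<delta> * R \<theta> / 2 - 18) / 8) \<le> exp (- K * R \<theta>) / 2" .
  have 2: "\<forall>\<^sub>F \<theta> in at_top. \<bar>K\<bar> * (ln \<theta> / \<delta>) + ln 2 \<le> \<theta> / ln \<theta>"
  proof -
    have "\<forall>\<^sub>F \<theta> in at_top. c * (ln \<theta> / \<delta>) + ln 2 \<le> \<theta> / ln \<theta>" for c :: real
      using \<delta> by real_asymp
    then show ?thesis .
  qed
  have 3: "\<forall>\<^sub>F \<theta> :: real in at_top. 13 \<le> ln \<theta>" by real_asymp
  have 4: "\<forall>\<^sub>F \<theta> :: real in at_top. 16 * (ln \<theta>)\<^sup>2 \<le> \<theta>" by real_asymp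
  show ?thesis
    using 1 2 3 4 eventually_center_bounds eventually_ge_at_top[of 3] eventually_a_pos
  proof eventually_elim
    case (elim \<theta>)
    interpret stick_model \<alpha> \<theta> "M \<theta>" "U \<theta>" using elim by (intro stick_model) simp
    have R: "0 < R \<theta>" using elim by simp
    have Y_less: "Y \<theta> \<omega> n < - \<delta> \<longleftrightarrow> PD_sequence (U \<theta>) \<omega> n < (\<beta> \<theta> - \<delta> * R \<theta>) / \<theta>" for \<omega>
      using elim by (simp add: Y_def field_simps)
    show ?case
    proof (cases "\<beta> \<theta> \<le> \<delta> * R \<theta>")
      case True
      have "AE \<omega> in M \<theta>. \<omega> \<notin> {\<omega>\<in>space (M \<theta>). Y \<theta> \<omega> n < - \<delta>}"
        using AE_PD_sequence
      proof eventually_elim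
        case 2: (elim \<omega>)
        have "0 < PD_sequence (U \<theta>) \<omega> n"
          unfolding descending_rearrangement_less_iff[OF conjunct2[OF 2]]
          using 2 by (intro exI[of _ "{..n}"]) (auto intro: stick_breaking_pos)
        moreover have "(\<beta> \<theta> - \<delta> * R \<theta>) / \<theta> \<le> 0" using True elim by (intro divide_nonpos_pos) auto
        ultimately show ?case unfolding Y_less by auto
      qed
      then have "prob {\<omega>\<in>space (M \<theta>). Y \<theta> \<omega> n < - \<delta>} = 0"
        using measurable_Y[of \<theta> n] elim by (intro prob_eq_0[THEN iffD2]) auto
      then show ?thesis by simp
    next
      case False
      define z where "z = \<delta> * R \<theta> / 2"
      have half: "0 < q / 2" "q / 2 \<le> \<beta> \<theta>" if "0 < q" "\<not> \<beta> \<theta> \<le> q" for q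
        using that by auto
      have pos: "q / 2 \<le> q" if "q = \<delta> * R \<theta>" for q
        using that mult_pos_pos[OF \<delta> R] by simp
      have z: "0 < z" "z \<le> \<beta> \<theta>"
        unfolding z_def by (intro half mult_pos_pos \<delta> R False)+
      have "prob {\<omega>\<in>space (M \<theta>). Y \<theta> \<omega> n < - \<delta>} \<le> prob {\<omega>\<in>space (M \<theta>). PD_sequence (U \<theta>) \<omega> n < (\<beta> \<theta> - z) / \<theta>}"
      proof (intro finite_measure_mono subsetI)
        fix \<omega> assume \<omega>: "\<omega> \<in> {\<omega>\<in>space (M \<theta>). Y \<theta> \<omega> n < - \<delta>}"
        have "(\<beta> \<theta> - \<delta> * R \<theta>) / \<theta> \<le> (\<beta> \<theta> - z) / \<theta>"
          unfolding z_def using pos elim by (intro divide_right_mono diff_left_mono) auto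
        then show "\<omega> \<in> {\<omega>\<in>space (M \<theta>). PD_sequence (U \<theta>) \<omega> n < (\<beta> \<theta> - z) / \<theta>}"
          using \<omega> unfolding Y_less by auto
      qed measurable
      also have "\<dots> \<le> exp (- (\<theta> / ln \<theta>)) + exp (real n - exp (z - 18) / 8)"
        using z elim by (intro prob_coordinate_small_le) auto
      also have "exp (real n - exp (z - 18) / 8) \<le> exp (- K * R \<theta>) / 2"
        using elim(1) by (simp add: z_def)
      also have "exp (- (\<theta> / ln \<theta>)) \<le> exp (- K * R \<theta>) / 2"
      proof -
        \<comment> \<open>In this regime \<open>R \<theta> \<le> ln \<theta> / \<delta>\<close>, and
          \<open>\<theta> / ln \<theta>\<close> eventually exceeds any multiple of that.\<close>
        have "\<delta> * R \<theta> \<le> ln \<theta>" using False elim(5) by linarith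
        then have "R \<theta> \<le> ln \<theta> / \<delta>" using \<delta> by (simp add: pos_le_divide_eq mult.commute)
        then have "\<bar>K\<bar> * R \<theta> \<le> \<bar>K\<bar> * (ln \<theta> / \<delta>)" by (intro mult_left_mono) auto
        moreover have "K * R \<theta> \<le> \<bar>K\<bar> * R \<theta>" using R by (intro mult_right_mono) auto
        ultimately have "- (\<theta> / ln \<theta>) \<le> - (K * R \<theta>) - ln 2" using elim(2) by linarith
        then have "exp (- (\<theta> / ln \<theta>)) \<le> exp (- (K * R \<theta>) - ln 2)" by (simp only: exp_le_cancel_iff)
        then show ?thesis by (simp add: exp_diff)
      qed
      finally show ?thesis by simp
    qed
  qed
qed

lemma eventually_prob_above_ge:
  fixes n :: nat and v :: "nat \<Rightarrow> real"
  assumes v: "\<And>k. k < n \<Longrightarrow> 0 \<le> v k" "\<And>k l. k \<le> l \<Longrightarrow> l < n \<Longrightarrow> v l \<le> v k" and \<epsilon>: "0 < \<epsilon>"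
  shows "\<forall>\<^sub>F \<theta> in at_top. exp (- ((\<Sum>k<n. v k) + \<epsilon>) * R \<theta>) \<le>
    measure (M \<theta>) {\<omega>\<in>space (M \<theta>). \<forall>k<n. v k < Y \<theta> \<omega> k}"
proof (cases "n = 0")
  case True
  show ?thesis
    using eventually_ge_at_top[of 2] eventually_a_pos
  proof eventually_elim
    case (elim \<theta>)
    interpret stick_model \<alpha> \<theta> "M \<theta>" "U \<theta>" using elim by (intro stick_model) simp
    show ?case using elim \<epsilon> True by (simp add: prob_space)
  qed
next
  case False
  then have n: "0 < n" by simp
  \<comment> \<open>Each of the \<open>n\<close> coordinates may lose \<open>2 * e\<close> of rate:
    one \<open>e\<close> for raising the window, one for the corrections collected in
    \<open>G\<close>.\<close>
  define e where "e = \<epsilon> / (2 * real n)"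
  have e: "0 < e" using \<epsilon> n by (simp add: e_def)
  define V where "V = v 0 + e"
  have V: "0 \<le> V" using v(1)[of 0] n e by (simp add: V_def)
  define r where "r \<theta> = a \<theta> / \<theta>" for \<theta>
  define b where "b \<theta> = 1 / a \<theta>" for \<theta>
  have r: "(r \<longlongrightarrow> 0) at_top" using speed_0 by (simp add: r_def[abs_def])
  have b: "(b \<longlongrightarrow> 0) at_top" using inverse_a_tendsto by (simp add: b_def[abs_def])
  \<comment> \<open>\<open>X\<close> dominates all window positions. \<open>D\<close> is
    \<open>(X + 1) / \<theta>\<close>; \<open>R * Q\<close>, \<open>R * F\<close> and
    \<open>R * G\<close> are \<open>(X + 1)\<^sup>2 / \<theta>\<close>, the loss from removed
    length, and the total loss in the exponent. They are expanded into products with known limits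
    because neither \<open>ln \<theta>\<close> nor \<open>R\<close> dominates the other.\<close>
  define X where "X \<theta> = ln \<theta> + V * R \<theta>" for \<theta>
  define D where "D \<theta> = (ln \<theta> + 1) / \<theta> + V * b \<theta>" for \<theta>
  define Q where "Q \<theta> = (ln \<theta> + 1)\<^sup>2 / \<theta> * r \<theta> + 2 * V * ((ln \<theta> + 1) / \<theta>) + V\<^sup>2 * b \<theta>" for \<theta>
  define F where "F \<theta> = real n * (6 * r \<theta> + 6 * V * (1 / ln \<theta>) + ln \<theta> * (ln \<theta> + 1) / \<theta> * r \<theta> + V * ((ln \<theta> + 1) / \<theta>) +
      V * (ln \<theta> / \<theta>) + V\<^sup>2 * b \<theta>)" for \<theta>
  define G where "G \<theta> = r \<theta> * (1 + ln 16) + (r \<theta> * ((ln \<theta> + 1) / ln \<theta>) + V * (1 / ln \<theta>)) +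
      real n * (r \<theta> * ((ln \<theta> + 1) / ln \<theta>) + V * (1 / ln \<theta>)) * (1 + 2 * D \<theta>) + 2 * Q \<theta>" for \<theta>
  have l: "((\<lambda>\<theta>::real. (ln \<theta> + 1) / \<theta>) \<longlongrightarrow> 0) at_top" "((\<lambda>\<theta>::real. ln \<theta> / \<theta>) \<longlongrightarrow> 0) at_top"
    "((\<lambda>\<theta>::real. (ln \<theta> + 1)\<^sup>2 / \<theta>) \<longlongrightarrow> 0) at_top" "((\<lambda>\<theta>::real. ln \<theta> * (ln \<theta> + 1) / \<theta>) \<longlongrightarrow> 0) at_top"
    "((\<lambda>\<theta>::real. 1 / ln \<theta>) \<longlongrightarrow> 0) at_top" "((\<lambda>\<theta>::real. (ln \<theta> + 1) / ln \<theta>) \<longlongrightarrow> 1) at_top"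
    by - real_asymp+
  have D: "(D \<longlongrightarrow> 0 + V * 0) at_top"
    unfolding D_def[abs_def] by (intro tendsto_intros l b)
  have Q: "(Q \<longlongrightarrow> 0 * 0 + 2 * V * 0 + V\<^sup>2 * 0) at_top"
    unfolding Q_def[abs_def] by (intro tendsto_intros l b r)
  have "(F \<longlongrightarrow> real n * (6 * 0 + 6 * V * 0 + 0 * 0 + V * 0 + V * 0 + V\<^sup>2 * 0)) at_top"
    unfolding F_def[abs_def] by (intro tendsto_intros l b r)
  then have F: "\<forall>\<^sub>F \<theta> in at_top. F \<theta> < e / 2"
    using e by (intro order_tendstoD(2)[of F 0]) simp_all
  have "(G \<longlongrightarrow> 0 * (1 + ln 16) + (0 * 1 + V * 0) + real n * (0 * 1 + V * 0) * (1 + 2 * (0 + V * 0)) +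
      2 * (0 * 0 + 2 * V * 0 + V\<^sup>2 * 0)) at_top"
    unfolding G_def[abs_def] by (intro tendsto_intros l r D Q)
  then have G: "\<forall>\<^sub>F \<theta> in at_top. G \<theta> < e"
    using e by (intro order_tendstoD(2)[of G 0]) simp_all
  have D': "\<forall>\<^sub>F \<theta> in at_top. D \<theta> < 1 / 4"
    using D by (intro order_tendstoD(2)[of D 0]) simp_all
  obtain C where C: "\<forall>\<^sub>F \<theta> in at_top. stick_model.excess_const \<alpha> \<theta> (1 / 2) (\<beta> \<theta>) \<le> C"
    using excess_const_bounded[of "1 / 2"] by auto
  have "\<forall>\<^sub>F x in at_top. C * exp (- (1 / 2) * (e * x)) \<le> 1" using e by real_asymp
  from eventually_compose_filterlim[OF this R_at_top]
  have C': "\<forall>\<^sub>F \<theta> in at_top. C * exp (- (1 / 2) * (e * R \<theta>)) \<le> 1" .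
  have 3: "\<forall>\<^sub>F \<theta> :: real in at_top. 8 \<le> ln \<theta>" by real_asymp
  have 4: "\<forall>\<^sub>F \<theta> :: real in at_top. 2 * ln \<theta> \<le> \<theta>" by real_asymp
  show ?thesis
    using F G D' C C' 3 4 eventually_center_bounds eventually_ge_at_top[of 3] eventually_a_pos
  proof eventually_elim
    case (elim \<theta>)
    interpret stick_model \<alpha> \<theta> "M \<theta>" "U \<theta>" using elim by (intro stick_model) simp
    define L where "L = ln \<theta>"
    have pos: "0 < a \<theta>" "0 < \<theta>" "0 < L" "0 < R \<theta>" using elim by (auto simp: L_def)
    have XD: "(X \<theta> + 1) / \<theta> = D \<theta>"
      using pos by (simp add: X_def D_def b_def field_simps)
    have XL: "(X \<theta> + 1) / L = R \<theta> * (r \<theta> * ((ln \<theta> + 1) / ln \<theta>) + V * (1 / ln \<theta>))"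
      using pos by (simp add: X_def r_def L_def[symmetric] field_simps)
    have XQ: "(X \<theta> + 1) * ((X \<theta> + 1) / \<theta>) = R \<theta> * Q \<theta>"
      using pos by (simp add: X_def Q_def r_def b_def L_def[symmetric] power2_eq_square field_simps)
    have XF: "real n * (6 / L + D \<theta>) * X \<theta> = R \<theta> * F \<theta>"
      using pos by (simp add: X_def D_def F_def r_def b_def L_def[symmetric] power2_eq_square field_simps)
    \<comment> \<open>Windows start at level \<open>v k + e\<close> but the target is only
      \<open>v k + e / 2\<close>: the gap pays for the removed length through
      \<open>F \<theta> < e / 2\<close>, and the other half makes the final inequality
      strict.\<close>
    define x where "x k = \<beta> \<theta> + (v k + e) * R \<theta>" for k
    define y where "y k = \<beta> \<theta> + (v k + e / 2) * R \<theta>" for k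
    have vV: "v k + e \<le> V" if "k < n" for k using v(2)[of 0 k] that by (simp add: V_def)
    have xX: "x k \<le> X \<theta>" if "k < n" for k
      using mult_right_mono[OF vV[OF that], of "R \<theta>"] pos elim by (simp add: x_def X_def)
    have x0: "\<beta> \<theta> + e * R \<theta> \<le> x k" if "k < n" for k
      using mult_right_mono[of e "v k + e" "R \<theta>"] v(1)[OF that] pos by (simp add: x_def)
    have x00: "0 \<le> x k" if "k < n" for k
      using x0[OF that] mult_pos_pos[OF e pos(4)] elim by linarith
    have X0: "0 \<le> X \<theta>" using pos V by (simp add: X_def L_def[symmetric])
    have D0: "0 \<le> D \<theta>" using XD X0 pos by (metis add_nonneg_nonneg divide_nonneg_pos zero_le_one)
    have "exp (- ((\<Sum>k<n. v k) + \<epsilon>) * R \<theta>) = (\<Prod>k<n. exp (- (v k + 2 * e) * R \<theta>))"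
    proof -
      have "(\<Sum>k<n. - (v k + 2 * e) * R \<theta>) = - (\<Sum>k<n. v k + 2 * e) * R \<theta>"
        by (simp only: sum_distrib_right[symmetric] sum_negf)
      also have "(\<Sum>k<n. v k + 2 * e) = (\<Sum>k<n. v k) + \<epsilon>"
        using n by (simp add: sum.distrib e_def)
      finally show ?thesis by (simp only: exp_sum[OF finite_lessThan, symmetric])
    qed
    also have "\<dots> \<le> (\<Prod>k<n. exp (\<beta> \<theta> - (x k + 1) / ln \<theta> - (1 + real n / ln \<theta>) * (x k + 1) * (1 + 2 * (x k + 1) / \<theta>)) / 16)"
    proof (intro prod_mono conjI)
      fix k assume "k \<in> {..<n}"
      then have k: "k < n" by simp
      have 1: "(x k + 1) / L \<le> (X \<theta> + 1) / L"
        using xX[OF k] pos by (intro divide_right_mono) auto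
      have 2: "(x k + 1) * (2 * (x k + 1) / \<theta>) \<le> 2 * ((X \<theta> + 1) * ((X \<theta> + 1) / \<theta>))"
      proof -
        have "(x k + 1) * (2 * (x k + 1) / \<theta>) \<le> (X \<theta> + 1) * (2 * (X \<theta> + 1) / \<theta>)"
          using xX[OF k] x00[OF k] pos by (intro mult_mono divide_right_mono) auto
        then show ?thesis by (simp only: times_divide_eq_right mult_ac)
      qed
      have 3: "real n * ((x k + 1) / L) * (1 + 2 * (x k + 1) / \<theta>) \<le> real n * ((X \<theta> + 1) / L) * (1 + 2 * D \<theta>)"
      proof -
        have "2 * (x k + 1) / \<theta> \<le> 2 * ((X \<theta> + 1) / \<theta>)"
          using xX[OF k] pos by (simp add: divide_right_mono)
        then show ?thesis
          using xX[OF k] x00[OF k] pos X0 XD 1 by (intro mult_mono mult_left_mono add_left_mono) auto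
      qed
      have "(1 + real n / L) * A * (1 + d) = A + A * d + real n * (A / L) * (1 + d)" for A d
        by (simp add: algebra_simps)
      then have "(1 + real n / L) * (x k + 1) * (1 + 2 * (x k + 1) / \<theta>) =
          (x k + 1) + (x k + 1) * (2 * (x k + 1) / \<theta>) + real n * ((x k + 1) / L) * (1 + 2 * (x k + 1) / \<theta>)"
        .
      also have "\<dots> \<le> (x k + 1) + 2 * (R \<theta> * Q \<theta>) + real n * ((X \<theta> + 1) / L) * (1 + 2 * D \<theta>)"
        using 2 3 XQ by linarith
      finally have 4: "(1 + real n / L) * (x k + 1) * (1 + 2 * (x k + 1) / \<theta>) \<le>
        (x k + 1) + 2 * (R \<theta> * Q \<theta>) + real n * ((X \<theta> + 1) / L) * (1 + 2 * D \<theta>)" .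
      have "R \<theta> * G \<theta> = 1 + ln 16 + (X \<theta> + 1) / L + real n * ((X \<theta> + 1) / L) * (1 + 2 * D \<theta>) + 2 * (R \<theta> * Q \<theta>)"
      proof -
        have "R \<theta> * r \<theta> = 1" using pos by (simp add: r_def)
        then show ?thesis unfolding XL G_def by algebra
      qed
      moreover have "R \<theta> * G \<theta> \<le> R \<theta> * e" using elim pos by (intro mult_left_mono) auto
      ultimately have "(x k + 1) / L + (1 + real n / L) * (x k + 1) * (1 + 2 * (x k + 1) / \<theta>) + ln 16
          \<le> x k + R \<theta> * e"
        using 1 4 by linarith
      moreover have "- (v k + 2 * e) * R \<theta> = \<beta> \<theta> - x k - R \<theta> * e"
        unfolding x_def by algebra
      ultimately have "- (v k + 2 * e) * R \<theta> \<le>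
          \<beta> \<theta> - (x k + 1) / L - (1 + real n / L) * (x k + 1) * (1 + 2 * (x k + 1) / \<theta>) - ln 16"
        by linarith
      then have "exp (- (v k + 2 * e) * R \<theta>) \<le>
          exp (\<beta> \<theta> - (x k + 1) / L - (1 + real n / L) * (x k + 1) * (1 + 2 * (x k + 1) / \<theta>) - ln 16)"
        by (simp only: exp_le_cancel_iff)
      also have "\<dots> = exp (\<beta> \<theta> - (x k + 1) / L - (1 + real n / L) * (x k + 1) * (1 + 2 * (x k + 1) / \<theta>)) / 16"
        by (subst exp_diff) simp
      finally show "exp (- (v k + 2 * e) * R \<theta>) \<le>
          exp (\<beta> \<theta> - (x k + 1) / ln \<theta> - (1 + real n / ln \<theta>) * (x k + 1) * (1 + 2 * (x k + 1) / \<theta>)) / 16"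
        by (simp add: L_def)
    qed simp
    also have "\<dots> \<le> prob {\<omega>\<in>space (M \<theta>). \<forall>k<n. y k / \<theta> \<le> PD_sequence (U \<theta>) \<omega> k}"
    proof (rule prob_coordinates_large_ge[OF n])
      show "2 * ln \<theta> \<le> \<theta>" "6 \<le> ln \<theta>" "2 \<le> \<beta> \<theta>" using elim by auto
      show "\<beta> \<theta> + e * R \<theta> \<le> x k" "x k \<le> X \<theta>" if "k < n" for k using x0 xX that by auto
      show "0 < e * R \<theta>" using e pos by simp
      have "excess_const (1 / 2) (\<beta> \<theta>) * exp (- (1 / 2) * (e * R \<theta>)) \<le> C * exp (- (1 / 2) * (e * R \<theta>))"
        using elim by (intro mult_right_mono) auto
      then show "excess_const (1 / 2) (\<beta> \<theta>) * exp (- (1 / 2) * (e * R \<theta>)) \<le> 1" using elim(5) by linarith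
      have "X \<theta> + 1 = D \<theta> * \<theta>" using XD pos by (simp add: field_simps)
      also have "\<dots> \<le> 1 / 4 * \<theta>" using elim(3) pos by (intro mult_right_mono) auto
      finally show "2 * (X \<theta> + 1) \<le> \<theta>" using pos(2) by simp
      have "6 / ln \<theta> \<le> 6 / 8" using elim(6) by (intro divide_left_mono) auto
      then show "6 / ln \<theta> + (X \<theta> + 1) / \<theta> \<le> 1" unfolding XD using elim(3) by linarith
      show "y l \<le> y k" if "k \<le> l" "l < n" for k l
        unfolding y_def using v(2)[OF that] pos by (intro add_left_mono mult_right_mono) auto
      fix k assume k: "k < n"
      have "real n * (6 / L + D \<theta>) * x k \<le> real n * (6 / L + D \<theta>) * X \<theta>"
        using xX[OF k] pos D0 by (intro mult_left_mono mult_nonneg_nonneg add_nonneg_nonneg) auto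
      also have "\<dots> \<le> R \<theta> * (e / 2)" unfolding XF using elim pos by (intro mult_left_mono) auto
      finally have "real n * (6 / L + D \<theta>) * x k \<le> R \<theta> * (e / 2)" .
      moreover have "y k = x k - R \<theta> * (e / 2)"
      proof -
        have "(v k + e / 2) * \<rho> = (v k + e) * \<rho> - \<rho> * (e / 2)" for \<rho> by (simp add: algebra_simps)
        then show ?thesis by (simp only: x_def y_def add_diff_eq)
      qed
      moreover have "(1 - real n * (6 / L + D \<theta>)) * x k = x k - real n * (6 / L + D \<theta>) * x k"
        by (simp only: left_diff_distrib mult_1)
      ultimately show "y k \<le> (1 - real n * (6 / ln \<theta> + (X \<theta> + 1) / \<theta>)) * x k"
        unfolding XD L_def[symmetric] by linarith
    qed
    also have "\<dots> \<le> prob {\<omega>\<in>space (M \<theta>). \<forall>k<n. v k < Y \<theta> \<omega> k}"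
    proof (intro finite_measure_mono subsetI)
      fix \<omega> assume \<omega>: "\<omega> \<in> {\<omega>\<in>space (M \<theta>). \<forall>k<n. y k / \<theta> \<le> PD_sequence (U \<theta>) \<omega> k}"
      have "v k < Y \<theta> \<omega> k" if "k < n" for k
      proof -
        have "y k \<le> \<theta> * PD_sequence (U \<theta>) \<omega> k"
          using \<omega> that pos by (simp add: field_simps)
        then have "(v k + e / 2) * R \<theta> \<le> \<theta> * PD_sequence (U \<theta>) \<omega> k - \<beta> \<theta>" by (simp add: y_def)
        then have "v k + e / 2 \<le> Y \<theta> \<omega> k"
          unfolding Y_eq[OF pos(1,2)] using pos(4) by (simp only: pos_le_divide_eq)
        then show ?thesis using e by simp
      qed
      then show "\<omega> \<in> {\<omega>\<in>space (M \<theta>). \<forall>k<n. v k < Y \<theta> \<omega> k}" using \<omega> by simp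
    next
      have [measurable]: "(\<lambda>\<omega>. Y \<theta> \<omega> k) \<in> borel_measurable (M \<theta>)" for k
        using elim by (intro measurable_Y) simp
      show "{\<omega>\<in>space (M \<theta>). \<forall>k<n. v k < Y \<theta> \<omega> k} \<in> sets (M \<theta>)" by measurable
    qed
    finally show ?case .
  qed
qed

end

section \<open>The large deviation principle\<close>

lemma tendsto_fun_iff:
  fixes f :: "'c \<Rightarrow> 'a \<Rightarrow> 'b::topological_space"
  shows "(f \<longlongrightarrow> l) F \<longleftrightarrow> (\<forall>i. ((\<lambda>n. f n i) \<longlongrightarrow> l i) F)"
proof -
  have "limitin (product_topology (\<lambda>i. euclidean) UNIV) f l F \<longleftrightarrow> (\<forall>i. ((\<lambda>n. f n i) \<longlongrightarrow> l i) F)"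
    by (simp add: limitin_componentwise)
  then show ?thesis by (simp add: euclidean_product_topology)
qed

lemma compact_cube: "compact {x :: nat \<Rightarrow> real. \<forall>i. x i \<in> {c..d}}"
proof -
  have "compactin (product_topology (\<lambda>i::nat. euclideanreal) UNIV) (PiE UNIV (\<lambda>i. {c..d}))"
    by (subst compactin_PiE) auto
  moreover have "PiE UNIV (\<lambda>i. {c..d}) = {x :: nat \<Rightarrow> real. \<forall>i. x i \<in> {c..d}}"
    by (auto simp: PiE_def)
  ultimately show ?thesis by (simp add: euclidean_product_topology)
qed

text \<open>Disjointness becomes a uniform gap on finitely many coordinates, the form in which
  coordinatewise estimates can be applied. If every gap failed, a convergent subsequence in
  \<open>K\<close> would drag the points of \<open>C\<close> to the same limit. It serves level sets
  for the upper bound and single points for the lower bound.\<close>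

lemma compact_closed_separated:
  fixes K C :: "(nat \<Rightarrow> real) set"
  assumes "compact K" "closed C" "K \<inter> C = {}"
  shows "\<exists>n. \<exists>\<delta>>0. \<forall>y\<in>C. \<forall>x\<in>K. \<exists>i<n. \<delta> \<le> \<bar>y i - x i\<bar>"
proof (rule ccontr)
  assume neg: "\<not> ?thesis"
  have "\<exists>y\<in>C. \<exists>x\<in>K. \<forall>i<m. \<bar>y i - x i\<bar> < inverse (real (Suc m))" for m
  proof -
    have "0 < inverse (real (Suc m))" by simp
    with neg show ?thesis by (meson not_le)
  qed
  then obtain y x where y: "\<And>m. y m \<in> C" and x: "\<And>m. x m \<in> K"
    and yx: "\<And>m i. i < m \<Longrightarrow> \<bar>y m i - x m i\<bar> < inverse (real (Suc m))"
    by metis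
  have "seq_compact K" using assms(1) by (simp add: compact_eq_seq_compact_metric)
  then obtain l s where l: "l \<in> K" "strict_mono s" "(x \<circ> s) \<longlonglongrightarrow> l"
    using x unfolding seq_compact_def by blast
  have "(y \<circ> s) \<longlonglongrightarrow> l"
    unfolding tendsto_fun_iff
  proof
    fix i
    have "(\<lambda>m. y m i - x m i) \<longlonglongrightarrow> 0"
    proof (rule Lim_null_comparison)
      show "\<forall>\<^sub>F m in sequentially. norm (y m i - x m i) \<le> inverse (real (Suc m))"
        using eventually_gt_at_top[of i] by eventually_elim (auto dest: yx)
    qed (rule LIMSEQ_inverse_real_of_nat)
    then have "(\<lambda>m. y (s m) i - x (s m) i) \<longlonglongrightarrow> 0"
      using LIMSEQ_subseq_LIMSEQ[OF _ l(2)] by (force simp: o_def)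
    moreover have "(\<lambda>m. x (s m) i) \<longlonglongrightarrow> l i"
      using l(3) by (simp add: tendsto_fun_iff)
    ultimately have "(\<lambda>m. (y (s m) i - x (s m) i) + x (s m) i) \<longlonglongrightarrow> 0 + l i"
      by (rule tendsto_add)
    then show "(\<lambda>m. (y \<circ> s) m i) \<longlonglongrightarrow> l i" by simp
  qed
  then have "l \<in> C" by (rule closed_sequentially[OF assms(2), rotated]) (simp add: y)
  then show False using l(1) assms(3) by blast
qed

section \<open>Level sets of the rate function\<close>

text \<open>Partial sums involve finitely many coordinates, so level sets become intersections of
  sets closed in the product topology. At \<open>c = \<infinity>\<close> the left side always holds
  and the equivalence would fail.\<close>

lemma PD_rate_le_iff:
  assumes "c \<noteq> \<infinity>"
  shows "PD_rate x \<le> c \<longleftrightarrow> decseq x \<and> (\<forall>i. 0 \<le> x i) \<and> (\<forall>n. ereal (\<Sum>i<n. x i) \<le> c)"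
proof (cases "decseq x \<and> (\<forall>i. 0 \<le> x i)")
  case True
  then have "PD_rate x = (\<Sum>i. ereal (x i))" by (simp add: PD_rate_def)
  moreover have "(\<Sum>i. ereal (x i)) \<le> c \<longleftrightarrow> (\<forall>n. ereal (\<Sum>i<n. x i) \<le> c)"
  proof
    assume "(\<Sum>i. ereal (x i)) \<le> c"
    moreover have "ereal (\<Sum>i<n. x i) \<le> (\<Sum>i. ereal (x i))" for n
      using suminf_upper[of "\<lambda>i. ereal (x i)" n] True by simp
    ultimately show "\<forall>n. ereal (\<Sum>i<n. x i) \<le> c" using order.trans by blast
  next
    assume "\<forall>n. ereal (\<Sum>i<n. x i) \<le> c"
    then show "(\<Sum>i. ereal (x i)) \<le> c" using True by (intro suminf_bound) auto
  qed
  ultimately show ?thesis using True by simp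
qed (use assms in \<open>auto simp: PD_rate_def\<close>)

lemma closed_PD_rate_le: "closed {x. PD_rate x \<le> c}"
proof (cases "c = \<infinity>")
  case False
  have "{x. PD_rate x \<le> c} = {x. \<forall>m n. m \<le> n \<longrightarrow> x n \<le> x m} \<inter> {x. \<forall>i. 0 \<le> x i} \<inter> {x. \<forall>n. ereal (\<Sum>i<n. x i) \<le> c}"
    by (auto simp: PD_rate_le_iff[OF False] decseq_def)
  also have "closed \<dots>"
    by (intro closed_Int closed_Collect_all closed_Collect_imp open_Collect_const closed_Collect_le
        continuous_on_const continuous_on_product_coordinates continuous_on_ereal continuous_on_sum)
  finally show ?thesis .
qed simp

lemma compact_PD_rate_le: "compact {x. PD_rate x \<le> ereal \<gamma>}"
proof -
  have "{x. PD_rate x \<le> ereal \<gamma>} \<subseteq> {x. \<forall>i. x i \<in> {0..\<gamma>}}"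
  proof (intro subsetI CollectI allI)
    fix x i assume "x \<in> {x. PD_rate x \<le> ereal \<gamma>}"
    then have x: "\<And>i. 0 \<le> x i" "(\<Sum>j<Suc i. x j) \<le> \<gamma>" by (auto simp: PD_rate_le_iff simp del: sum.lessThan_Suc)
    have "x i \<le> (\<Sum>j<Suc i. x j)" using x(1) by (intro member_le_sum) auto
    with x show "x i \<in> {0..\<gamma>}" by auto
  qed
  then have "{x. \<forall>i. x i \<in> {0..\<gamma>}} \<inter> {x. PD_rate x \<le> ereal \<gamma>} = {x. PD_rate x \<le> ereal \<gamma>}" by blast
  then show ?thesis using compact_Int_closed[OF compact_cube closed_PD_rate_le] by metis
qed

lemma rate_function_PD_rate: "rate_function PD_rate"
  unfolding rate_function_def
proof (intro conjI allI closed_PD_rate_le)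
  show "0 \<le> PD_rate x" for x by (auto simp: PD_rate_def intro!: suminf_0_le)
qed

lemma ereal_mult_elog_le:
  assumes "0 < r" "0 \<le> p" "p \<le> exp (- \<gamma> / r)"
  shows "ereal r * elog p \<le> ereal (- \<gamma>)"
proof (cases "p = 0")
  case False
  then have "ln p \<le> ln (exp (- \<gamma> / r))" using assms by (subst ln_le_cancel_iff) auto
  then have "r * ln p \<le> - \<gamma>" using assms(1) by (simp add: field_simps)
  then show ?thesis using False by (simp add: elog_def)
qed (use assms in \<open>simp add: elog_def\<close>)

lemma ereal_mult_elog_ge:
  assumes "0 < r" "exp (- \<gamma> / r) \<le> p"
  shows "ereal (- \<gamma>) \<le> ereal r * elog p"
proof -
  have p: "0 < p" using assms(2) exp_gt_zero less_le_trans by blast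
  then have "ln (exp (- \<gamma> / r)) \<le> ln p" using assms by (subst ln_le_cancel_iff) auto
  then have "- \<gamma> \<le> r * ln p" using assms(1) by (simp add: field_simps)
  then show ?thesis using p by (simp add: elog_def)
qed

section \<open>Bounds for closed and open sets\<close>

context PD_family begin

lemma measurable_Y_seq: "2 \<le> \<theta> \<Longrightarrow> Y \<theta> \<in> borel_measurable (M \<theta>)"
  by (intro measurable_coordinatewise_then_product measurable_Y)

lemma measure_law:
  assumes "2 \<le> \<theta>" "A \<in> sets borel"
  shows "measure (distr (M \<theta>) borel (Y \<theta>)) A = measure (M \<theta>) {\<omega>\<in>space (M \<theta>). Y \<theta> \<omega> \<in> A}"
  using measure_distr[OF measurable_Y_seq[OF assms(1)] assms(2)]
  by (simp add: vimage_def Int_def conj_commute)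

lemma AE_decseq_Y:
  assumes "2 \<le> \<theta>" "0 < a \<theta>"
  shows "AE \<omega> in M \<theta>. decseq (Y \<theta> \<omega>)"
  using stick_model.AE_PD_sequence[OF stick_model[OF assms(1)]]
  by eventually_elim (use assms in \<open>auto simp: descending_rearrangement_def decseq_def Y_def\<close>)

text \<open>A level set at some \<open>\<gamma>\<close> strictly between \<open>\<gamma>'\<close>
  and the infimum misses \<open>C\<close>, and being compact it does so with a gap \<delta>. Hence
  reaching \<open>C\<close> forces a coordinate below \<open>- (\<delta> / 2)\<close> or positive
  parts with sum at least \<gamma>.\<close>

lemma eventually_prob_closed_le:
  assumes C: "closed C" and \<gamma>: "0 \<le> \<gamma>'" "ereal \<gamma>' < (INF x\<in>C. PD_rate x)"
  shows "\<forall>\<^sub>F \<theta> in at_top. measure (M \<theta>) {\<omega>\<in>space (M \<theta>). Y \<theta> \<omega> \<in> C} \<le> exp (- \<gamma>' * R \<theta>)"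
proof -
  obtain \<gamma> where \<gamma>': "ereal \<gamma>' < ereal \<gamma>" "ereal \<gamma> < (INF x\<in>C. PD_rate x)"
    using ereal_dense2[OF \<gamma>(2)] by blast
  then have less: "\<gamma>' < \<gamma>" by simp
  have "{x. PD_rate x \<le> ereal \<gamma>} \<inter> C = {}"
    using \<gamma>'(2) by (auto simp: not_le[symmetric] INF_lower2)
  from compact_closed_separated[OF compact_PD_rate_le C this]
  obtain n0 \<delta> where \<delta>: "0 < \<delta>"
    and n0: "\<And>y x. y \<in> C \<Longrightarrow> PD_rate x \<le> ereal \<gamma> \<Longrightarrow> \<exists>i<n0. \<delta> \<le> \<bar>y i - x i\<bar>"
    by blast
  \<comment> \<open>The range is weakened to \<open>i \<le> n\<close> so that a last coordinate
    always exists; the sequence decreases, so a lower bound there covers all earlier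
    coordinates.\<close>
  define n where "n = n0"
  have sep: "\<exists>i\<le>n. \<delta> \<le> \<bar>y i - x i\<bar>" if "y \<in> C" "PD_rate x \<le> ereal \<gamma>" for x y
    using n0[OF that] by (auto simp: n_def intro: less_imp_le)
  have \<delta>2: "0 < \<delta> / 2" using \<delta> by simp
  define \<gamma>2 where "\<gamma>2 = (\<gamma>' + \<gamma>) / 2"
  have \<gamma>2: "0 \<le> \<gamma>2" "\<gamma>' < \<gamma>2" "\<gamma>2 < \<gamma>" using \<gamma> less by (auto simp: \<gamma>2_def)
  have half: "\<forall>\<^sub>F x in at_top. exp (- d * x) \<le> 1 / 2" if "0 < d" for d :: real
    using that by real_asymp
  have "\<forall>\<^sub>F x in at_top. exp (- x) + exp (- (\<gamma>2 - \<gamma>') * x) \<le> 1"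
    using half[of 1] half[of "\<gamma>2 - \<gamma>'"] \<gamma>2(2) by (auto elim: eventually_elim2)
  from eventually_compose_filterlim[OF this R_at_top]
  have "\<forall>\<^sub>F \<theta> in at_top. exp (- R \<theta>) + exp (- (\<gamma>2 - \<gamma>') * R \<theta>) \<le> 1" .
  then show ?thesis
    using eventually_prob_below_le[OF \<delta>2, of n "\<gamma>' + 1"]
      eventually_prob_sum_pos_le[OF \<gamma>2(1,3), of "Suc n"] eventually_ge_at_top[of 2] eventually_a_pos
  proof eventually_elim
    case (elim \<theta>)
    interpret stick_model \<alpha> \<theta> "M \<theta>" "U \<theta>" using elim by (intro stick_model) simp
    let ?A = "{\<omega>\<in>space (M \<theta>). Y \<theta> \<omega> n < - (\<delta> / 2)}"
    let ?B = "{\<omega>\<in>space (M \<theta>). \<gamma> \<le> (\<Sum>i<Suc n. max 0 (Y \<theta> \<omega> i))}"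
    have [measurable]: "(\<lambda>\<omega>. Y \<theta> \<omega> k) \<in> borel_measurable (M \<theta>)" for k
      using elim by (intro measurable_Y) simp
    have "AE \<omega> in M \<theta>. \<omega> \<in> {\<omega>\<in>space (M \<theta>). Y \<theta> \<omega> \<in> C} \<longrightarrow> \<omega> \<in> ?A \<union> ?B"
      using AE_decseq_Y[OF elim(4,5)]
    proof eventually_elim
      case dec: (elim \<omega>)
      show ?case
      proof (intro impI, rule ccontr)
        assume *: "\<omega> \<in> {\<omega>\<in>space (M \<theta>). Y \<theta> \<omega> \<in> C}" "\<omega> \<notin> ?A \<union> ?B"
        define y where "y = Y \<theta> \<omega>"
        \<comment> \<open>The comparison point raises negative coordinates to 0 and cuts off the
          tail. Outside the two bad events it lies in the level set and within
          \<open>\<delta> / 2\<close> of \<open>y\<close> up to \<open>n\<close>, against the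
          gap.\<close>
        define x where "x i = (if i \<le> n then max 0 (y i) else 0)" for i
        have y: "y \<in> C" "- (\<delta> / 2) \<le> y n" "(\<Sum>i<Suc n. max 0 (y i)) < \<gamma>"
          using * by (auto simp: y_def simp del: sum.lessThan_Suc)
        have ymono: "y j \<le> y i" if "i \<le> j" for i j using dec that by (auto simp: y_def decseq_def)
        have "(\<Sum>i<m. x i) \<le> \<gamma>" for m
        proof -
          have "(\<Sum>i<m. x i) \<le> (\<Sum>i<m + Suc n. x i)" by (intro sum_mono2) (auto simp: x_def)
          also have "\<dots> = (\<Sum>i<Suc n. max 0 (y i))"
            by (rule sum.mono_neutral_cong_right) (auto simp: x_def)
          finally show ?thesis using y(3) by simp
        qed
        then have "PD_rate x \<le> ereal \<gamma>"
          using ymono by (auto simp: PD_rate_le_iff decseq_def x_def intro: max.coboundedI2)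
        then obtain i where i: "i \<le> n" "\<delta> \<le> \<bar>y i - x i\<bar>" using sep[OF y(1)] by blast
        then show False using ymono[OF i(1)] y(2) \<delta> by (auto simp: x_def max_def split: if_splits)
      qed
    qed
    then have "prob {\<omega>\<in>space (M \<theta>). Y \<theta> \<omega> \<in> C} \<le> prob (?A \<union> ?B)"
      by (intro finite_measure_mono_AE) measurable
    also have "\<dots> \<le> prob ?A + prob ?B" by (intro measure_Un_le) measurable
    also have "\<dots> \<le> exp (- (\<gamma>' + 1) * R \<theta>) + exp (- \<gamma>2 * R \<theta>)"
      using elim(2,3) \<delta> by simp
    also have "\<dots> = exp (- \<gamma>' * R \<theta>) * (exp (- R \<theta>) + exp (- (\<gamma>2 - \<gamma>') * R \<theta>))"
    proof -
      have "- (\<gamma>' + 1) * \<rho> = - \<gamma>' * \<rho> + - \<rho>" "- \<gamma>2 * \<rho> = - \<gamma>' * \<rho> + - (\<gamma>2 - \<gamma>') * \<rho>" for \<rho>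
        by (simp_all add: algebra_simps)
      then show ?thesis by (simp only: exp_add distrib_left)
    qed
    also have "\<dots> \<le> exp (- \<gamma>' * R \<theta>) * 1" using elim(1) by (intro mult_left_mono) auto
    finally show ?case by simp
  qed
qed

text \<open>Lower bounds on coordinates do not confine the sequence near \<open>x\<close>, but it
  can only escape upwards. An escape raises the sum of positive parts from \<open>S\<close> to at
  least \<open>S + (\<epsilon> - \<eta>)\<close>, an event of strictly worse rate that can be
  subtracted.\<close>

lemma eventually_prob_open_ge:
  assumes G: "open G" "x \<in> G" and \<gamma>: "PD_rate x < ereal \<gamma>"
  shows "\<forall>\<^sub>F \<theta> in at_top. exp (- \<gamma> * R \<theta>) \<le> measure (M \<theta>) {\<omega>\<in>space (M \<theta>). Y \<theta> \<omega> \<in> G}"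
proof -
  have "closed (- G)" "{x} \<inter> - G = {}" using G by auto
  from compact_closed_separated[OF _ this]
  obtain n \<epsilon> where \<epsilon>: "0 < \<epsilon>" and sep: "\<And>y. y \<notin> G \<Longrightarrow> \<exists>i<n. \<epsilon> \<le> \<bar>y i - x i\<bar>"
    by auto
  have x: "decseq x" "\<And>i. 0 \<le> x i" using \<gamma> by (auto simp: PD_rate_def split: if_splits)
  obtain s where s: "PD_rate x \<le> ereal s" "s < \<gamma>"
    using ereal_dense2[OF \<gamma>] by (auto intro: less_imp_le)
  have sum_x: "(\<Sum>k<n. x k) \<le> s" using s(1) by (simp add: PD_rate_le_iff)
  define \<eta> where "\<eta> = min (\<epsilon> / 2) ((\<gamma> - s) / (2 * real (Suc n)))"
  have \<eta>: "0 < \<eta>" "\<eta> \<le> \<epsilon> / 2"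
    using \<epsilon> s(2) unfolding \<eta>_def by (simp only: min_less_iff_conj, simp) (rule min.cobounded1)
  have n\<eta>: "real n * \<eta> \<le> (\<gamma> - s) / 2"
  proof -
    have "real n * \<eta> \<le> real (Suc n) * ((\<gamma> - s) / (2 * real (Suc n)))"
      using \<eta> s(2) by (intro mult_mono) (auto simp: \<eta>_def)
    then show ?thesis by (simp del: of_nat_Suc)
  qed
  define v where "v k = x k + \<eta>" for k
  define S where "S = (\<Sum>k<n. v k)"
  have "0 \<le> v k" for k using \<eta>(1) x(2)[of k] by (simp add: v_def)
  then have "0 \<le> S" by (simp add: S_def sum_nonneg)
  moreover have "S = (\<Sum>k<n. x k) + real n * \<eta>" by (simp add: S_def v_def sum.distrib)
  ultimately have S: "0 \<le> S" "S \<le> s + (\<gamma> - s) / 2" using add_mono[OF sum_x n\<eta>] by simp_all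
  \<comment> \<open>\<open>2 * e\<close> must fit into \<open>\<gamma> - S\<close>, for the final
    rate, and into \<open>\<epsilon> / 4\<close>, for the subtracted term to be negligible.\<close>
  define e where "e = min ((\<gamma> - s) / 4) (\<epsilon> / 8)"
  have "0 < e" using \<epsilon> s(2) by (simp add: e_def)
  moreover have "e \<le> (\<gamma> - s) / 4" "e \<le> \<epsilon> / 8"
    unfolding e_def by (rule min.cobounded1, rule min.cobounded2)
  ultimately have e: "0 < e" "e \<le> (\<gamma> - s) / 4" "e \<le> \<epsilon> / 8" .
  have "\<forall>\<^sub>F \<theta> in at_top. exp (- (S + e) * R \<theta>) \<le> measure (M \<theta>) {\<omega>\<in>space (M \<theta>). \<forall>k<n. v k < Y \<theta> \<omega> k}"
    unfolding S_def using x \<eta> e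
    by (intro eventually_prob_above_ge) (auto simp: v_def decseq_def add_nonneg_nonneg)
  moreover have "\<forall>\<^sub>F \<theta> in at_top. measure (M \<theta>) {\<omega>\<in>space (M \<theta>). S + (\<epsilon> - \<eta>) \<le> (\<Sum>i<n. max 0 (Y \<theta> \<omega> i))} \<le>
      exp (- (S + \<epsilon> / 4) * R \<theta>)"
    using \<eta> \<epsilon> S by (intro eventually_prob_sum_pos_le) auto
  moreover have "\<forall>\<^sub>F \<theta> in at_top. exp (- e * R \<theta>) \<le> 1 / 2"
  proof -
    have "\<forall>\<^sub>F r in at_top. exp (- e * r) \<le> 1 / 2" using e by real_asymp
    from eventually_compose_filterlim[OF this R_at_top] show ?thesis .
  qed
  ultimately show ?thesis
    using eventually_ge_at_top[of 2] eventually_a_pos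
  proof eventually_elim
    case (elim \<theta>)
    interpret stick_model \<alpha> \<theta> "M \<theta>" "U \<theta>" using elim by (intro stick_model) simp
    let ?A = "{\<omega>\<in>space (M \<theta>). \<forall>k<n. v k < Y \<theta> \<omega> k}"
    let ?B = "{\<omega>\<in>space (M \<theta>). S + (\<epsilon> - \<eta>) \<le> (\<Sum>i<n. max 0 (Y \<theta> \<omega> i))}"
    let ?G = "{\<omega>\<in>space (M \<theta>). Y \<theta> \<omega> \<in> G}"
    have [measurable]: "(\<lambda>\<omega>. Y \<theta> \<omega> k) \<in> borel_measurable (M \<theta>)" for k
      using elim by (intro measurable_Y) simp
    have [measurable]: "?G \<in> sets (M \<theta>)"
      using measurable_sets[OF measurable_Y_seq[OF elim(4)], of G] G(1)
      by (simp add: vimage_def Int_def conj_commute)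
    have R: "0 < R \<theta>" using elim by simp
    have "?A \<subseteq> ?G \<union> ?B"
    proof
      fix \<omega> assume \<omega>: "\<omega> \<in> ?A"
      define y where "y = Y \<theta> \<omega>"
      have yv: "v k < y k" if "k < n" for k using \<omega> that by (simp add: y_def)
      show "\<omega> \<in> ?G \<union> ?B"
      proof (rule ccontr)
        assume *: "\<omega> \<notin> ?G \<union> ?B"
        then obtain i where i: "i < n" "\<epsilon> \<le> \<bar>y i - x i\<bar>"
          using sep[of y] \<omega> by (auto simp: y_def)
        then have yi: "v i + (\<epsilon> - \<eta>) \<le> y i"
          using yv[OF i(1)] \<eta> by (auto simp: v_def abs_if split: if_splits)
        have "S + (\<epsilon> - \<eta>) = (\<Sum>k<n. v k + (if k = i then \<epsilon> - \<eta> else 0))"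
          using i(1) by (simp add: S_def sum.distrib)
        also have "\<dots> \<le> (\<Sum>k<n. max 0 (y k))"
          using yi yv by (intro sum_mono max.coboundedI2) (auto intro: less_imp_le)
        finally show False using * \<omega> by (simp add: y_def)
      qed
    qed
    then have "prob ?A \<le> prob (?G \<union> ?B)" by (intro finite_measure_mono) measurable
    also have "\<dots> \<le> prob ?G + prob ?B" by (intro measure_Un_le) measurable
    \<comment> \<open>With \<open>p = exp (- (S + e) * R \<theta>)\<close>, the subtracted term is
      at most \<open>p * exp (- e * R \<theta>) \<le> p / 2\<close>, and the remaining
      \<open>p / 2\<close> is at least \<open>exp (- \<gamma> * R \<theta>)\<close>.\<close>
    finally have "exp (- (S + e) * R \<theta>) - exp (- (S + \<epsilon> / 4) * R \<theta>) \<le> prob ?G"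
      using elim(1,2) by linarith
    moreover have "exp (- (S + \<epsilon> / 4) * R \<theta>) \<le> exp (- (S + e) * R \<theta>) * exp (- e * R \<theta>)"
    proof -
      have "(S + e + e) * R \<theta> \<le> (S + \<epsilon> / 4) * R \<theta>" using R e by (intro mult_right_mono) auto
      then have "exp (- ((S + \<epsilon> / 4) * R \<theta>)) \<le> exp (- ((S + e + e) * R \<theta>))" 
        by (simp only: exp_le_cancel_iff neg_le_iff_le)
      also have "- ((S + e + e) * \<rho>) = - (S + e) * \<rho> + - e * \<rho>" for \<rho> by (simp add: algebra_simps)
      finally show ?thesis by (simp only: exp_add mult_minus_left)
    qed
    moreover have "exp (- (S + e) * R \<theta>) * exp (- e * R \<theta>) \<le> exp (- (S + e) * R \<theta>) * (1 / 2)"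
      using elim(3) by (intro mult_left_mono) auto
    moreover have "exp (- \<gamma> * R \<theta>) \<le> exp (- (S + e) * R \<theta>) * exp (- e * R \<theta>)"
    proof -
      have "S + e + e \<le> \<gamma>" using e S by (simp add: field_simps)
      then have "(S + e + e) * R \<theta> \<le> \<gamma> * R \<theta>" using R by (intro mult_right_mono) auto
      then have "exp (- (\<gamma> * R \<theta>)) \<le> exp (- ((S + e + e) * R \<theta>))"
        by (simp only: exp_le_cancel_iff neg_le_iff_le)
      also have "- ((S + e + e) * \<rho>) = - (S + e) * \<rho> + - e * \<rho>" for \<rho> by (simp add: algebra_simps)
      finally show ?thesis by (simp only: exp_add mult_minus_left)
    qed
    ultimately show ?case by linarith
  qed
qed

theorem large_deviation_principle_Y:
  "large_deviation_principle at_top (\<lambda>\<theta>. distr (M \<theta>) borel (Y \<theta>)) (\<lambda>\<theta>. a \<theta> / \<theta>) PD_rate"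
  unfolding large_deviation_principle_def
proof (intro conjI allI impI rate_function_PD_rate)
  let ?\<mu> = "\<lambda>\<theta>. distr (M \<theta>) borel (Y \<theta>)"
  show "\<forall>\<^sub>F \<theta> in at_top. prob_space (?\<mu> \<theta>) \<and> sets (?\<mu> \<theta>) = sets borel"
    using eventually_ge_at_top[of 2]
  proof eventually_elim
    case (elim \<theta>)
    interpret stick_model \<alpha> \<theta> "M \<theta>" "U \<theta>" using elim by (intro stick_model)
    show ?case using prob_space_distr[OF measurable_Y_seq[OF elim]] by simp
  qed
  have pos: "\<forall>\<^sub>F \<theta> in at_top. 0 < a \<theta> / \<theta>"
    using eventually_a_pos eventually_gt_at_top[of 0] by eventually_elim simp
  then show "filterlim (\<lambda>\<theta>. a \<theta> / \<theta>) (at_right 0) at_top"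
    using speed_0 unfolding filterlim_at by (auto elim: eventually_mono)
  show "Limsup at_top (\<lambda>\<theta>. ereal (a \<theta> / \<theta>) * elog (measure (?\<mu> \<theta>) C)) \<le> - (INF x\<in>C. PD_rate x)"
    if C: "closed C" for C
  proof (rule dense_ge)
    \<comment> \<open>Testing against reals strictly above the bound provides the slack that the
      estimate for closed sets needs and also covers an infinite infimum.\<close>
    fix z assume "- (INF x\<in>C. PD_rate x) < z"
    then obtain w where w: "- (INF x\<in>C. PD_rate x) < ereal w" "ereal w < z"
      using ereal_dense2 by blast
    have less: "ereal (- w) < (INF x\<in>C. PD_rate x)"
      using iffD1[OF ereal_uminus_less_reorder w(1)] by (simp only: uminus_ereal.simps)
    have "\<forall>\<^sub>F \<theta> in at_top. measure (M \<theta>) {\<omega>\<in>space (M \<theta>). Y \<theta> \<omega> \<in> C} \<le> exp (- (- w) * R \<theta>)"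
    proof (cases "0 \<le> - w")
      case True
      then show ?thesis using less by (rule eventually_prob_closed_le[OF C])
    next
      \<comment> \<open>Positive \<open>w\<close> does occur, for instance when the infimum is 0;
        the claimed bound is then at least 1.\<close>
      case False
      show ?thesis
        using eventually_ge_at_top[of 2] pos
      proof eventually_elim
        case (elim \<theta>)
        interpret stick_model \<alpha> \<theta> "M \<theta>" "U \<theta>" using elim by (intro stick_model) 
        have "0 < a \<theta>" using elim by (simp add: zero_less_divide_iff)
        then have "0 \<le> - (- w) * R \<theta>" using False elim by simp
        then have "1 \<le> exp (- (- w) * R \<theta>)" by (simp only: one_le_exp_iff)
        then show ?case using prob_le_1 order.trans by blast
      qed
    qed
    then have "\<forall>\<^sub>F \<theta> in at_top. ereal (a \<theta> / \<theta>) * elog (measure (?\<mu> \<theta>) C) \<le> ereal w"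
      using pos eventually_ge_at_top[of 2]
    proof eventually_elim
      case (elim \<theta>)
      then show ?case
        using ereal_mult_elog_le[of "a \<theta> / \<theta>" "measure (?\<mu> \<theta>) C" "- w"] C by (simp add: measure_law)
    qed
    then have "Limsup at_top (\<lambda>\<theta>. ereal (a \<theta> / \<theta>) * elog (measure (?\<mu> \<theta>) C)) \<le> ereal w"
      by (rule Limsup_bounded)
    then show "Limsup at_top (\<lambda>\<theta>. ereal (a \<theta> / \<theta>) * elog (measure (?\<mu> \<theta>) C)) \<le> z" using w(2) by simp
  qed
  show "- (INF x\<in>G. PD_rate x) \<le> Liminf at_top (\<lambda>\<theta>. ereal (a \<theta> / \<theta>) * elog (measure (?\<mu> \<theta>) G))"
    if G: "open G" for G
  proof (rule dense_le)
    fix z assume "z < - (INF x\<in>G. PD_rate x)"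
    then obtain w where w: "z < ereal w" "ereal w < - (INF x\<in>G. PD_rate x)"
      using ereal_dense2 by blast
    have "(INF x\<in>G. PD_rate x) < ereal (- w)"
      using iffD1[OF ereal_less_uminus_reorder w(2)] by (simp only: uminus_ereal.simps)
    then obtain x where x: "x \<in> G" "PD_rate x < ereal (- w)" by (auto simp: INF_less_iff)
    have "\<forall>\<^sub>F \<theta> in at_top. ereal w \<le> ereal (a \<theta> / \<theta>) * elog (measure (?\<mu> \<theta>) G)"
      using eventually_prob_open_ge[OF G x] pos eventually_ge_at_top[of 2]
    proof eventually_elim
      case (elim \<theta>)
      then show ?case
        using ereal_mult_elog_ge[of "a \<theta> / \<theta>" "- w" "measure (?\<mu> \<theta>) G"] G by (simp add: measure_law)
    qed
    then have "ereal w \<le> Liminf at_top (\<lambda>\<theta>. ereal (a \<theta> / \<theta>) * elog (measure (?\<mu> \<theta>) G))"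
      by (rule Liminf_bounded)
    then show "z \<le> Liminf at_top (\<lambda>\<theta>. ereal (a \<theta> / \<theta>) * elog (measure (?\<mu> \<theta>) G))" using w(1) by simp
  qed
qed

end

theorem theorem3p4:
  fixes \<alpha> :: real and a :: "real \<Rightarrow> real"
    and M :: "real \<Rightarrow> 'w measure" and U :: "real \<Rightarrow> nat \<Rightarrow> 'w \<Rightarrow> real"
  assumes "0 < \<alpha>" and "\<alpha> < 1"
    and "filterlim a at_top at_top"
    and "((\<lambda>\<theta>. a \<theta> / \<theta>) \<longlongrightarrow> 0) at_top"
    and "\<And>\<theta>. \<theta> > 0 \<Longrightarrow> PD_sticks \<alpha> \<theta> (M \<theta>) (U \<theta>)"
  shows "large_deviation_principle at_top
           (\<lambda>\<theta>. distr (M \<theta>) (borel :: (nat \<Rightarrow> real) measure)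
              (\<lambda>\<omega> n. a \<theta> * (PD_sequence (U \<theta>) \<omega> n - beta_center \<alpha> \<theta> / \<theta>)))
           (\<lambda>\<theta>. a \<theta> / \<theta>)
           PD_rate"
proof -
  interpret PD_family \<alpha> a M U using assms by unfold_locales
  show ?thesis using large_deviation_principle_Y unfolding Y_def[abs_def] .
qed

end
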